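(* Let $\{\varphi_i\}_{1<i<n}$ be a dual equivalence for $(\mathcal{A},\mathrm{Des})$ and let $\mathrm{stat}:\mathcal{A}\to\mathbb{Z}_{\ge0}$ (or to $\mathbb{Z}_{\ge0}^r$, with $q^{\mathrm{stat}}$ the corresponding monomial) satisfy $\mathrm{stat}(\varphi_i(T))=\mathrm{stat}(T)$ for all $i$ and $T$. Then each equivalence class of the relation generated by all $\varphi_i$ contains a unique dominant element, $\alpha(T)$ is a partition for every dominant $T$, and $$f(X;q):=\sum_{T\in\mathcal{A}}q^{\mathrm{stat}(T)}Q_{\mathrm{Des}(T)}(X)=\sum_{T\in\mathrm{Dom}(\mathcal{A})}q^{\mathrm{stat}(T)}s_{\alpha(T)}(X)=\sum_\lambda\Big(\sum_{T\in\mathrm{Dom}(\mathcal{A}),\ \alpha(T)=\lambda}q^{\mathrm{stat}(T)}\Big)s_\lambda(X),$$ where $\mathrm{Dom}(\mathcal{A})$ is the set of dominant elements.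
   Context: $\mathcal{A}$ is a finite set and $\mathrm{Des}(T)\subseteq[n-1]$ for $T\in\mathcal{A}$. For $D\subseteq[n-1]$, $Q_D(X)=\sum x_{i_1}\cdots x_{i_n}$ over $i_1\le\dots\le i_n$ with $i_j<i_{j+1}$ for $j\in D$; $s_\lambda$ is the Schur function. Dual equivalence: for $1<h\le i<n$, $[T]_{h,i}$ is the class of $T$ under the equivalence relation generated by $\varphi_h,\dots,\varphi_i$, and $\mathrm{Des}_{h,i}(U)=\{d-(h-2):d\in\mathrm{Des}(U)\cap\{h-1,\dots,i\}\}\subseteq[i-h+2]$. $\{\varphi_i\}$ (involutions on $\mathcal{A}$) is a dual equivalence if (i) for all $1<h\le i<n$ with $i-h\le3$ and all $T$, $\sum_{U\in[T]_{h,i}}Q_{\mathrm{Des}_{h,i}(U)}(X)=s_\lambda(X)$ for some partition $\lambda$ of $i-h+3$; (ii) $\varphi_i\varphi_j=\varphi_j\varphi_i$ for $|i-j|\ge3$. For $T\in\mathcal{A}$ with $\mathrm{Des}(T)=\{d_1<\dots<d_k\}$, $\alpha(T)$ is the composition $(d_1,d_2-d_1,\dots,d_k-d_{k-1},n-d_k)$ of $n$. Dominance on compositions of $n$: $\alpha\ge\beta$ iff $\alpha_1+\dots+\alpha_j\ge\beta_1+\dots+\beta_j$ for all $j$. $T$ is dominant if $\alpha(T)\ge\alpha(S)$ for every $S$ in the equivalence class of $T$ under the relation generated by all $\varphi_i$. *)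

theory Defs
  imports Main
begin

text \<open>Formal power series in the variables x_0, x_1, ... are represented by their
coefficient functions: a monomial is an exponent vector a :: nat \<Rightarrow> nat.\<close>

text \<open>Coefficient of the monomial x^a in the fundamental quasisymmetric function Q_D of
degree n: the number of index sequences i_1 \<le> ... \<le> i_n (a list of length n) with
i_j < i_(j+1) for j in D whose monomial is x^a.\<close>
definition Qcoef :: "nat \<Rightarrow> nat set \<Rightarrow> (nat \<Rightarrow> nat) \<Rightarrow> int" where
  "Qcoef n D a = int (card {is :: nat list. length is = n \<and> sorted is
      \<and> (\<forall>j\<in>D. is ! (j - 1) < is ! j) \<and> (\<forall>k. count_list is k = a k)})"

definition is_partition :: "nat list \<Rightarrow> bool" where
  "is_partition la \<longleftrightarrow> sorted_wrt (\<ge>) la \<and> (\<forall>x\<in>set la. 0 < x)"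

definition partitions :: "nat \<Rightarrow> nat list set" where
  "partitions n = {la. is_partition la \<and> sum_list la = n}"

definition cells :: "nat list \<Rightarrow> (nat \<times> nat) set" where
  "cells la = {(r, c). r < length la \<and> c < la ! r}"

definition ssyt :: "nat list \<Rightarrow> (nat \<times> nat \<Rightarrow> nat) \<Rightarrow> bool" where
  "ssyt la T \<longleftrightarrow>
     (\<forall>r c. (r, c) \<in> cells la \<longrightarrow>
        ((r, c + 1) \<in> cells la \<longrightarrow> T (r, c) \<le> T (r, c + 1)) \<and>
        ((r + 1, c) \<in> cells la \<longrightarrow> T (r, c) < T (r + 1, c))) \<and>
     (\<forall>x. x \<notin> cells la \<longrightarrow> T x = 0)"

definition schur_coef :: "nat list \<Rightarrow> (nat \<Rightarrow> nat) \<Rightarrow> int" where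
  "schur_coef la a = int (card {T. ssyt la T \<and> (\<forall>k. card {x \<in> cells la. T x = k} = a k)})"

definition gen_rel :: "'a set \<Rightarrow> (nat \<Rightarrow> 'a \<Rightarrow> 'a) \<Rightarrow> nat set \<Rightarrow> ('a \<times> 'a) set" where
  "gen_rel A \<phi> I = {(U, \<phi> j U) | U j. U \<in> A \<and> j \<in> I}"

definition eq_class :: "'a set \<Rightarrow> (nat \<Rightarrow> 'a \<Rightarrow> 'a) \<Rightarrow> nat set \<Rightarrow> 'a \<Rightarrow> 'a set" where
  "eq_class A \<phi> I T = {U. (T, U) \<in> (gen_rel A \<phi> I)\<^sup>*}"

definition Des_hi :: "('a \<Rightarrow> nat set) \<Rightarrow> nat \<Rightarrow> nat \<Rightarrow> 'a \<Rightarrow> nat set" where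
  "Des_hi Des h i U = (\<lambda>d. d - (h - 2)) ` (Des U \<inter> {h - 1..i})"

definition involutions_on :: "nat \<Rightarrow> 'a set \<Rightarrow> (nat \<Rightarrow> 'a \<Rightarrow> 'a) \<Rightarrow> bool" where
  "involutions_on n A \<phi> \<longleftrightarrow>
     (\<forall>i. 1 < i \<and> i < n \<longrightarrow> (\<forall>T\<in>A. \<phi> i T \<in> A \<and> \<phi> i (\<phi> i T) = T))"

definition dual_equivalence :: "nat \<Rightarrow> 'a set \<Rightarrow> ('a \<Rightarrow> nat set) \<Rightarrow> (nat \<Rightarrow> 'a \<Rightarrow> 'a) \<Rightarrow> bool" where
  "dual_equivalence n A Des \<phi> \<longleftrightarrow>
     (\<forall>h i. 1 < h \<and> h \<le> i \<and> i < n \<and> i - h \<le> 3 \<longrightarrow>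
        (\<forall>T\<in>A. \<exists>la. la \<in> partitions (i - h + 3) \<and>
           (\<forall>a. (\<Sum>U\<in>eq_class A \<phi> {h..i} T. Qcoef (i - h + 3) (Des_hi Des h i U) a)
                 = schur_coef la a))) \<and>
     (\<forall>i j. 1 < i \<and> i < n \<and> 1 < j \<and> j < n \<and> (j + 3 \<le> i \<or> i + 3 \<le> j) \<longrightarrow>
        (\<forall>T\<in>A. \<phi> i (\<phi> j T) = \<phi> j (\<phi> i T)))"

definition alpha :: "nat \<Rightarrow> nat set \<Rightarrow> nat list" where
  "alpha n D = (let ds = sorted_list_of_set D in map2 (-) (ds @ [n]) (0 # ds))"

definition dominates :: "nat list \<Rightarrow> nat list \<Rightarrow> bool" where
  "dominates al be \<longleftrightarrow> (\<forall>j. sum_list (take j be) \<le> sum_list (take j al))"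

definition dominant :: "nat \<Rightarrow> 'a set \<Rightarrow> ('a \<Rightarrow> nat set) \<Rightarrow> (nat \<Rightarrow> 'a \<Rightarrow> 'a) \<Rightarrow> 'a \<Rightarrow> bool" where
  "dominant n A Des \<phi> T \<longleftrightarrow> T \<in> A \<and>
     (\<forall>S\<in>eq_class A \<phi> {1<..<n} T. dominates (alpha n (Des T)) (alpha n (Des S)))"

end

theory Submission
  imports Defs "HOL-Library.Multiset"
begin

text \<open>A standard tableau is encoded by its Yamanouchi word, whose \<open>j\<close>-th letter is the row of entry \<open>j\<close>;
  Haiman's elementary dual equivalences become Knuth moves on three consecutive letters. By induction on
  \<open>n\<close>, every class of a dual equivalence is identified, compatibly with descents and involutions, with
  all Yamanouchi words of one shape, so that its generating function is a Schur function and its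
  dominant element is the unique sorted word. On a class of the first \<open>n - 2\<close> involutions the descents
  at \<open>n\<close> determine the row of entry \<open>n + 1\<close>. That the last involution is then a Knuth move follows from
  windows of five entries, since it commutes with all involutions acting on the entries below \<open>n - 1\<close>.
  That the resulting covering map onto the Yamanouchi words is injective is part of the hypothesis up
  to size six; for larger sizes, loops between three corners of the shape can be contracted inside a
  window of six entries.\<close>

section \<open>Yamanouchi words and Knuth moves\<close>

text \<open>Descents only compare neighbouring letters. A letter is therefore located by bringing
  every corner of the preceding shape next to it: two addable rows that no corner separates are
  equal. Whole words are recovered from the descents along all Knuth paths, because a letter of a
  Yamanouchi word is at most the number of descents before it, and only the sorted word attains this
  bound everywhere.

  Above size six, compatibility with Knuth moves does not by itself exclude that several elements of
  one class carry the same word. On a class of the smaller involutions the last letter, the row of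
  the largest entry, is constant, and the last involution joins classes that belong to different
  corners; the whole could be a nontrivial covering of the complete graph on the corners. Loops
  there are generated by triangles through one fixed corner, and the smallest shape with three
  corners is 321, whence windows of six entries. At size six descent sets no longer separate
  tableaux (two of shape 321 have descent set {2, 4}), so there the argument rests on the descent
  set of the sorted word, which occurs only once.\<close>

definition descents :: "nat list \<Rightarrow> nat set" where
  "descents w = {j. 0 < j \<and> j < length w \<and> w ! (j - 1) < w ! j}"

text \<open>\<open>count M r\<close> is the length of row \<open>r\<close>, with rows numbered from
  0. Multisets of rows make adding a cell an \<open>add_mset\<close> and avoid trailing zeros. A
  corner in row \<open>s\<close> is expressed by \<open>count M (Suc s) < count M s\<close>.\<close>

definition is_shape :: "nat multiset \<Rightarrow> bool" where
  "is_shape M \<longleftrightarrow> (\<forall>r. count M (Suc r) \<le> count M r)"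

definition yamanouchi :: "nat list \<Rightarrow> bool" where
  "yamanouchi w \<longleftrightarrow> (\<forall>k. is_shape (mset (take k w)))"

text \<open>Of two equal letters the later one counts as the smaller one: within a row of a tableau the later
  entry stands further to the right.\<close>

definition knuth3 :: "nat \<Rightarrow> nat \<Rightarrow> nat \<Rightarrow> nat list" where
  "knuth3 a b c = (if c \<le> a \<and> a < b \<or> b \<le> a \<and> a < c then [a, c, b]
     else if a < c \<and> c \<le> b \<or> b < c \<and> c \<le> a then [b, a, c] else [a, b, c])"

text \<open>Move \<open>i\<close> involves the entries \<open>i - 1\<close>, \<open>i\<close>,
  \<open>i + 1\<close>, which stand at the list positions \<open>i - 2\<close>,
  \<open>i - 1\<close>, \<open>i\<close>.\<close>

definition knuth :: "nat \<Rightarrow> nat list \<Rightarrow> nat list" where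
  "knuth i w = take (i - 2) w @ knuth3 (w ! (i - 2)) (w ! (i - 1)) (w ! i) @ drop (i + 1) w"

lemma is_shape_empty [simp]: "is_shape {#}"
  by (simp add: is_shape_def)

lemma yamanouchi_Nil [simp]: "yamanouchi []"
  by (simp add: yamanouchi_def)

lemma yamanouchi_snoc [simp]: "yamanouchi (w @ [r]) \<longleftrightarrow> yamanouchi w \<and> is_shape (add_mset r (mset w))"
proof -
  have "is_shape (mset (take k (w @ [r])))" if "yamanouchi w" "is_shape (add_mset r (mset w))" for k
    using that by (cases "k \<le> length w") (auto simp: yamanouchi_def)
  moreover have "is_shape (mset (take k w))" if "yamanouchi (w @ [r])" for k
  proof -
    have "take k w = take (min k (length w)) (w @ [r])" by (simp add: min_def)
    then show ?thesis using that unfolding yamanouchi_def by metis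
  qed
  moreover have "is_shape (add_mset r (mset w))" if "yamanouchi (w @ [r])"
    using that[unfolded yamanouchi_def, rule_format, of "Suc (length w)"] by simp
  ultimately show ?thesis by (auto simp: yamanouchi_def)
qed

lemma yamanouchi_take: "yamanouchi w \<Longrightarrow> yamanouchi (take k w)"
  by (auto simp: yamanouchi_def)

lemma yamanouchi_appendD: "yamanouchi (u @ v) \<Longrightarrow> yamanouchi u"
  using yamanouchi_take[of "u @ v" "length u"] by simp

lemma yamanouchi_dec: "yamanouchi w \<Longrightarrow> is_shape (mset w)"
  unfolding yamanouchi_def by (metis order_refl take_all)

lemma yamanouchi_sort:
  assumes "sorted w" "is_shape (mset w)"
  shows "yamanouchi w"
  unfolding yamanouchi_def is_shape_def
proof (intro allI)
  fix k r
  show "count (mset (take k w)) (Suc r) \<le> count (mset (take k w)) r"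
  proof (cases "Suc r \<in> set (take k w)")
    case False
    then have "count (mset (take k w)) (Suc r) = 0" by simp
    then show ?thesis by (metis le0)
  next
    case True
    have "sorted (take k w @ drop k w)" using assms by simp
    then have "\<forall>x\<in>set (take k w). \<forall>y\<in>set (drop k w). x \<le> y"
      unfolding sorted_append by blast
    then have "r \<notin> set (drop k w)" using True by fastforce
    then have d: "count (mset (drop k w)) r = 0" by simp
    have *: "mset w = mset (take k w) + mset (drop k w)"
      by (metis append_take_drop_id mset_append)
    have "count (mset (take k w)) (Suc r) \<le> count (mset w) (Suc r)" unfolding * by simp
    also have "\<dots> \<le> count (mset w) r" using assms by (simp add: is_shape_def)
    also have "\<dots> = count (mset (take k w)) r" unfolding * using d by simp
    finally show ?thesis .
  qed
qed

lemma ex_yam: "is_shape M \<Longrightarrow> \<exists>w. yamanouchi w \<and> mset w = M"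
  by (rule exI[of _ "sorted_list_of_multiset M"]) (simp add: yamanouchi_sort)

lemma is_shape_add_iff:
  "is_shape M \<Longrightarrow> is_shape (add_mset r M) \<longleftrightarrow> r = 0 \<or> count M r < count M (r - 1)"
  by (cases r) (auto simp: is_shape_def Suc_le_eq le_Suc_eq)

text \<open>An added letter can repair the inequality at \<open>r\<close> only if it equals
  \<open>r\<close>, which cannot hold for both letters.\<close>

lemma is_shape_add_mono:
  assumes "is_shape (add_mset c M)" "is_shape (add_mset c' M)" "c \<noteq> c'"
  shows "is_shape M"
proof -
  have "count M (Suc r) \<le> count M r" for r
    using assms(1)[unfolded is_shape_def, rule_format, of r] assms(2)[unfolded is_shape_def, rule_format, of r]
      assms(3) by (auto split: if_splits)
  then show ?thesis by (simp add: is_shape_def)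
qed

lemma ex_yam_snoc:
  assumes "is_shape M" "count M (Suc s) < count M s"
  shows "\<exists>v. yamanouchi (v @ [s]) \<and> mset (v @ [s]) = M"
proof -
  have s: "s \<in># M" using assms(2) by (metis count_eq_zero_iff not_less0)
  have "is_shape (M - {#s#})" unfolding is_shape_def
  proof
    fix r
    show "count (M - {#s#}) (Suc r) \<le> count (M - {#s#}) r"
      using assms(1)[unfolded is_shape_def, rule_format, of r] assms(2) by (cases "r = s") auto
  qed
  then obtain v where "yamanouchi v" "mset v = M - {#s#}" using ex_yam by blast
  then show ?thesis using assms(1) s by (intro exI[of _ v]) simp
qed

section \<open>Knuth moves are involutions that preserve shape and the Yamanouchi property\<close>

lemma knuth_app: "knuth (length u + 2) (u @ a # b # c # v) = u @ knuth3 a b c @ v"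
  by (simp add: knuth_def nth_append)

lemma knuth_app': "i = length u + 2 \<Longrightarrow> knuth i (u @ a # b # c # v) = u @ knuth3 a b c @ v"
  using knuth_app by simp

lemma knuth_app_Suc:
  "i = length u + 3 \<Longrightarrow> knuth i (u @ x # a # b # c # v) = u @ x # knuth3 a b c @ v"
  using knuth_app'[of i "u @ [x]" a b c v] by simp

lemma split3:
  assumes "2 \<le> i" "i < length w"
  obtains u a b c v where "w = u @ a # b # c # v" "length u = i - 2"
proof -
  have "w = take (i - 2) w @ w ! (i - 2) # w ! (i - 1) # w ! i # drop (i + 1) w"
  proof -
    have "drop (i - 2) w = w ! (i - 2) # w ! (i - 1) # w ! i # drop (i + 1) w"
      using Cons_nth_drop_Suc[of "i - 2" w] Cons_nth_drop_Suc[of "i - 1" w]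
        Cons_nth_drop_Suc[of i w] assms by (simp add: Suc_diff_Suc numeral_2_eq_2)
    then show ?thesis by (metis append_take_drop_id)
  qed
  then show thesis using that assms by (metis length_take less_imp_diff_less min.absorb2 nat_less_le)
qed

lemma knuth3_length [simp]: "length (knuth3 a b c) = 3"
  by (simp add: knuth3_def)

lemma knuth3_mset [simp]: "mset (knuth3 a b c) = {#a, b, c#}"
  by (simp add: knuth3_def)

lemma knuth_length [simp]: "2 \<le> i \<Longrightarrow> i < length w \<Longrightarrow> length (knuth i w) = length w"
  by (simp add: knuth_def)

lemma knuth_mset [simp]:
  assumes "2 \<le> i" "i < length w"
  shows "mset (knuth i w) = mset w"
proof -
  obtain u a b c v where "w = u @ a # b # c # v" "length u = i - 2"
    using split3[OF assms] by metis
  then show ?thesis using knuth_app'[of i u a b c v] assms by simp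
qed

lemma knuth_append:
  assumes "2 \<le> i" "i < length w"
  shows "knuth i (w @ v) = knuth i w @ v"
proof -
  obtain u a b c x where "w = u @ a # b # c # x" "length u = i - 2"
    using split3[OF assms] by metis
  then show ?thesis using knuth_app'[of i u a b c x] knuth_app'[of i u a b c "x @ v"] assms by simp
qed

lemma knuth3_cases:
  "knuth3 a b c = [a, c, b] \<and> (c \<le> a \<and> a < b \<or> b \<le> a \<and> a < c)
    \<or> knuth3 a b c = [b, a, c] \<and> (a < c \<and> c \<le> b \<or> b < c \<and> c \<le> a) \<or> knuth3 a b c = [a, b, c]"
  by (simp add: knuth3_def)

lemma knuth_K:
  assumes "2 \<le> i" "i < length w"
  shows "knuth i (knuth i w) = w"
proof -
  obtain u a b c v where w: "w = u @ a # b # c # v" "length u = i - 2"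
    using split3[OF assms] by metis
  have i: "i = length u + 2" using w assms by simp
  consider "knuth3 a b c = [a, c, b]" "c \<le> a \<and> a < b \<or> b \<le> a \<and> a < c"
    | "knuth3 a b c = [b, a, c]" "a < c \<and> c \<le> b \<or> b < c \<and> c \<le> a" | "knuth3 a b c = [a, b, c]"
    using knuth3_cases[of a b c] by blast
  then show ?thesis
  proof cases
    case 1
    then show ?thesis by (auto simp: w(1) knuth_app'[OF i] knuth3_def)
  next
    case 2
    then show ?thesis by (auto simp: w(1) knuth_app'[OF i] knuth3_def)
  next
    case 3
    then show ?thesis by (auto simp: w(1) knuth_app'[OF i])
  qed
qed

lemma yam3:
  "yamanouchi (u @ [x, y, z]) \<longleftrightarrow> yamanouchi u \<and> is_shape (add_mset x (mset u))
    \<and> is_shape (add_mset y (add_mset x (mset u))) \<and> is_shape (add_mset z (add_mset y (add_mset x (mset u))))"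
proof -
  have "mset (u @ [x, y]) = add_mset y (add_mset x (mset u))"
    "mset (u @ [x]) = add_mset x (mset u)" by simp_all
  then show ?thesis
    using yamanouchi_snoc[of "u @ [x, y]" z] yamanouchi_snoc[of "u @ [x]" y] yamanouchi_snoc[of u x]
    by (metis append.assoc append_Cons append_Nil)
qed

text \<open>Moving a letter forward can only fail if it jumps over a letter from the row just above
  it. For the swap of \<open>b\<close> and \<open>c\<close> this means \<open>b = c - 1\<close>; the
  condition on \<open>a\<close> then forces \<open>a = b\<close>, so \<open>a\<close> already
  supplies the missing cell. For the swap of \<open>a\<close> and \<open>b\<close> it means
  \<open>a = b - 1\<close> and hence \<open>c = b\<close>; room for two letters \<open>b\<close>
  after one \<open>a\<close> leaves room for one \<open>b\<close> before it.\<close>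

lemma yamanouchi_K:
  assumes "2 \<le> i" "i < length w" "yamanouchi w"
  shows "yamanouchi (knuth i w)"
proof -
  obtain u a b c v where w: "w = u @ a # b # c # v" "length u = i - 2"
    using split3[OF assms(1,2)] by metis
  have i: "i = length u + 2" using w assms by simp
  have y: "yamanouchi (u @ [a, b, c])" using assms(3) yamanouchi_appendD[of "u @ [a,b,c]" v] w by simp
  then have y': "yamanouchi u" "is_shape (mset u)" "is_shape (add_mset a (mset u))"
    "is_shape (add_mset b (add_mset a (mset u)))" "is_shape (add_mset c (add_mset b (add_mset a (mset u))))"
    using yam3[of u a b c] yamanouchi_dec[of u] by blast+
  have A: "is_shape (add_mset c (add_mset a (mset u)))" if "c \<le> a \<and> a < b \<or> b \<le> a \<and> a < c"
  proof -
    have "c = 0 \<or> count (add_mset a (mset u)) c < count (add_mset a (mset u)) (c - 1)"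
    proof (cases c)
      case (Suc d)
      show ?thesis
        using y'(5)[unfolded is_shape_def, rule_format, of d] y'(2)[unfolded is_shape_def, rule_format, of d]
          that Suc by (auto split: if_splits)
    qed simp
    then show ?thesis using is_shape_add_iff[OF y'(3)] by simp
  qed
  have B: "is_shape (add_mset b (mset u))" if "a < c \<and> c \<le> b \<or> b < c \<and> c \<le> a"
  proof -
    have "b = 0 \<or> count (mset u) b < count (mset u) (b - 1)"
    proof (cases b)
      case (Suc d)
      show ?thesis
        using y'(5)[unfolded is_shape_def, rule_format, of d] y'(4)[unfolded is_shape_def, rule_format, of d]
          that Suc by (auto split: if_splits)
    qed simp
    then show ?thesis using is_shape_add_iff[OF y'(2)] by simp
  qed
  have k: "yamanouchi (u @ knuth3 a b c)"
  proof -
    have 2: "add_mset b (add_mset c (add_mset a (mset u))) = add_mset c (add_mset b (add_mset a (mset u)))"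
      "add_mset c (add_mset a (add_mset b (mset u))) = add_mset c (add_mset b (add_mset a (mset u)))"
      by simp_all
    have 3: "add_mset a (add_mset b (mset u)) = add_mset b (add_mset a (mset u))" by simp
    have "is_shape (add_mset b (add_mset c (add_mset a (mset u))))"
      "is_shape (add_mset c (add_mset a (add_mset b (mset u))))" "is_shape (add_mset a (add_mset b (mset u)))"
      using y' by (simp_all only: 2 3)
    then have "yamanouchi (u @ [a, c, b])" if "c \<le> a \<and> a < b \<or> b \<le> a \<and> a < c"
      using y' A[OF that] unfolding yam3 by blast
    moreover have "yamanouchi (u @ [b, a, c])" if "a < c \<and> c \<le> b \<or> b < c \<and> c \<le> a"
      using y' B[OF that] \<open>is_shape (add_mset c (add_mset a (add_mset b (mset u))))\<close>
        \<open>is_shape (add_mset a (add_mset b (mset u)))\<close> unfolding yam3 by blast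
    ultimately show ?thesis using y knuth3_cases[of a b c] by metis
  qed
  have l: "take k (u @ knuth3 a b c @ v) = (if k \<le> length u + 3 then take k (u @ knuth3 a b c)
      else (u @ knuth3 a b c) @ take (k - length u - 3) v)" for k
    by auto
  have l2: "is_shape (mset ((u @ knuth3 a b c) @ take (k - length u - 3) v))" if "k > length u + 3" for k
  proof -
    have "take k w = u @ [a,b,c] @ take (k - length u - 3) v"
      using that by (simp add: w numeral_3_eq_3 take_Cons')
    then have "mset (take k w) = mset ((u @ knuth3 a b c) @ take (k - length u - 3) v)" by simp
    then show ?thesis using assms(3) unfolding yamanouchi_def by metis
  qed
  have "yamanouchi (u @ knuth3 a b c @ v)" using k l l2 unfolding yamanouchi_def by (metis not_le)
  then show ?thesis using knuth_app'[OF i] w by simp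
qed

lemma foldK_props:
  assumes "set p \<subseteq> {2..<length w}"
  shows "length (fold knuth p w) = length w \<and> mset (fold knuth p w) = mset w \<and> (yamanouchi w \<longrightarrow> yamanouchi (fold knuth p w))"
  using assms by (induction p arbitrary: w) (auto simp: yamanouchi_K)

lemma foldK_append:
  "set p \<subseteq> {2..<length w} \<Longrightarrow> fold knuth p (w @ v) = fold knuth p w @ v"
  by (induction p arbitrary: w) (auto simp: knuth_append)

lemma foldK_rev:
  "set p \<subseteq> {2..<length w} \<Longrightarrow> fold knuth (rev p) (fold knuth p w) = w"
proof (induction p arbitrary: w)
  case (Cons i p)
  then show ?case by (simp add: knuth_K)
qed simp

lemma knuth3_between_fst:
  "c \<le> a \<and> a < b \<or> b \<le> a \<and> a < c \<Longrightarrow> knuth3 a b c = [a, c, b]"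
  by (auto simp: knuth3_def)

lemma knuth3_between_last:
  "a < c \<and> c \<le> b \<or> b < c \<and> c \<le> a \<Longrightarrow> knuth3 a b c = [b, a, c]"
  by (auto simp: knuth3_def)

text \<open>Induction on the length. With equal last letters the induction hypothesis handles the
  prefixes. With different ones, both prefixes are rearranged so that a letter between the two last
  letters precedes them; one move then exchanges these.\<close>

lemma yamanouchi_connected:
  assumes "yamanouchi u" "yamanouchi v" "mset u = mset v"
  shows "\<exists>p. set p \<subseteq> {2..<length u} \<and> fold knuth p u = v"
  using assms
proof (induction "length u" arbitrary: u v)
  case 0
  then show ?case by (intro exI[of _ "[]"]) auto
next
  case (Suc n)
  obtain u' c where u: "u = u' @ [c]" using Suc(2) by (metis length_0_conv nat.distinct(1) rev_exhaust)
  have len: "length v = Suc n" using Suc(2,5) mset_eq_length by fastforce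
  obtain v' c' where v: "v = v' @ [c']" using len by (metis length_0_conv nat.distinct(1) rev_exhaust)
  have lu: "length u' = n" "length v' = n" using Suc(2) u v len by auto
  note pr = Suc.prems
  note IH = Suc(1)
  have *: "\<exists>p. set p \<subseteq> {2..<Suc n} \<and> fold knuth p (x @ [d]) = y @ [d]"
    if h: "yamanouchi x" "yamanouchi y" "mset x = mset y" "length x = n" for x y d
  proof -
    obtain p where p: "set p \<subseteq> {2..<length x}" "fold knuth p x = y" using IH[OF h(4)[symmetric] h(1-3)] by blast
    then show ?thesis using h foldK_append[of p x "[d]"] by (intro exI[of _ p]) auto
  qed
  have key: "\<exists>p. set p \<subseteq> {2..<Suc n} \<and> fold knuth p (x @ [d]) = y @ [d']"
    if h: "yamanouchi (x @ [d])" "yamanouchi (y @ [d'])" "mset (x @ [d]) = mset (y @ [d'])" "length x = n" "d < d'" for x y d d'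
  proof -
    define M where "M = mset x - {#d'#}"
    have e: "add_mset d (mset x) = add_mset d' (mset y)" using h(3) by simp
    then have dx: "d' \<in># mset x" using h(5) by (metis insert_noteq_member nat_less_le union_single_eq_member)
    have mx: "mset x = add_mset d' M" using dx by (simp add: M_def)
    have my: "mset y = add_mset d M" using e unfolding mx by (metis add_mset_add_mset_same_iff add_mset_commute)
    have dd: "is_shape (add_mset d' M)" "is_shape (add_mset d M)" 
      using yamanouchi_dec[OF yamanouchi_appendD[OF h(1)]] yamanouchi_dec[OF yamanouchi_appendD[OF h(2)]] mx my by simp_all
    have dM: "is_shape M" using is_shape_add_mono[OF dd] h(5) by simp
    have cn: "count M (Suc (d' - 1)) < count M (d' - 1)"
      using dd(1)[unfolded is_shape_add_iff[OF dM]] h(5) by auto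
    \<comment> \<open>Row \<open>d' - 1\<close> is a corner of \<open>M\<close> because
      \<open>d'\<close> is addable, and it lies between \<open>d\<close> and \<open>d'\<close> in
      the order of \<open>knuth3\<close>.\<close>
    obtain z where z: "yamanouchi (z @ [d' - 1])" "mset (z @ [d' - 1]) = M"
      using ex_yam_snoc[OF dM cn] by blast
    define s where "s = d' - 1"
    have s: "d \<le> s" "s < d'" using h(5) by (auto simp: s_def)
    have zx: "yamanouchi (z @ [s] @ [d'])" "mset (z @ [s] @ [d']) = mset x"
      using z dd yamanouchi_snoc[of "z @ [s]" d'] mx by (auto simp: s_def)
    have zy: "yamanouchi (z @ [s] @ [d])" "mset (z @ [s] @ [d]) = mset y"
      using z dd yamanouchi_snoc[of "z @ [s]" d] my by (auto simp: s_def)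
    have sx: "length (z @ [s] @ [d']) = n" "length (z @ [s] @ [d]) = n"
    proof -
      show "length (z @ [s] @ [d']) = n" using zx(2) h(4) by (metis size_mset)
      then show "length (z @ [s] @ [d]) = n" by simp
    qed
    have yx: "yamanouchi x" "yamanouchi y" using h(1,2) yamanouchi_appendD by blast+
    obtain p where p: "set p \<subseteq> {2..<Suc n}" "fold knuth p (x @ [d]) = (z @ [s] @ [d']) @ [d]"
      using *[OF yx(1) zx(1) zx(2)[symmetric] h(4)] by blast
    obtain q where q: "set q \<subseteq> {2..<Suc n}" "fold knuth q ((z @ [s] @ [d]) @ [d']) = y @ [d']"
      using *[OF zy(1) yx(2) zy(2) sx(2)] by blast
    have k: "knuth n ((z @ [s] @ [d']) @ [d]) = (z @ [s] @ [d]) @ [d']"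
      using knuth_app'[of n z s d' d "[]"] sx s knuth3_between_fst[of d s d'] by simp
    have n2: "n \<ge> 2" using sx by simp
    have "fold knuth (p @ n # q) (x @ [d]) = y @ [d']" using p(2) q(2) k by simp
    moreover have "set (p @ n # q) \<subseteq> {2..<Suc n}" using p(1) q(1) n2 by simp
    ultimately show ?thesis by blast
  qed
  consider "c = c'" | "c < c'" | "c' < c" by linarith
  then show ?case
  proof cases
    case 1
    have "mset u' = mset v'" "yamanouchi u'" "yamanouchi v'" using pr u v 1 by simp_all
    from *[OF this(2,3,1) lu(1), of c'] show ?thesis
      unfolding Suc(2)[symmetric] by (simp only: u v 1)
  next
    case 2
    show ?thesis
      using key[OF pr(1)[unfolded u] pr(2)[unfolded v] pr(3)[unfolded u v] lu(1) 2]
      unfolding Suc(2)[symmetric] by (simp only: u v)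
  next
    case 3
    obtain p where "set p \<subseteq> {2..<Suc n}" "fold knuth p v = u" 
      using key[OF pr(2)[unfolded v] pr(1)[unfolded u] pr(3)[unfolded u v, symmetric] lu(2) 3]
      unfolding u v by blast
    moreover from this have "fold knuth (rev p) u = v" using foldK_rev[of p v] len by simp
    ultimately show ?thesis unfolding Suc(2)[symmetric] by (intro exI[of _ "rev p"]) simp
  qed
qed

section \<open>Rigidity of descent patterns\<close>

lemma yamanouchi_nth_le_prefix_max:
  assumes "yamanouchi w" "p < length w" "x < w ! p"
  shows "\<exists>q<p. w ! q = x"
proof -
  have "\<exists>q<p. w ! q = w ! p - 1 - k" if "k < w ! p" for k
    using that
  proof (induction k)
    case 0
    have "w ! p \<in> set (take (Suc p) w)" using assms(2) by (simp add: take_Suc_conv_app_nth)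
    then have "count (mset (take (Suc p) w)) (w ! p) > 0" by simp
    moreover have "is_shape (mset (take (Suc p) w))" using assms(1) yamanouchi_def by blast
    ultimately have "count (mset (take (Suc p) w)) (w ! p - 1) > 0" 
      using 0 unfolding is_shape_def by (metis Suc_pred diff_Suc_1 less_le_trans)
    then have "w ! p - 1 \<in> set (take (Suc p) w)" by simp
    then obtain q where "q < Suc p" "w ! q = w ! p - 1" by (auto simp: in_set_conv_nth)
    moreover have "q \<noteq> p" using 0 \<open>w ! q = w ! p - 1\<close> by (metis diff_less less_irrefl zero_less_one)
    ultimately show ?case by (intro exI[of _ q]) auto
  next
    case (Suc k)
    then obtain q where q: "q < p" "w ! q = w ! p - 1 - k" by auto
    have "w ! q \<in> set (take (Suc q) w)" using assms(2) q by (simp add: take_Suc_conv_app_nth)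
    then have "count (mset (take (Suc q) w)) (w ! q) > 0" by simp
    moreover have "is_shape (mset (take (Suc q) w))" using assms(1) yamanouchi_def by blast
    moreover have "w ! q = Suc (w ! p - 1 - Suc k)" using q Suc by simp
    ultimately have "count (mset (take (Suc q) w)) (w ! p - 1 - Suc k) > 0" 
      unfolding is_shape_def by (metis less_le_trans)
    then have "w ! p - 1 - Suc k \<in> set (take (Suc q) w)" by simp
    then obtain q' where "q' < Suc q" "w ! q' = w ! p - 1 - Suc k" by (auto simp: in_set_conv_nth)
    then show ?case using q by (intro exI[of _ q']) auto
  qed
  from this[of "w ! p - 1 - x"] show ?thesis using assms(3) by auto
qed

text \<open>If an earlier letter is at least as large, its bound is inherited. Otherwise the letter
  is a strict record, so its position is a descent, and the letter one smaller occurs earlier,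
  before this descent.\<close>

lemma yamanouchi_nth_le:
  assumes "yamanouchi w" "p < length w"
  shows "w ! p \<le> card (descents w \<inter> {1..p})"
  using assms(2)
proof (induction p rule: less_induct)
  case (less p)
  have mono: "card (descents w \<inter> {1..q}) \<le> card (descents w \<inter> {1..p})" if "q \<le> p" for q
    using that by (intro card_mono) auto
  show ?case
  proof (cases "\<exists>q<p. w ! p \<le> w ! q")
    case True
    then obtain q where "q < p" "w ! p \<le> w ! q" by blast
    then show ?thesis using less.IH[of q] less.prems mono[of q] by linarith
  next
    case False
    then have big: "w ! q < w ! p" if "q < p" for q using that not_le by blast
    show ?thesis
    proof (cases "w ! p = 0")
      case nz: False
      then obtain q where q: "q < p" "w ! q = w ! p - 1" using yamanouchi_nth_le_prefix_max[OF assms(1) less.prems, of "w ! p - 1"] by auto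
      have p: "p \<in> descents w" using big[of "p - 1"] q less.prems by (auto simp: descents_def)
      then have "descents w \<inter> {1..p} = insert p (descents w \<inter> {1..p - 1})" using q by auto
      then have "card (descents w \<inter> {1..p}) = Suc (card (descents w \<inter> {1..p - 1}))" using q
        by (subst card_insert_disjoint[symmetric]) auto
      moreover have "card (descents w \<inter> {1..q}) \<le> card (descents w \<inter> {1..p - 1})"
        using q by (intro card_mono) auto
      ultimately show ?thesis using less.IH[of q] q less.prems by simp
    qed simp
  qed
qed

lemma sorted_yam_nth:
  assumes "yamanouchi w" "sorted w" "p < length w"
  shows "w ! p = card (descents w \<inter> {1..p})"
  using assms(3)
proof (induction p)
  case 0
  then show ?case using yamanouchi_nth_le[OF assms(1), of 0] by auto
next
  case (Suc p)
  have m: "w ! p \<le> w ! Suc p" using assms(2) Suc.prems by (simp add: sorted_nth_mono)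
  show ?case
  proof (cases "Suc p \<in> descents w")
    case True
    have "w ! p < w ! Suc p" using True by (simp add: descents_def)
    moreover have "descents w \<inter> {1..Suc p} = insert (Suc p) (descents w \<inter> {1..p})" using True by auto
    then have "card (descents w \<inter> {1..Suc p}) = Suc (card (descents w \<inter> {1..p}))" by auto
    ultimately show ?thesis using Suc yamanouchi_nth_le[OF assms(1) Suc.prems] by simp
  next
    case False
    have "descents w \<inter> {1..Suc p} = descents w \<inter> {1..p}" using False atLeastAtMostSuc_conv by auto
    moreover have "w ! p = w ! Suc p" using False Suc.prems m by (auto simp: descents_def)
    ultimately show ?thesis using Suc by simp
  qed
qed

lemma sum_list_pointwise_eq:
  fixes xs ys :: "nat list"
  assumes "length xs = length ys" "\<And>i. i < length xs \<Longrightarrow> xs ! i \<le> ys ! i" 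
    "sum_list ys \<le> sum_list xs"
  shows "xs = ys"
proof (rule nth_equalityI[OF assms(1)])
  fix i assume i: "i < length xs"
  have e: "sum_list xs = (\<Sum>i<length xs. xs ! i)" "sum_list ys = (\<Sum>i<length xs. ys ! i)"
    using assms(1) by (simp_all add: sum_list_sum_nth atLeast0LessThan)
  show "xs ! i = ys ! i"
  proof (rule ccontr)
    assume "xs ! i \<noteq> ys ! i"
    then have "xs ! i < ys ! i" using assms(2)[OF i] by simp
    then have "(\<Sum>i<length xs. xs ! i) < (\<Sum>i<length xs. ys ! i)"
      using i assms(2) by (intro sum_strict_mono_ex1) auto
    then show False using e assms(3) by simp
  qed
qed

lemma yamanouchi_sort_mset: "yamanouchi u \<Longrightarrow> yamanouchi (sort u)"
  by (rule yamanouchi_sort) (simp_all add: yamanouchi_dec)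

lemma descents_sort_le:
  assumes "yamanouchi u" "yamanouchi v" "length u = length v" "descents v = descents (sort u)" "i < length v"
  shows "v ! i \<le> sort u ! i"
  using yamanouchi_nth_le[OF assms(2,5)] sorted_yam_nth[OF yamanouchi_sort_mset[OF assms(1)], of i] assms by simp

lemma sum_list_mset_eq: "mset xs = mset ys \<Longrightarrow> sum_list xs = sum_list (ys :: nat list)"
  by (metis sum_mset_sum_list)

text \<open>The sorted word attains the bound of \<open>yamanouchi_nth_le\<close> at every position,
  so \<open>v\<close> is letterwise at most \<open>sort u\<close>. Equal contents have equal letter
  sums, which leaves no room for a smaller letter.\<close>

lemma descents_sort_unique:
  assumes "yamanouchi u" "yamanouchi v" "mset u = mset v" "descents v = descents (sort u)"
  shows "v = sort u"
proof (rule sum_list_pointwise_eq)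
  show "length v = length (sort u)" using assms(3) by (metis length_sort size_mset)
  then show "\<And>i. i < length v \<Longrightarrow> v ! i \<le> sort u ! i" 
    using descents_sort_le[OF assms(1,2) _ assms(4)] by simp
  show "sum_list (sort u) \<le> sum_list v"
    using sum_list_mset_eq[of "sort u" v] assms(3) by simp
qed

lemma descents_paths_sum_le:
  assumes "yamanouchi u" "yamanouchi v" "length u = n" "length v = n"
    and "\<And>p. set p \<subseteq> {2..<n} \<Longrightarrow> descents (fold knuth p u) = descents (fold knuth p v)"
  shows "\<exists>p. set p \<subseteq> {2..<n} \<and> fold knuth p u = sort u \<and> (\<forall>i<n. fold knuth p v ! i \<le> sort u ! i)"
    and "sum_list v \<le> sum_list u"
proof -
  obtain p where p: "set p \<subseteq> {2..<n}" "fold knuth p u = sort u"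
    using yamanouchi_connected[OF assms(1) yamanouchi_sort_mset[OF assms(1)]] assms(3) by auto
  let ?v = "fold knuth p v"
  have v: "length ?v = n" "mset ?v = mset v" "yamanouchi ?v" using foldK_props[of p v] assms p by auto
  have le: "\<forall>i<n. ?v ! i \<le> sort u ! i"
    using descents_sort_le[OF assms(1) v(3)] assms(3) v assms(5)[OF p(1)] p(2) by simp
  then show "\<exists>p. set p \<subseteq> {2..<n} \<and> fold knuth p u = sort u \<and> (\<forall>i<n. fold knuth p v ! i \<le> sort u ! i)"
    using p by blast
  have "sum_list v = sum_list ?v" using v by (metis sum_list_mset_eq)
  also have "\<dots> = (\<Sum>i<n. ?v ! i)" using v by (simp add: sum_list_sum_nth atLeast0LessThan)
  also have "\<dots> \<le> (\<Sum>i<n. sort u ! i)" using le by (intro sum_mono) auto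
  also have "\<dots> = sum_list (sort u)" using assms by (simp add: sum_list_sum_nth atLeast0LessThan)
  also have "\<dots> = sum_list u" by (rule sum_list_mset_eq) simp
  finally show "sum_list v \<le> sum_list u" .
qed

text \<open>A path that sorts \<open>u\<close> turns \<open>v\<close> into a word letterwise below
  \<open>sort u\<close>, so \<open>v\<close> has the smaller letter sum. By symmetry the sums agree,
  and then so do the words. Equality of the shapes is a consequence here, not an assumption.\<close>

lemma descents_paths_unique:
  assumes "yamanouchi u" "yamanouchi v" "length u = n" "length v = n"
    and "\<And>p. set p \<subseteq> {2..<n} \<Longrightarrow> descents (fold knuth p u) = descents (fold knuth p v)"
  shows "u = v"
proof -
  obtain p where p: "set p \<subseteq> {2..<n}" "fold knuth p u = sort u" "\<forall>i<n. fold knuth p v ! i \<le> sort u ! i"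
    using descents_paths_sum_le(1)[OF assms] by blast
  have s: "sum_list u \<le> sum_list v" using descents_paths_sum_le(2)[OF assms(2,1,4,3)] assms(5) by metis
  let ?v = "fold knuth p v"
  have v: "length ?v = n" "mset ?v = mset v" using foldK_props[of p v] assms p by auto
  have "?v = sort u"
  proof (rule sum_list_pointwise_eq)
    show "sum_list (sort u) \<le> sum_list ?v"
      using s sum_list_mset_eq[of "sort u" u] sum_list_mset_eq[of ?v v] v by simp
  qed (use v assms p in auto)
  then show ?thesis using p foldK_rev[of p u] foldK_rev[of p v] assms by metis
qed

section \<open>Schur functions as sums of fundamental quasisymmetric functions\<close>

definition strict_at :: "nat list \<Rightarrow> nat set \<Rightarrow> bool" where
  "strict_at s D \<longleftrightarrow> (\<forall>j\<in>D. s ! (j - 1) < s ! j)"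

definition cells_of :: "nat multiset \<Rightarrow> (nat \<times> nat) set" where
  "cells_of M = {(r, c). c < count M r}"

definition ssyt_of :: "nat multiset \<Rightarrow> (nat \<times> nat \<Rightarrow> nat) \<Rightarrow> bool" where
  "ssyt_of M T \<longleftrightarrow> (\<forall>r c. Suc c < count M r \<longrightarrow> T (r, c) \<le> T (r, Suc c))
     \<and> (\<forall>r c. c < count M (Suc r) \<longrightarrow> T (r, c) < T (Suc r, c)) \<and> (\<forall>x. x \<notin> cells_of M \<longrightarrow> T x = 0)"

text \<open>Inverse standardization: the \<open>j\<close>-th letter of the word is the row of the cell that receives the
  \<open>j\<close>-th value. Both lists are processed from the right.\<close>

fun fill_rev :: "nat list \<Rightarrow> nat list \<Rightarrow> nat \<times> nat \<Rightarrow> nat" where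
  "fill_rev (r # w) (x # s) = (fill_rev w s)((r, count (mset w) r) := x)"
| "fill_rev _ _ = (\<lambda>_. 0)"

definition fill :: "nat list \<Rightarrow> nat list \<Rightarrow> nat \<times> nat \<Rightarrow> nat" where
  "fill w s = fill_rev (rev w) (rev s)"

lemma fill_Nil [simp]: "fill [] s = (\<lambda>_. 0)"
  by (simp add: fill_def)

lemma fill_snoc [simp]: "fill (w @ [r]) (s @ [x]) = (fill w s)((r, count (mset w) r) := x)"
  by (simp add: fill_def)

lemma cells_of_add: "cells_of (add_mset r M) = insert (r, count M r) (cells_of M)"
  by (auto simp: cells_of_def split: if_splits)

lemma cells_of_empty [simp]: "cells_of {#} = {}"
  by (simp add: cells_of_def)

lemma cells_of_fresh [simp]: "(r, count M r) \<notin> cells_of M"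
  by (simp add: cells_of_def)

lemma finite_cel [simp]: "finite (cells_of M)"
  by (induction M) (simp_all add: cells_of_add)

lemma card_cel: "card (cells_of M) = size M"
  by (induction M) (simp_all add: cells_of_add)

lemma fill_outside: "length w = length s \<Longrightarrow> x \<notin> cells_of (mset w) \<Longrightarrow> fill w s x = 0"
proof (induction w arbitrary: s rule: rev_induct)
  case (snoc r w)
  then obtain s' y where "s = s' @ [y]" by (metis length_0_conv rev_exhaust snoc_eq_iff_butlast)
  then show ?case using snoc by (auto simp: cells_of_add)
qed simp

lemma image_mset_upd:
  assumes "finite C" "x \<notin> C"
  shows "image_mset (T(x := y)) (mset_set (insert x C)) = add_mset y (image_mset T (mset_set C))"
proof -
  have "image_mset (T(x := y)) (mset_set C) = image_mset T (mset_set C)"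
    using assms by (intro image_mset_cong) auto
  then show ?thesis using assms by simp
qed

lemma fill_content: "length w = length s \<Longrightarrow> image_mset (fill w s) (mset_set (cells_of (mset w))) = mset s"
proof (induction w arbitrary: s rule: rev_induct)
  case (snoc r w)
  then obtain s' y where s: "s = s' @ [y]" by (metis length_0_conv rev_exhaust snoc_eq_iff_butlast)
  have m: "mset (w @ [r]) = add_mset r (mset w)" by simp
  have "image_mset (fill (w @ [r]) s) (mset_set (cells_of (mset (w @ [r]))))
      = add_mset y (image_mset (fill w s') (mset_set (cells_of (mset w))))"
    unfolding s fill_snoc m cells_of_add by (rule image_mset_upd) simp_all
  also have "image_mset (fill w s') (mset_set (cells_of (mset w))) = mset s'"
    using snoc.IH[of s'] snoc.prems s by simp
  finally show ?case using s by simp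
qed simp

lemma fill_in_set: "length w = length s \<Longrightarrow> x \<in> cells_of (mset w) \<Longrightarrow> fill w s x \<in> set s"
  using fill_content[of w s] by (metis finite_cel finite_set_mset_mset_set image_eqI set_image_mset set_mset_mset)

lemma strict_at_snoc:
  assumes "length w = length s"
  shows "strict_at (s @ [x]) (descents (w @ [r])) \<longleftrightarrow>
    strict_at s (descents w) \<and> (w \<noteq> [] \<longrightarrow> last w < r \<longrightarrow> last s < x)"
proof -
  have 1: "descents (w @ [r]) = descents w \<union> (if w \<noteq> [] \<and> last w < r then {length w} else {})"
    by (cases "w = []") (auto simp: descents_def nth_append last_conv_nth less_Suc_eq)
  have 2: "(s @ [x]) ! (j - 1) < (s @ [x]) ! j \<longleftrightarrow> s ! (j - 1) < s ! j" if "j \<in> descents w" for j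
    using that assms by (auto simp: descents_def nth_append)
  have 3: "(s @ [x]) ! (length w - 1) < (s @ [x]) ! length w \<longleftrightarrow> last s < x" if "w \<noteq> []"
  proof -
    have "s \<noteq> []" using that assms by auto
    then show ?thesis using assms by (auto simp: nth_append last_conv_nth)
  qed
  show ?thesis using 2 3 unfolding strict_at_def 1 by (auto split: if_splits)
qed

lemma sorted_le_last: "sorted s \<Longrightarrow> y \<in> set s \<Longrightarrow> y \<le> last (s :: nat list)"
  by (cases s rule: rev_cases) (auto simp: sorted_append)

text \<open>While the value stays the same the letters cannot increase, since an increase is a
  descent and forces a strict step of the values. Cells with one common value are thus filled from
  bottom to top.\<close>

lemma fill_last:
  assumes "length w = length s" "sorted s" "strict_at s (descents w)" "(r, c) \<in> cells_of (mset w)"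
    "fill w s (r, c) = last s"
  shows "last w \<le> r"
  using assms
proof (induction w arbitrary: s rule: rev_induct)
  case (snoc t w)
  then obtain s' y where s: "s = s' @ [y]" by (metis length_0_conv rev_exhaust snoc_eq_iff_butlast)
  show ?case
  proof (cases "(r, c) = (t, count (mset w) t)")
    case False
    then have c: "(r, c) \<in> cells_of (mset w)" using snoc.prems(4) by (auto simp: cells_of_add)
    have f: "fill w s' (r, c) = y" using snoc.prems(5) False s by (auto split: if_splits)
    have l: "length w = length s'" "sorted s'" "\<forall>x\<in>set s'. x \<le> y"
      using snoc.prems(1,2) s by (simp_all add: sorted_append)
    have st: "strict_at s' (descents w)" "w \<noteq> [] \<longrightarrow> last w < t \<longrightarrow> last s' < y"
      using snoc.prems(3) unfolding s strict_at_snoc[OF l(1)] by auto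
    have "y \<in> set s'" using fill_in_set[OF l(1) c] f by simp
    then have ne: "s' \<noteq> []" by auto
    have "y \<le> last s'" using sorted_le_last[OF l(2) \<open>y \<in> set s'\<close>] .
    moreover have "last s' \<le> y" using l(3) ne by simp
    ultimately have y: "last s' = y" by simp
    then have "t \<le> last w" using st(2) l(1) ne by fastforce
    moreover have "last w \<le> r" using snoc.IH[OF l(1,2) st(1) c] f y by simp
    ultimately show ?thesis by simp
  qed simp
qed simp

lemma fill_ss:
  assumes "length w = length s" "sorted s" "strict_at s (descents w)" "yamanouchi w"
  shows "ssyt_of (mset w) (fill w s)"
  using assms
proof (induction w arbitrary: s rule: rev_induct)
  case Nil
  then show ?case by (simp add: ssyt_of_def)
next
  case (snoc t w)
  then obtain s' y where s: "s = s' @ [y]" by (metis length_0_conv rev_exhaust snoc_eq_iff_butlast)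
  have l: "length w = length s'" "sorted s'" "\<forall>x\<in>set s'. x \<le> y"
    using snoc.prems(1,2) s by (simp_all add: sorted_append)
  have st: "strict_at s' (descents w)" "w \<noteq> [] \<longrightarrow> last w < t \<longrightarrow> last s' < y"
    using snoc.prems(3) unfolding s strict_at_snoc[OF l(1)] by auto
  have y: "yamanouchi w" "is_shape (add_mset t (mset w))" using snoc.prems(4) by auto
  have IH: "ssyt_of (mset w) (fill w s')" using snoc.IH l st y by simp
  let ?M = "mset w"
  have le: "fill w s' x \<le> y" if "x \<in> cells_of ?M" for x using fill_in_set[OF l(1) that] l(3) by simp
  show ?case unfolding ssyt_of_def
  proof (intro conjI allI impI)
    fix r c assume h: "Suc c < count (mset (w @ [t])) r"
    show "fill (w @ [t]) s (r, c) \<le> fill (w @ [t]) s (r, Suc c)"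
    proof (cases "r = t \<and> Suc c = count ?M t")
      case True
      then show ?thesis using le[of "(r, c)"] s by (auto simp: cells_of_def)
    next
      case False
      then have "Suc c < count ?M r" using h by (auto split: if_splits)
      then show ?thesis using IH s unfolding ssyt_of_def by auto
    qed
  next
    fix r c assume h: "c < count (mset (w @ [t])) (Suc r)"
    show "fill (w @ [t]) s (r, c) < fill (w @ [t]) s (Suc r, c)"
    proof (cases "Suc r = t \<and> c = count ?M t")
      case True
      have c: "(r, c) \<in> cells_of ?M" using True y(2)[unfolded is_shape_def, rule_format, of r] by (auto simp: cells_of_def)
      \<comment> \<open>If the cell above also held \<open>y\<close>, \<open>fill_last\<close> would
        give \<open>last w \<le> r < t\<close>, a descent, and \<open>strict_at\<close> would forbid
        the repeated value.\<close>
      have "fill w s' (r, c) \<noteq> y"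
      proof
        assume e: "fill w s' (r, c) = y"
        then have "y \<in> set s'" using fill_in_set[OF l(1) c] by simp
        then have ne: "s' \<noteq> []" by auto
        have "y \<le> last s'" using sorted_le_last[OF l(2) \<open>y \<in> set s'\<close>] .
        moreover have "last s' \<le> y" using l(3) ne by simp
        ultimately have yl: "last s' = y" by simp
        then have "t \<le> last w" using st(2) l(1) ne by fastforce
        moreover have "last w \<le> r" using fill_last[OF l(1,2) st(1) c] e yl by simp
        ultimately show False using True by simp
      qed
      then have "fill w s' (r, c) < y" using le[OF c] by simp
      then show ?thesis using True s by simp
    next
      case False
      then have "c < count ?M (Suc r)" using h by (auto split: if_splits)
      moreover have "c < count ?M r" using calculation yamanouchi_dec[OF y(1)] unfolding is_shape_def by (meson less_le_trans)
      ultimately show ?thesis using IH s False unfolding ssyt_of_def by auto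
    qed
  next
    fix x assume "x \<notin> cells_of (mset (w @ [t]))"
    then show "fill (w @ [t]) s x = 0" using fill_outside[OF snoc.prems(1)] by simp
  qed
qed

lemma ssyt_of_col:
  assumes "ssyt_of M T" "is_shape M" "r < r'" "c < count M r'"
  shows "T (r, c) < T (r', c)"
  using assms(3,4)
proof (induction r')
  case (Suc r')
  have "c < count M r'" using Suc.prems assms(2) unfolding is_shape_def by (meson less_le_trans)
  moreover have "T (r', c) < T (Suc r', c)" using assms(1) Suc.prems unfolding ssyt_of_def by auto
  ultimately show ?case using Suc by (cases "r = r'") auto
qed simp

lemma fill_surj:
  assumes "sorted s" "is_shape M" "size M = length s" "ssyt_of M T" "image_mset T (mset_set (cells_of M)) = mset s"
  shows "\<exists>w. yamanouchi w \<and> mset w = M \<and> strict_at s (descents w) \<and> fill w s = T"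
  using assms
proof (induction s arbitrary: M T rule: rev_induct)
  case Nil
  then have "M = {#}" by simp
  then show ?case using Nil by (intro exI[of _ "[]"]) (auto simp: ssyt_of_def descents_def strict_at_def)
next
  case (snoc x s)
  note m = snoc.prems(5)
  have xs: "sorted s" "\<forall>y\<in>set s. y \<le> x" using snoc.prems(1) by (auto simp: sorted_append)
  have val: "T z \<le> x" if "z \<in> cells_of M" for z
  proof -
    have "T z \<in># mset (s @ [x])" using that unfolding m[symmetric] by simp
    then show ?thesis using xs(2) by auto
  qed
  \<comment> \<open>Among the cells with the largest value, the one in the rightmost column has no
    cell to its right or below it, so it is a corner and can be taken as the cell filled
    last.\<close>
  define C where "C = {z \<in> cells_of M. T z = x}"
  have "x \<in># image_mset T (mset_set (cells_of M))" unfolding m by simp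
  then have "C \<noteq> {}" unfolding C_def by auto
  moreover have "finite C" unfolding C_def by simp
  ultimately have "Max (snd ` C) \<in> snd ` C" "\<forall>z'\<in>C. snd z' \<le> Max (snd ` C)" by simp_all
  then obtain z where z: "z \<in> C" "\<forall>z'\<in>C. snd z' \<le> snd z" by force
  obtain r c where rc: "z = (r, c)" by fastforce
  have zc: "c < count M r" "T (r, c) = x" using z(1) rc by (auto simp: C_def cells_of_def)
  have cr: "count M r = Suc c"
  proof (rule ccontr)
    assume "count M r \<noteq> Suc c"
    then have s: "Suc c < count M r" using zc by simp
    then have "T (r, c) \<le> T (r, Suc c)" using snoc.prems(4) unfolding ssyt_of_def by blast
    moreover have "(r, Suc c) \<in> cells_of M" using s by (simp add: cells_of_def)
    ultimately have "(r, Suc c) \<in> C" using val[of "(r, Suc c)"] zc by (simp add: C_def)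
    then show False using z rc by fastforce
  qed
  have cs: "count M (Suc r) \<le> c"
  proof (rule ccontr)
    assume "\<not> ?thesis"
    then have s: "c < count M (Suc r)" by simp
    then have "T (r, c) < T (Suc r, c)" using snoc.prems(4) unfolding ssyt_of_def by blast
    then show False using val[of "(Suc r, c)"] s zc by (simp add: cells_of_def)
  qed
  define N where "N = M - {#r#}"
  have M: "M = add_mset r N" using cr unfolding N_def by (metis count_eq_zero_iff insert_DiffM nat.distinct(1))
  have nc: "count N r = c" using cr M by simp
  have dN: "is_shape N" unfolding is_shape_def
  proof
    fix q show "count N (Suc q) \<le> count N q"
      using snoc.prems(2)[unfolded is_shape_def, rule_format, of q] cs nc unfolding M
      by (cases "q = r") (auto split: if_splits)
  qed
  define T' where "T' = T((r, c) := 0)"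
  have TT: "T = T'((r, c) := x)" using zc by (simp add: T'_def fun_eq_iff)
  have cM: "cells_of M = insert (r, c) (cells_of N)" unfolding M cells_of_add nc ..
  have fr: "(r, c) \<notin> cells_of N" using nc cells_of_fresh by metis
  have ssN: "ssyt_of N T'" unfolding ssyt_of_def
  proof (intro conjI allI impI)
    fix q d assume h: "Suc d < count N q"
    then have "T (q, d) \<le> T (q, Suc d)" using snoc.prems(4) unfolding ssyt_of_def M by (auto split: if_splits)
    then show "T' (q, d) \<le> T' (q, Suc d)" using h nc unfolding T'_def by auto
  next
    fix q d assume h: "d < count N (Suc q)"
    then have "T (q, d) < T (Suc q, d)" using snoc.prems(4) unfolding ssyt_of_def M by (auto split: if_splits)
    moreover have "d < count N q" using h dN unfolding is_shape_def by (meson less_le_trans)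
    ultimately show "T' (q, d) < T' (Suc q, d)" using h nc unfolding T'_def by auto
  next
    fix y assume "y \<notin> cells_of N"
    then show "T' y = 0" using snoc.prems(4) cM unfolding ssyt_of_def T'_def by (metis fun_upd_apply insertE)
  qed
  have "image_mset T (mset_set (cells_of M)) = add_mset x (image_mset T' (mset_set (cells_of N)))"
    unfolding cM TT using fr by (intro image_mset_upd) auto
  then have c': "image_mset T' (mset_set (cells_of N)) = mset s" using m by simp
  have "size N = length s" using snoc.prems(3) M by simp
  then obtain w where w: "yamanouchi w" "mset w = N" "strict_at s (descents w)" "fill w s = T'"
    using snoc.IH[OF xs(1) dN _ ssN c'] by blast
  have lw: "length w = length s" using \<open>size N = length s\<close> w(2) by (metis size_mset)
  \<comment> \<open>If the value \<open>x\<close> were repeated at a descent, the previous cell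
    \<open>(t, d)\<close> would lie in a higher row. Then \<open>d \<le> c\<close> by the choice of
    \<open>z\<close> and \<open>c \<le> d\<close> by the shape, so one column would contain
    \<open>x\<close> twice.\<close>
  have "last s < x" if h: "w \<noteq> []" "last w < r"
  proof (rule ccontr)
    assume "\<not> last s < x"
    moreover have sne: "s \<noteq> []" using h lw by auto
    then have "last s \<le> x" using xs(2) by simp
    ultimately have ls: "last s = x" by simp
    obtain v t where v: "w = v @ [t]" using h by (metis rev_exhaust)
    obtain s' where s': "s = s' @ [x]" using ls sne by (metis append_butlast_last_id)
    define d where "d = count (mset v) t"
    have T't: "T' (t, d) = x" using w(4) unfolding v s' by (auto simp: d_def)
    have dt: "count N t = Suc d" using w(2) v by (auto simp: d_def)
    have tr: "t < r" using h v by simp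
    have "(t, d) \<in> cells_of M" using dt M by (simp add: cells_of_def)
    moreover have Tt: "T (t, d) = x" using T't tr unfolding T'_def by simp
    ultimately have "d \<le> c" using z(2) rc by (fastforce simp: C_def)
    moreover have "count M r \<le> count M t"
      using lift_Suc_antimono_le[of "count M" t r] snoc.prems(2) tr unfolding is_shape_def by simp
    then have "c \<le> d" using cr dt tr M by simp
    ultimately have "d = c" by simp
    then have "T (t, c) < T (r, c)" using ssyt_of_col[OF snoc.prems(4,2) tr zc(1)] by simp
    then show False using Tt zc \<open>d = c\<close> by simp
  qed
  then have st: "strict_at (s @ [x]) (descents (w @ [r]))" unfolding strict_at_snoc[OF lw] using w(3) by blast
  show ?case
  proof (intro exI[of _ "w @ [r]"] conjI)
    show "yamanouchi (w @ [r])" using w snoc.prems(2) M by simp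
    show "mset (w @ [r]) = M" using w M by simp
    show "fill (w @ [r]) (s @ [x]) = T" using w nc TT by simp
  qed (rule st)
qed

text \<open>By \<open>fill_last\<close>, the last letter of either word is the least row that
  contains the largest value, so it can be read off the filling.\<close>

lemma fill_inj:
  assumes "length w = length s" "sorted s" "strict_at s (descents w)" "strict_at s (descents w')"
    "mset w = mset w'" "fill w s = fill w' s"
  shows "w = w'"
  using assms
proof (induction s arbitrary: w w' rule: rev_induct)
  case Nil
  then show ?case by simp
next
  case (snoc x s)
  have lw': "length w' = length (s @ [x])" using snoc.prems(1,5) by (metis size_mset)
  obtain v t where v: "w = v @ [t]" using snoc.prems(1) by (metis length_0_conv rev_exhaust snoc_eq_iff_butlast)
  obtain v' t' where v': "w' = v' @ [t']" using lw' by (metis length_0_conv rev_exhaust snoc_eq_iff_butlast)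
  have f: "fill w' (s @ [x]) (t, count (mset v) t) = x" "fill w (s @ [x]) (t', count (mset v') t') = x"
    unfolding snoc.prems(6)[symmetric] v apply simp
    unfolding snoc.prems(6)[unfolded v] v' by simp
  have g: "(t, count (mset v) t) \<in> cells_of (mset w')" "(t', count (mset v') t') \<in> cells_of (mset w)"
    unfolding snoc.prems(5)[symmetric] v apply (simp add: cells_of_add)
    unfolding snoc.prems(5)[unfolded v] v' by (simp add: cells_of_add)
  have "t' \<le> t" using fill_last[OF lw' snoc.prems(2,4) g(1)] f v' by simp
  moreover have "t \<le> t'" using fill_last[OF snoc.prems(1,2,3) g(2)] f v by simp
  ultimately have t: "t = t'" by simp
  have mv: "mset v = mset v'" using snoc.prems(5) v v' t by simp
  have lv: "length v = length s" "length v' = length s" using snoc.prems(1) lw' v v' by simp_all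
  have "fill v s = (fill w (s @ [x]))((t, count (mset v) t) := 0)"
    using fill_outside[OF lv(1)] v by (auto simp: fun_eq_iff)
  also have "\<dots> = fill v' s"
    unfolding snoc.prems(6) using fill_outside[OF lv(2)] v' mv t by (auto simp: fun_eq_iff)
  finally have "fill v s = fill v' s" .
  moreover have "strict_at s (descents v)" "strict_at s (descents v')"
    using snoc.prems(3,4) unfolding v v' strict_at_snoc[OF lv(1)] strict_at_snoc[OF lv(2)] by auto
  moreover have "sorted s" using snoc.prems(2) by (simp add: sorted_append)
  ultimately have "v = v'" using snoc.IH[OF lv(1) _ _ _ mv] by blast
  then show ?case using v v' t by simp
qed

definition yam_words :: "nat multiset \<Rightarrow> nat list set" where
  "yam_words M = {w. yamanouchi w \<and> mset w = M}"

lemma finite_yams [simp]: "finite (yam_words M)"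
proof (rule finite_subset)
  show "yam_words M \<subseteq> {xs. set xs \<subseteq> set_mset M \<and> length xs = size M}" by (auto simp: yam_words_def)
qed (simp add: finite_lists_length_eq)

lemma card_ss:
  assumes "sorted s" "is_shape M" "size M = length s"
  shows "card {T. ssyt_of M T \<and> image_mset T (mset_set (cells_of M)) = mset s} = card {w \<in> yam_words M. strict_at s (descents w)}"
proof -
  have len: "length w = length s" if "w \<in> yam_words M" for w
    using that assms(3) by (auto simp: yam_words_def)
  have "bij_betw (\<lambda>w. fill w s) {w \<in> yam_words M. strict_at s (descents w)}
      {T. ssyt_of M T \<and> image_mset T (mset_set (cells_of M)) = mset s}"
    unfolding bij_betw_def
  proof
    show "inj_on (\<lambda>w. fill w s) {w \<in> yam_words M. strict_at s (descents w)}"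
      by (rule inj_onI) (use fill_inj assms len in \<open>auto simp: yam_words_def\<close>)
    show "(\<lambda>w. fill w s) ` {w \<in> yam_words M. strict_at s (descents w)}
        = {T. ssyt_of M T \<and> image_mset T (mset_set (cells_of M)) = mset s}"
    proof (intro equalityI subsetI)
      fix T assume "T \<in> (\<lambda>w. fill w s) ` {w \<in> yam_words M. strict_at s (descents w)}"
      then obtain w where w: "w \<in> yam_words M" "strict_at s (descents w)" "T = fill w s" by auto
      then show "T \<in> {T. ssyt_of M T \<and> image_mset T (mset_set (cells_of M)) = mset s}"
        using fill_ss[OF len assms(1), of w] fill_content[OF len, of w] by (auto simp: yam_words_def)
    next
      fix T assume "T \<in> {T. ssyt_of M T \<and> image_mset T (mset_set (cells_of M)) = mset s}"
      then show "T \<in> (\<lambda>w. fill w s) ` {w \<in> yam_words M. strict_at s (descents w)}"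
        using fill_surj[OF assms, of T] by (auto simp: yam_words_def)
    qed
  qed
  then show ?thesis by (simp add: bij_betw_same_card)
qed

section \<open>Partitions as multisets of rows, and the expansion of Schur functions\<close>

definition shape_of :: "nat list \<Rightarrow> nat multiset" where
  "shape_of la = mset (concat (map (\<lambda>r. replicate (la ! r) r) [0..<length la]))"

lemma shape_of_snoc: "shape_of (la @ [x]) = shape_of la + replicate_mset x (length la)"
proof -
  have "map (\<lambda>r. replicate ((la @ [x]) ! r) r) [0..<length la] = map (\<lambda>r. replicate (la ! r) r) [0..<length la]"
    by (auto simp: nth_append)
  then have "concat (map (\<lambda>r. replicate ((la @ [x]) ! r) r) [0..<length (la @ [x])])
      = concat (map (\<lambda>r. replicate (la ! r) r) [0..<length la]) @ replicate x (length la)"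
    by (simp del: map_eq_conv)
  then show ?thesis by (simp add: shape_of_def)
qed

lemma count_shp: "count (shape_of la) r = (if r < length la then la ! r else 0)"
proof (induction la rule: rev_induct)
  case Nil
  then show ?case by (simp add: shape_of_def)
next
  case (snoc x la)
  then show ?case by (auto simp: shape_of_snoc nth_append)
qed

lemma size_shp: "size (shape_of la) = sum_list la"
proof (induction la rule: rev_induct)
  case (snoc x la)
  then show ?case by (auto simp: shape_of_snoc)
qed (simp add: shape_of_def)

lemma cells_shp: "cells la = cells_of (shape_of la)"
  by (auto simp: cells_def cells_of_def count_shp split: if_splits)

lemma is_shape_shp: "is_partition la \<Longrightarrow> is_shape (shape_of la)"
  unfolding is_partition_def is_shape_def by (auto simp: count_shp sorted_wrt_iff_nth_less)

lemma ssyt_shp: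
  assumes "is_partition la"
  shows "ssyt la T \<longleftrightarrow> ssyt_of (shape_of la) T"
proof -
  have d: "c < count (shape_of la) r" if "c < count (shape_of la) (Suc r)" for r c
    using that is_shape_shp[OF assms] unfolding is_shape_def by (meson less_le_trans)
  show ?thesis unfolding ssyt_def ssyt_of_def cells_shp using d by (auto simp: cells_of_def)
qed

lemma sorted_count_unique:
  assumes "sorted s" "sorted t" "\<And>k. count_list s k = count_list t k"
  shows "s = (t :: nat list)"
proof -
  have "mset s = mset t" using assms(3) by (intro multiset_eqI) (simp add: count_mset)
  then show ?thesis using assms by (metis properties_for_sort sorted_sort_id)
qed

text \<open>A monomial determines its sorted index sequence, so every coefficient is 0 or 1.\<close>

lemma Qcoef_eq:
  assumes "sorted s" "length s = m" "\<And>k. count_list s k = a k"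
  shows "Qcoef m D a = (if strict_at s D then 1 else 0)"
proof -
  have "{is. length is = m \<and> sorted is \<and> (\<forall>j\<in>D. is ! (j - 1) < is ! j) \<and> (\<forall>k. count_list is k = a k)}
     = (if strict_at s D then {s} else {})"
  proof -
    have u: "is = s" if "sorted is" "\<forall>k. count_list is k = a k" for "is"
      by (rule sorted_count_unique[OF that(1) assms(1)]) (simp add: that(2) assms(3))
    show ?thesis
    proof (intro equalityI subsetI)
      fix t assume "t \<in> (if strict_at s D then {s} else {})"
      then show "t \<in> {is. length is = m \<and> sorted is \<and> (\<forall>j\<in>D. is ! (j - 1) < is ! j) \<and> (\<forall>k. count_list is k = a k)}"
        using assms unfolding strict_at_def by (simp split: if_splits)
    next
      fix t assume "t \<in> {is. length is = m \<and> sorted is \<and> (\<forall>j\<in>D. is ! (j - 1) < is ! j) \<and> (\<forall>k. count_list is k = a k)}"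
      then show "t \<in> (if strict_at s D then {s} else {})"
        using u[of t] unfolding strict_at_def by simp
    qed
  qed
  then show ?thesis unfolding Qcoef_def by simp
qed

lemma Qcoef_0:
  assumes "\<not> (\<exists>s. sorted s \<and> length s = m \<and> (\<forall>k. count_list s k = a k))"
  shows "Qcoef m D a = 0"
proof -
  have "{is. length is = m \<and> sorted is \<and> (\<forall>j\<in>D. is ! (j - 1) < is ! j) \<and> (\<forall>k. count_list is k = a k)} = {}"
    using assms by auto
  then show ?thesis by (simp only: Qcoef_def card.empty)
qed

lemma count_image_cel: "count (image_mset T (mset_set (cells_of M))) k = card {x \<in> cells_of M. T x = k}"
proof -
  have "{x \<in> cells_of M. T x = k} = T -` {k} \<inter> cells_of M" by auto
  then show ?thesis by (simp add: count_image_mset)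
qed

lemma card_filter: "finite A \<Longrightarrow> int (card {x \<in> A. P x}) = (\<Sum>x\<in>A. if P x then 1 else 0)"
  by (simp add: sum.inter_filter[symmetric])

text \<open>Gessel's expansion: the semistandard tableaux of a given content are sorted by their
  standardizations, here recorded as Yamanouchi words.\<close>

theorem schur_coef_eq:
  assumes "is_partition la"
  shows "schur_coef la a = (\<Sum>w\<in>yam_words (shape_of la). Qcoef (sum_list la) (descents w) a)"
proof (cases "\<exists>s. sorted s \<and> length s = sum_list la \<and> (\<forall>k. count_list s k = a k)")
  case True
  then obtain s where s: "sorted s" "length s = sum_list la" "\<And>k. count_list s k = a k" by blast
  have "{T. ssyt la T \<and> (\<forall>k. card {x \<in> cells la. T x = k} = a k)}
      = {T. ssyt_of (shape_of la) T \<and> image_mset T (mset_set (cells_of (shape_of la))) = mset s}"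
    unfolding ssyt_shp[OF assms] cells_shp multiset_eq_iff count_image_cel using s(3) by (simp add: count_mset)
  then have "schur_coef la a = int (card {w \<in> yam_words (shape_of la). strict_at s (descents w)})"
    using card_ss[OF s(1) is_shape_shp[OF assms]] s(2) by (simp add: schur_coef_def size_shp)
  also have "\<dots> = (\<Sum>w\<in>yam_words (shape_of la). if strict_at s (descents w) then 1 else 0)"
    by (rule card_filter) simp
  finally show ?thesis using Qcoef_eq[OF s] by simp
next
  case False
  have "{T. ssyt la T \<and> (\<forall>k. card {x \<in> cells la. T x = k} = a k)} = {}"
  proof (rule ccontr)
    assume "\<not> ?thesis"
    then obtain T where T: "\<And>k. card {x \<in> cells la. T x = k} = a k" by auto
    define s where "s = sorted_list_of_multiset (image_mset T (mset_set (cells_of (shape_of la))))"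
    have "sorted s" "length s = sum_list la"
      unfolding s_def by (simp_all flip: size_mset add: card_cel size_shp)
    moreover have "count_list s k = a k" for k
      using T[of k] unfolding cells_shp count_image_cel[symmetric] s_def
      by (metis count_mset mset_sorted_list_of_multiset)
    ultimately show False using False by blast
  qed
  then have "schur_coef la a = 0" by (simp only: schur_coef_def card.empty)
  then show ?thesis using Qcoef_0[OF False] by simp
qed

section \<open>Linear independence of the fundamental quasisymmetric functions\<close>

lemma card_partition_subsets:
  assumes "finite Z" "finite E"
  shows "card {x \<in> Z. B x \<subseteq> E} = (\<Sum>E'\<in>Pow E. card {x \<in> Z. B x = E'})"
proof -
  have "{x \<in> Z. B x \<subseteq> E} = (\<Union>E'\<in>Pow E. {x \<in> Z. B x = E'})" by auto
  moreover have "card (\<Union>E'\<in>Pow E. {x \<in> Z. B x = E'}) = (\<Sum>E'\<in>Pow E. card {x \<in> Z. B x = E'})"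
    using assms by (intro card_UN_disjoint) auto
  ultimately show ?thesis by simp
qed

text \<open>A suitable coefficient counts the indices with \<open>D x \<subseteq> E\<close>.
  Induction over the proper subsets of \<open>E\<close> then isolates those with
  \<open>D x = E\<close>.\<close>

lemma Qcoef_independent:
  fixes D :: "'a \<Rightarrow> nat set" and D' :: "'b \<Rightarrow> nat set"
  assumes fin: "finite X" "finite Y"
    and sub: "\<And>x. x \<in> X \<Longrightarrow> D x \<subseteq> {0<..<m}" "\<And>y. y \<in> Y \<Longrightarrow> D' y \<subseteq> {0<..<m}"
    and eq: "\<And>a. (\<Sum>x\<in>X. Qcoef m (D x) a) = (\<Sum>y\<in>Y. Qcoef m (D' y) a)"
  shows "card {x \<in> X. D x = E} = card {y \<in> Y. D' y = E}"
proof -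
  have le: "card {x \<in> X. D x \<subseteq> E} = card {y \<in> Y. D' y \<subseteq> E}" if E: "E \<subseteq> {0<..<m}" for E
  proof -
    \<comment> \<open>This sequence jumps exactly at the elements of \<open>E\<close>, so it is
      strict at \<open>B\<close> iff \<open>B \<subseteq> E\<close>.\<close>
    define s where "s = map (\<lambda>j. card (E \<inter> {1..j})) [0..<m]"
    have s: "sorted s" "length s = m"
      unfolding s_def by (auto simp: sorted_iff_nth_mono intro!: card_mono)
    have st: "strict_at s B \<longleftrightarrow> B \<subseteq> E" if B: "B \<subseteq> {0<..<m}" for B
    proof -
      have "s ! (j - 1) < s ! j \<longleftrightarrow> j \<in> E" if j: "0 < j" "j < m" for j
      proof -
        have "E \<inter> {1..j} = (if j \<in> E then insert j (E \<inter> {1..j - 1}) else E \<inter> {1..j - 1})"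
          using j by (auto simp: le_less)
        moreover have "j \<notin> E \<inter> {1..j - 1}" using j by auto
        ultimately have "card (E \<inter> {1..j}) = card (E \<inter> {1..j - 1}) + (if j \<in> E then 1 else 0)"
          by (cases "j \<in> E") (simp_all only: card_insert_disjoint finite_Int finite_atLeastAtMost if_True if_False, simp_all)
        then show ?thesis using j by (simp add: s_def)
      qed
      then show ?thesis using B unfolding strict_at_def by (auto simp: subset_iff)
    qed
    have q: "Qcoef m B (count_list s) = (if strict_at s B then 1 else 0)" for B
      using Qcoef_eq[OF s] by blast
    have "int (card {x \<in> X. D x \<subseteq> E}) = (\<Sum>x\<in>X. Qcoef m (D x) (count_list s))"
      unfolding q card_filter[OF fin(1)] using st[OF sub(1)] by (intro sum.cong) auto
    also have "\<dots> = (\<Sum>y\<in>Y. Qcoef m (D' y) (count_list s))" by (rule eq)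
    also have "\<dots> = int (card {y \<in> Y. D' y \<subseteq> E})"
      unfolding q card_filter[OF fin(2)] using st[OF sub(2)] by (intro sum.cong) auto
    finally show ?thesis by simp
  qed
  show ?thesis
  proof (cases "E \<subseteq> {0<..<m}")
    case True
    then have "finite E" by (rule finite_subset) simp
    then show ?thesis using True
    proof (induction E rule: finite_psubset_induct)
      case (psubset E)
      have "Pow E = insert E {E'. E' \<subset> E}" by auto
      then have *: "(\<Sum>E'\<in>Pow E. f E') = f E + (\<Sum>E'\<in>{E'. E' \<subset> E}. f E')" for f :: "nat set \<Rightarrow> nat"
      proof -
        have "{E'. E' \<subset> E} \<subseteq> Pow E" by auto
        then have "finite {E'. E' \<subset> E}" by (rule finite_subset) (simp add: psubset.hyps)
        then show ?thesis using \<open>Pow E = _\<close> by simp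
      qed
      have "(\<Sum>E'\<in>{E'. E' \<subset> E}. card {x \<in> X. D x = E'}) = (\<Sum>E'\<in>{E'. E' \<subset> E}. card {y \<in> Y. D' y = E'})"
        using psubset.IH psubset.prems by (intro sum.cong) auto
      then show ?case using le[OF psubset.prems] card_partition_subsets[OF fin(1) psubset.hyps(1), of D]
          card_partition_subsets[OF fin(2) psubset.hyps(1), of D'] *
        by simp
    qed
  next
    case False
    then have "{x \<in> X. D x = E} = {}" "{y \<in> Y. D' y = E} = {}" using sub by auto
    then show ?thesis by (simp only: card.empty)
  qed
qed

section \<open>Descent patterns in windows of at most five consecutive entries\<close>

primrec yam_list :: "nat \<Rightarrow> nat list list" where
  "yam_list 0 = [[]]"
| "yam_list (Suc m) = concat (map (\<lambda>w. map (\<lambda>r. w @ [r])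
     (filter (\<lambda>r. r = 0 \<or> count_list w r < count_list w (r - 1)) [0..<Suc m])) (yam_list m))"

text \<open>Only the content of \<open>w\<close> matters: there is one list of descent bits for each
  standard tableau of that shape. Lists are used so that the profiles can be computed by
  evaluation.\<close>

definition profile_of :: "nat \<Rightarrow> nat list \<Rightarrow> bool list list" where
  "profile_of m w = map (\<lambda>v. map (\<lambda>j. v ! (j - 1) < v ! j) [1..<m])
     (filter (\<lambda>v. sort v = sort w) (yam_list m))"

lemma mem_snocs:
  "w @ [r] \<in> set (concat (map (\<lambda>w. map (\<lambda>r. w @ [r]) (filter (P w) [0..<k])) ws)) \<longleftrightarrow>
    w \<in> set ws \<and> r < k \<and> P w r"
  by auto

lemma set_ylist: "set (yam_list m) = {w. yamanouchi w \<and> length w = m}"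
proof (induction m)
  case (Suc m)
  have iff: "w @ [r] \<in> set (yam_list (Suc m)) \<longleftrightarrow> yamanouchi (w @ [r]) \<and> length w = m" for w r
  proof -
    have "r \<le> m" if "yamanouchi (w @ [r])" "length w = m"
    proof -
      have "r \<le> card (descents (w @ [r]) \<inter> {1..m})" using yamanouchi_nth_le[OF that(1), of m] that(2) by (auto simp: nth_append)
      also have "\<dots> \<le> card {1..m}" by (rule card_mono) auto
      finally show ?thesis by simp
    qed
    moreover have "is_shape (add_mset r (mset w)) \<longleftrightarrow> r = 0 \<or> count_list w r < count_list w (r - 1)" if "yamanouchi w"
      using is_shape_add_iff[OF yamanouchi_dec[OF that], of r] by (simp add: count_mset)
    ultimately show ?thesis unfolding yam_list.simps mem_snocs using Suc by (auto simp: less_Suc_eq_le)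
  qed
  have ne: "w \<noteq> []" if "w \<in> set (yam_list (Suc m))" for w using that by auto
  show ?case
  proof (intro set_eqI)
    fix v
    show "v \<in> set (yam_list (Suc m)) \<longleftrightarrow> v \<in> {w. yamanouchi w \<and> length w = Suc m}"
    proof (cases v rule: rev_cases)
      case Nil
      then show ?thesis using ne[of v] by auto
    next
      case (snoc w r)
      then show ?thesis using iff[of w r] by auto
    qed
  qed
qed auto

lemma distinct_snocs:
  "distinct ws \<Longrightarrow> distinct (concat (map (\<lambda>w. map (\<lambda>r. w @ [r]) (filter (P w) [0..<k])) ws))"
  by (induction ws) (auto simp: distinct_map inj_on_def)

lemma distinct_ylist: "distinct (yam_list m)"
proof (induction m)
  case (Suc m)
  show ?case unfolding yam_list.simps by (rule distinct_snocs[OF Suc])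
qed simp

text \<open>The partitions of 5 in the order 5, 41, 32, 311, 221, 2111, 11111.\<close>

abbreviation profiles_5 :: "bool list list set" where
  "profiles_5 \<equiv> {[[False, False, False, False]],
    [[False, False, False, True], [False, False, True, False], [False, True, False, False], [True, False, False, False]],
    [[False, False, True, False], [False, True, False, True], [False, True, False, False], [True, False, False, True], [True, False, True, False]],
    [[False, False, True, True], [False, True, False, True], [False, True, True, False], [True, False, False, True], [True, False, True, False], [True, True, False, False]],
    [[False, True, False, True], [False, True, True, False], [True, False, True, True], [True, False, True, False], [True, True, False, True]],
    [[False, True, True, True], [True, False, True, True], [True, True, False, True], [True, True, True, False]],
    [[True, True, True, True]]}"

lemma profiles3: "profile_of 3 ` set (yam_list 3) \<subseteq> {[[False, False]],
    [[False, True], [True, False]],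
    [[True, True]]}"
  by code_simp

lemma profiles4: "profile_of 4 ` set (yam_list 4) \<subseteq> {[[False, False, False]],
    [[False, False, True], [False, True, False], [True, False, False]],
    [[False, True, False], [True, False, True]],
    [[False, True, True], [True, False, True], [True, True, False]],
    [[True, True, True]]}"
  by code_simp

lemma profiles5: "profile_of 5 ` set (yam_list 5) \<subseteq> profiles_5"
  by code_simp

text \<open>The symmetry behind this is evacuation, which reverses descent sets. It serves to
  exchange the two ends of a window in \<open>flip\<close>.\<close>

lemma profiles5_rev: "\<forall>S\<in>set ` profiles_5. rev ` S \<in> set ` profiles_5"
  by code_simp

lemma profiles5_distinct: "\<forall>L\<in>profiles_5. distinct L"
  by code_simp

lemma profiles5_card: "\<forall>S\<in>set ` profiles_5. card S \<noteq> 2"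
  by code_simp

definition window_des :: "('a \<Rightarrow> nat set) \<Rightarrow> nat \<Rightarrow> nat \<Rightarrow> 'a \<Rightarrow> nat set" where
  "window_des Des k m U = {j. 0 < j \<and> j < m \<and> j + k \<in> Des U}"

lemma profile_of_eq:
  assumes "yamanouchi u" "length u = m"
  shows "mset (profile_of m u) = image_mset (\<lambda>w. map (\<lambda>j. j \<in> descents w) [1..<m]) (mset_set (yam_words (mset u)))"
proof -
  have "set (filter (\<lambda>v. sort v = sort u) (yam_list m)) = yam_words (mset u)"
  proof -
    have "sort v = sort u \<longleftrightarrow> mset v = mset u" for v
      by (metis mset_sort properties_for_sort sorted_sort)
    then show ?thesis using assms size_mset by (auto simp: set_ylist yam_words_def) (metis size_mset)
  qed
  then have e: "mset_set (yam_words (mset u)) = mset (filter (\<lambda>v. sort v = sort u) (yam_list m))"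
    using distinct_ylist[of m] by (metis distinct_filter mset_set_set)
  have "map (\<lambda>j. v ! (j - 1) < v ! j) [1..<m] = map (\<lambda>j. j \<in> descents v) [1..<m]"
    if "v \<in> set (yam_list m)" for v
    using that by (auto simp: set_ylist descents_def)
  then show ?thesis unfolding profile_of_def mset_map e by (intro image_mset_cong) (auto simp del: map_eq_conv)
qed

lemma inj_on_distinct:
  assumes "finite X" "image_mset f (mset_set X) = mset L" "distinct L"
  shows "inj_on f X" "f ` X = set L" "card X = length L"
proof -
  show c: "card X = length L" using assms(2) by (metis size_image_mset size_mset size_mset_set)
  have "set_mset (image_mset f (mset_set X)) = set L" using assms(2) by simp
  then show i: "f ` X = set L" using assms(1) by simp
  have "card (f ` X) = card X" using c i assms(3) by (simp add: distinct_card)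
  then show "inj_on f X" using assms(1) by (simp add: eq_card_imp_inj_on)
qed

text \<open>A class of three consecutive involutions \<open>f\<close>, \<open>g\<close>, \<open>h\<close>, with the membership of four consecutive
  positions in the descent set as bits. All Schur functions of degree at most five are multiplicity
  free in the fundamental basis, so the bits determine the element.\<close>

locale window5 =
  fixes X :: "'a set" and f g h :: "'a \<Rightarrow> 'a" and B :: "'a \<Rightarrow> bool list" and b1 b2 b3 b4 :: "'a \<Rightarrow> bool" and S
  assumes B: "B T = [b1 T, b2 T, b3 T, b4 T]"
    and cl: "T \<in> X \<Longrightarrow> f T \<in> X" "T \<in> X \<Longrightarrow> g T \<in> X" "T \<in> X \<Longrightarrow> h T \<in> X"
    and inv: "T \<in> X \<Longrightarrow> f (f T) = T" "T \<in> X \<Longrightarrow> g (g T) = T" "T \<in> X \<Longrightarrow> h (h T) = T"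
    and min: "Y \<subseteq> X \<Longrightarrow> Y \<noteq> {} \<Longrightarrow> (\<And>T. T \<in> Y \<Longrightarrow> f T \<in> Y \<and> g T \<in> Y \<and> h T \<in> Y) \<Longrightarrow> Y = X"
    and f3: "T \<in> X \<Longrightarrow> b1 T = b2 T \<Longrightarrow> f T = T" "T \<in> X \<Longrightarrow> b1 T \<noteq> b2 T \<Longrightarrow> b1 (f T) = b2 T \<and> b2 (f T) = b1 T"
    and g3: "T \<in> X \<Longrightarrow> b2 T = b3 T \<Longrightarrow> g T = T" "T \<in> X \<Longrightarrow> b2 T \<noteq> b3 T \<Longrightarrow> b2 (g T) = b3 T \<and> b3 (g T) = b2 T"
    and h3: "T \<in> X \<Longrightarrow> b3 T = b4 T \<Longrightarrow> h T = T" "T \<in> X \<Longrightarrow> b3 T \<noteq> b4 T \<Longrightarrow> b3 (h T) = b4 T \<and> b4 (h T) = b3 T"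
    and f4: "T \<in> X \<Longrightarrow> b3 (f T) \<noteq> b3 T \<Longrightarrow> f T = g T"
    and g4: "T \<in> X \<Longrightarrow> b1 (g T) \<noteq> b1 T \<Longrightarrow> f T = g T" "T \<in> X \<Longrightarrow> b4 (g T) \<noteq> b4 T \<Longrightarrow> g T = h T"
    and h4: "T \<in> X \<Longrightarrow> b2 (h T) \<noteq> b2 T \<Longrightarrow> g T = h T"
    and profile_of: "inj_on B X" "B ` X = S"
    and S: "S \<in> set ` profiles_5"
begin

lemma inj: "T \<in> X \<Longrightarrow> U \<in> X \<Longrightarrow> b1 T = b1 U \<Longrightarrow> b2 T = b2 U \<Longrightarrow> b3 T = b3 U \<Longrightarrow> b4 T = b4 U \<Longrightarrow> T = U"
  using profile_of(1) by (simp add: inj_on_def B)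

lemma mem: "T \<in> X \<Longrightarrow> [b1 T, b2 T, b3 T, b4 T] \<in> S"
  using profile_of(2) B by (metis imageI)

lemma ex: "l \<in> S \<Longrightarrow> \<exists>T\<in>X. B T = l"
  using profile_of(2) by (metis imageE)

lemma card_ne_2: "card X \<noteq> 2"
  using bspec[OF profiles5_card S] profile_of card_image[OF profile_of(1)] by simp

text \<open>\<open>T\<close> and \<open>U\<close> would form a class by themselves, but no shape of
  size five has exactly two standard tableaux.\<close>

lemma no_pair:
  assumes "T \<in> X" "U \<in> X" "T \<noteq> U" "f T = U" "g T = U" "h T = U"
  shows False
proof -
  have "{T, U} = X" by (rule min) (use assms inv(1)[OF assms(1)] inv(2)[OF assms(1)] inv(3)[OF assms(1)] in auto)
  then show False using card_ne_2 assms(3) by (metis card_2_iff)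
qed

lemma f_34: "T \<in> X \<Longrightarrow> b3 (f T) \<noteq> b3 T \<Longrightarrow> b4 (f T) = b4 T"
  using no_pair[of T "f T"] f4[of T] g4(2)[of T] cl by metis

text \<open>If \<open>f\<close> changes the fourth bit of \<open>T\<close>, the patterns of
  \<open>T\<close> and \<open>f T\<close> leave only the shapes 32 and 221. Both contain the pattern
  False, True, False, True, and \<open>f\<close> must send its element to \<open>T\<close> or
  \<open>f T\<close>. As \<open>f\<close> is an involution, that element is itself \<open>T\<close>
  or \<open>f T\<close>, although \<open>f\<close> keeps its fourth bit.\<close>

lemma f_4: 
  assumes T: "T \<in> X"
  shows "b4 (f T) = b4 T"
proof (rule ccontr)
  assume ne: "b4 (f T) \<noteq> b4 T"
  have b3: "b3 (f T) = b3 T" using f_34[OF T] ne by blast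
  have b12: "b1 T \<noteq> b2 T" using f3(1)[OF T] ne by metis
  have m: "[b1 T, b2 T, b3 T, b4 T] \<in> S" "[b2 T, b1 T, b3 T, \<not> b4 T] \<in> S"
    using mem[OF T] mem[OF cl(1)[OF T]] f3(2)[OF T b12] b3 ne by simp_all
  \<comment> \<open>Two patterns that differ by exchanging the first two bits, exchanged bits being
    different, and flipping the fourth occur together only in the profiles of 32 and 221.\<close>
  have "[False, True, False, True] \<in> S
    \<and> ([True, False, True, True] \<in> S \<longrightarrow> [False, True, True, False] \<in> {[b1 T, b2 T, b3 T, b4 T], [b2 T, b1 T, b3 T, \<not> b4 T]})
    \<and> ([True, False, False, True] \<in> S \<longrightarrow> [False, True, False, False] \<in> {[b1 T, b2 T, b3 T, b4 T], [b2 T, b1 T, b3 T, \<not> b4 T]})"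
    using m b12 S unfolding image_insert image_empty by (elim insertE emptyE; cases "b1 T"; cases "b2 T"; cases "b3 T"; cases "b4 T"; simp)
  then have 0: "[False, True, False, True] \<in> S"
    and 1: "[True, False, True, True] \<in> S \<Longrightarrow> [False, True, True, False] \<in> {[b1 T, b2 T, b3 T, b4 T], [b2 T, b1 T, b3 T, \<not> b4 T]}"
    and 2: "[True, False, False, True] \<in> S \<Longrightarrow> [False, True, False, False] \<in> {[b1 T, b2 T, b3 T, b4 T], [b2 T, b1 T, b3 T, \<not> b4 T]}"
    by blast+
  obtain U where U: "U \<in> X" "\<not> b1 U" "b2 U" "\<not> b3 U" "b4 U"
    using ex[OF 0] by (auto simp: B)
  let ?V = "f U"
  have V: "?V \<in> X" "b1 ?V" "\<not> b2 ?V" using cl(1) U f3(2)[of U] by auto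
  have b4: "b4 ?V" 
  proof (rule ccontr)
    assume n4: "\<not> b4 ?V"
    then have "\<not> b3 ?V" using f_34[OF U(1)] U by blast
    then have "[True, False, False, False] \<in> S" using mem[OF V(1)] V n4 by simp
    moreover have "[False, True, False, True] \<in> S" using 0 .
    ultimately show False using S unfolding image_insert image_empty by (elim insertE emptyE; simp)
  qed
  \<comment> \<open>The pattern of \<open>?V\<close> is True, False, \<open>b3 ?V\<close>, True.
    Shape 32 has only one such pattern (third bit False), and so has shape 221 (third bit True); in
    both cases it belongs to \<open>T\<close> or \<open>f T\<close>.\<close>
  have "?V = T \<or> ?V = f T"
  proof (cases "b3 ?V")
    case True
    then have "[False, True, True, False] \<in> {[b1 T, b2 T, b3 T, b4 T], [b2 T, b1 T, b3 T, \<not> b4 T]}"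
      using 1 mem[OF V(1)] V b4 by simp
    then show ?thesis using inj[OF V(1) T] inj[OF V(1) cl(1)[OF T]] f3(2)[OF T b12] b3 ne V b4 True by auto
  next
    case False
    then have "[False, True, False, False] \<in> {[b1 T, b2 T, b3 T, b4 T], [b2 T, b1 T, b3 T, \<not> b4 T]}"
      using 2 mem[OF V(1)] V b4 by simp
    then show ?thesis using inj[OF V(1) T] inj[OF V(1) cl(1)[OF T]] f3(2)[OF T b12] b3 ne V b4 False by auto
  qed
  then have "U = f T \<or> U = T" using inv(1) U(1) T by metis
  then show False using \<open>?V = T \<or> ?V = f T\<close> b4 U(5) ne inv(1)[OF T] by metis
qed

text \<open>Reading the window from right to left exchanges \<open>f\<close> and \<open>h\<close>,
  so that facts about \<open>f\<close> yield facts about \<open>h\<close>.\<close>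

lemma flip: "window5 X h g f (\<lambda>T. rev (B T)) b4 b3 b2 b1 (rev ` S)"
proof
  show "inj_on (\<lambda>T. rev (B T)) X" using profile_of(1) by (simp add: inj_on_def)
  show "(\<lambda>T. rev (B T)) ` X = rev ` S" using profile_of(2) by auto
  show "rev ` S \<in> set ` profiles_5"
    by (rule bspec[OF profiles5_rev S])
  show "T \<in> X \<Longrightarrow> b2 (h T) \<noteq> b2 T \<Longrightarrow> h T = g T" for T using h4 by metis
  show "T \<in> X \<Longrightarrow> b3 (f T) \<noteq> b3 T \<Longrightarrow> g T = f T" for T using f4 by metis
  show "T \<in> X \<Longrightarrow> b4 (g T) \<noteq> b4 T \<Longrightarrow> h T = g T" for T using g4 by metis
  show "T \<in> X \<Longrightarrow> b1 (g T) \<noteq> b1 T \<Longrightarrow> g T = f T" for T using g4 by metis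
  show "Y = X" if "Y \<subseteq> X" "Y \<noteq> {}" "\<And>T. T \<in> Y \<Longrightarrow> h T \<in> Y \<and> g T \<in> Y \<and> f T \<in> Y" for Y
    using that by (intro min) blast+
  show "T \<in> X \<Longrightarrow> b4 T = b3 T \<Longrightarrow> h T = T" for T using h3(1) by metis
  show "T \<in> X \<Longrightarrow> b4 T \<noteq> b3 T \<Longrightarrow> b4 (h T) = b3 T \<and> b3 (h T) = b4 T" for T using h3(2) by metis
  show "T \<in> X \<Longrightarrow> b3 T = b2 T \<Longrightarrow> g T = T" for T using g3(1) by metis
  show "T \<in> X \<Longrightarrow> b3 T \<noteq> b2 T \<Longrightarrow> b3 (g T) = b2 T \<and> b2 (g T) = b3 T" for T using g3(2) by metis
  show "T \<in> X \<Longrightarrow> b2 T = b1 T \<Longrightarrow> f T = T" for T using f3(1) by metis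
  show "T \<in> X \<Longrightarrow> b2 T \<noteq> b1 T \<Longrightarrow> b2 (f T) = b1 T \<and> b1 (f T) = b2 T" for T using f3(2) by metis
  show "rev (B T) = [b4 T, b3 T, b2 T, b1 T]" for T by (simp add: B)
  show "T \<in> X \<Longrightarrow> f T \<in> X" for T by (rule cl(1))
  show "T \<in> X \<Longrightarrow> g T \<in> X" for T by (rule cl(2))
  show "T \<in> X \<Longrightarrow> h T \<in> X" for T by (rule cl(3))
  show "T \<in> X \<Longrightarrow> f (f T) = T" for T by (rule inv(1))
  show "T \<in> X \<Longrightarrow> g (g T) = T" for T by (rule inv(2))
  show "T \<in> X \<Longrightarrow> h (h T) = T" for T by (rule inv(3))
qed

lemma h_1: "T \<in> X \<Longrightarrow> b1 (h T) = b1 T"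
  using window5.f_4[OF flip] by blast

text \<open>The two sides are true for a class of shape 311 and false for one of shape 32.\<close>

lemma F1:
  assumes T: "T \<in> X" and b: "b1 T" "\<not> b2 T" "\<not> b3 T" "b4 T"
  shows "b4 (g (f T)) \<longleftrightarrow> b1 (g (h T))"
proof -
  let ?U = "f T" and ?V = "h T"
  have U: "?U \<in> X" "\<not> b1 ?U" "b2 ?U" "b4 ?U" using cl(1) T f3(2)[OF T] f_4[OF T] b by auto
  have V: "?V \<in> X" "b1 ?V" "b3 ?V" "\<not> b4 ?V" using cl(3) T h3(2)[OF T] h_1[OF T] b by auto
  \<comment> \<open>Only the profiles of 32 and 311 contain the pattern of \<open>T\<close>.\<close>
  have S2: "S = {[False, False, True, False], [False, True, False, True], [False, True, False, False], [True, False, False, True], [True, False, True, False]}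
    \<or> S = {[False, False, True, True], [False, True, False, True], [False, True, True, False], [True, False, False, True], [True, False, True, False], [True, True, False, False]}"
    using S mem[OF T] b unfolding image_insert image_empty by (elim insertE emptyE; simp)
  have U3: "\<not> b3 ?U" using S2 mem[OF U(1)] U by (cases "b3 ?U") auto
  have V2: "\<not> b2 ?V" using S2 mem[OF V(1)] V by (cases "b2 ?V") auto
  let ?W = "g ?U" and ?Z = "g ?V"
  have W: "?W \<in> X" "\<not> b2 ?W" "b3 ?W" using cl(2) U g3(2)[OF U(1)] U3 by auto
  have Z: "?Z \<in> X" "b2 ?Z" "\<not> b3 ?Z" using cl(2) V g3(2)[OF V(1)] V2 by auto
  have "b1 ?W \<Longrightarrow> ?W = T" using g4(1)[OF U(1)] U(2) inv(1)[OF T] by metis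
  then have W1: "\<not> b1 ?W" using W b by metis
  have "b4 ?Z \<Longrightarrow> ?Z = T" using g4(2)[OF V(1)] V(4) inv(3)[OF T] by metis
  then have Z4: "\<not> b4 ?Z" using Z b by metis
  show ?thesis using S2 mem[OF W(1)] mem[OF Z(1)] W Z W1 Z4 by (elim disjE; cases "b4 ?W"; cases "b1 ?Z"; simp)
qed

text \<open>The two sides are false for a class of shape 311 and true for one of shape 221.\<close>

lemma F2:
  assumes T: "T \<in> X" and b: "\<not> b1 T" "b2 T" "\<not> b3 T" "b4 T"
    and bh: "b2 (h T)"
  shows "b1 (g T) \<longleftrightarrow> b4 (g (f (h T)))"
proof -
  let ?V = "h T" and ?W = "g T"
  have V: "?V \<in> X" "\<not> b1 ?V" "b2 ?V" "b3 ?V" "\<not> b4 ?V" using cl(3) T h3(2)[OF T] h_1[OF T] b bh by auto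
  \<comment> \<open>Only the profiles of 311 and 221 contain the patterns of both \<open>T\<close>
    and \<open>h T\<close>.\<close>
  have S2: "S = {[False, False, True, True], [False, True, False, True], [False, True, True, False], [True, False, False, True], [True, False, True, False], [True, True, False, False]}
    \<or> S = {[False, True, False, True], [False, True, True, False], [True, False, True, True], [True, False, True, False], [True, True, False, True]}"
    using S mem[OF T] mem[OF V(1)] b V unfolding image_insert image_empty by (elim insertE emptyE; simp)
  have W: "?W \<in> X" "\<not> b2 ?W" "b3 ?W" using cl(2) T g3(2)[OF T] b by auto
  have W4: "b4 ?W"
  proof (rule ccontr)
    assume "\<not> b4 ?W"
    then have "g T = h T" using g4(2)[OF T] b by blast
    then show False using W(2) V(3) by metis
  qed
  let ?Q = "f ?V"
  have Q: "?Q \<in> X" "b1 ?Q" "\<not> b2 ?Q" "\<not> b4 ?Q" using cl(1) V f3(2)[OF V(1)] f_4[OF V(1)] by auto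
  have Q3: "b3 ?Q" using S2 mem[OF Q(1)] Q by (cases "b3 ?Q") auto
  let ?R = "g ?Q"
  have R: "?R \<in> X" "b2 ?R" "\<not> b3 ?R" using cl(2) Q g3(2)[OF Q(1)] Q3 by auto
  have R1: "b1 ?R"
  proof (rule ccontr)
    assume "\<not> b1 ?R"
    then have "?R = ?V" using g4(1)[OF Q(1)] Q inv(1)[OF V(1)] by metis
    then show False using R(3) V(4) by metis
  qed
  show ?thesis using S2 mem[OF W(1)] mem[OF R(1)] W R W4 R1 by (elim disjE; cases "b1 ?W"; cases "b4 ?R"; simp)
qed

end

section \<open>Dual equivalences in terms of descent statistics\<close>

definition reachable :: "(nat \<Rightarrow> 'a \<Rightarrow> 'a) \<Rightarrow> nat set \<Rightarrow> 'a \<Rightarrow> 'a \<Rightarrow> bool" where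
  "reachable \<phi> I T S \<longleftrightarrow> (\<exists>p. set p \<subseteq> I \<and> fold \<phi> p T = S)"

text \<open>Condition (i) with the generating functions removed, which linear independence of the
  fundamental quasisymmetric functions permits. The window consists of the entries
  \<open>k + 1\<close> to \<open>k + m\<close>; on each of its classes the descent sets are
  distributed as on the standard tableaux of one shape \<open>M\<close>.\<close>

locale dual =
  fixes n :: nat and A :: "'a set" and Des :: "'a \<Rightarrow> nat set" and \<phi> :: "nat \<Rightarrow> 'a \<Rightarrow> 'a"
  assumes finA: "finite A"
    and closed: "2 \<le> i \<Longrightarrow> i < n \<Longrightarrow> T \<in> A \<Longrightarrow> \<phi> i T \<in> A"
    and invol: "2 \<le> i \<Longrightarrow> i < n \<Longrightarrow> T \<in> A \<Longrightarrow> \<phi> i (\<phi> i T) = T"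
    and comm: "2 \<le> i \<Longrightarrow> i + 3 \<le> j \<Longrightarrow> j < n \<Longrightarrow> T \<in> A \<Longrightarrow> \<phi> i (\<phi> j T) = \<phi> j (\<phi> i T)"
    and loc: "3 \<le> m \<Longrightarrow> m \<le> 6 \<Longrightarrow> k + m \<le> n \<Longrightarrow> T \<in> A \<Longrightarrow>
      \<exists>M. is_shape M \<and> size M = m \<and> (\<forall>E. card {U. reachable \<phi> {k + 2..<k + m} T U \<and> window_des Des k m U = E} = card {w \<in> yam_words M. descents w = E})"

lemma fold_shift: "fold (\<lambda>i. \<phi> (i + k)) p T = fold \<phi> (map (\<lambda>i. i + k) p) T"
  by (induction p arbitrary: T) auto

lemma reachable_shift: "reachable (\<lambda>i. \<phi> (i + k)) I T S \<longleftrightarrow> reachable \<phi> ((\<lambda>i. i + k) ` I) T S"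
proof
  assume "reachable (\<lambda>i. \<phi> (i + k)) I T S"
  then obtain p where "set p \<subseteq> I" "fold \<phi> (map (\<lambda>i. i + k) p) T = S"
    unfolding reachable_def fold_shift by auto
  then show "reachable \<phi> ((\<lambda>i. i + k) ` I) T S"
    unfolding reachable_def by (intro exI[of _ "map (\<lambda>i. i + k) p"]) auto
next
  assume "reachable \<phi> ((\<lambda>i. i + k) ` I) T S"
  then obtain p where p: "set p \<subseteq> (\<lambda>i. i + k) ` I" "fold \<phi> p T = S" unfolding reachable_def by auto
  have "map (\<lambda>i. i + k) (map (\<lambda>i. i - k) p) = p" unfolding map_map comp_def
    by (rule map_idI) (use p(1) in auto)
  then show "reachable (\<lambda>i. \<phi> (i + k)) I T S" unfolding reachable_def fold_shift
    using p by (intro exI[of _ "map (\<lambda>i. i - k) p"]) auto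
qed

text \<open>Windows of a dual equivalence are dual equivalences themselves, which makes the
  induction over the size applicable to them.\<close>

lemma dual_shift:
  assumes "dual n A Des \<phi>" "k + m \<le> n"
  shows "dual m A (\<lambda>T. {j. j + k \<in> Des T}) (\<lambda>i. \<phi> (i + k))"
proof -
  interpret dual n A Des \<phi> by fact
  show ?thesis
  proof
    fix m' k' T assume h: "3 \<le> m'" "m' \<le> 6" "k' + m' \<le> m" "T \<in> A"
    have 1: "(\<lambda>i. i + k) ` {k' + 2..<k' + m'} = {(k' + k) + 2..<(k' + k) + m'}"
      by (simp add: add.commute add.left_commute)
    have 2: "window_des (\<lambda>T. {j. j + k \<in> Des T}) k' m' = window_des Des (k' + k) m'"
      by (auto simp: window_des_def fun_eq_iff add.assoc)
    show "\<exists>M. is_shape M \<and> size M = m' \<and>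
      (\<forall>E. card {U. reachable (\<lambda>i. \<phi> (i + k)) {k' + 2..<k' + m'} T U \<and> window_des (\<lambda>T. {j. j + k \<in> Des T}) k' m' U = E}
        = card {w \<in> yam_words M. descents w = E})"
      unfolding reachable_shift 1 2 using loc[of m' "k' + k" T] h assms(2) by simp
  next
    fix i j T assume "2 \<le> i" "i + 3 \<le> j" "j < m" "T \<in> A"
    then show "\<phi> (i + k) (\<phi> (j + k) T) = \<phi> (j + k) (\<phi> (i + k) T)"
      using comm[of "i + k" "j + k" T] assms(2) by simp
  qed (use finA closed invol assms(2) in auto)
qed

lemma descents_nth: "j = Suc (length u) \<Longrightarrow> j \<in> descents (u @ x # y # v) \<longleftrightarrow> x < y"
  by (simp add: descents_def nth_append)

lemma descents_nth1: "j = Suc (Suc (length u)) \<Longrightarrow> j \<in> descents (u @ a # x # y # v) \<longleftrightarrow> x < y"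
  using descents_nth[of j "u @ [a]"] by simp

lemma descents_append: "j < length u \<Longrightarrow> j \<in> descents (u @ v) \<longleftrightarrow> j \<in> descents u"
  by (auto simp: descents_def nth_append)

lemma descents_lt: "j \<in> descents u \<Longrightarrow> 0 < j \<and> j < length u"
  by (auto simp: descents_def)

lemma reachable_refl [simp]: "reachable \<phi> I T T"
  unfolding reachable_def by (intro exI[of _ "[]"]) simp

lemma reachable_trans: "reachable \<phi> I T S \<Longrightarrow> reachable \<phi> I S U \<Longrightarrow> reachable \<phi> I T U"
  unfolding reachable_def by (metis fold_append comp_apply le_sup_iff set_append)

lemma reachable_step: "i \<in> I \<Longrightarrow> reachable \<phi> I T (\<phi> i T)"
  unfolding reachable_def by (intro exI[of _ "[i]"]) simp

context dual
begin

lemma fold_in: "set p \<subseteq> {2..<n} \<Longrightarrow> T \<in> A \<Longrightarrow> fold \<phi> p T \<in> A"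
  by (induction p arbitrary: T) (auto simp: closed)

lemma reachable_in: "reachable \<phi> I T S \<Longrightarrow> I \<subseteq> {2..<n} \<Longrightarrow> T \<in> A \<Longrightarrow> S \<in> A"
  unfolding reachable_def using fold_in by blast

lemma fold_rev: "set p \<subseteq> {2..<n} \<Longrightarrow> T \<in> A \<Longrightarrow> fold \<phi> (rev p) (fold \<phi> p T) = T"
  by (induction p arbitrary: T) (auto simp: invol closed)

lemma reachable_sym: "reachable \<phi> I T S \<Longrightarrow> I \<subseteq> {2..<n} \<Longrightarrow> T \<in> A \<Longrightarrow> reachable \<phi> I S T"
  unfolding reachable_def using fold_rev by (metis order_trans set_rev)

lemma fold_comm: "set p \<subseteq> {2..<j - 2} \<Longrightarrow> j < n \<Longrightarrow> T \<in> A \<Longrightarrow> \<phi> j (fold \<phi> p T) = fold \<phi> p (\<phi> j T)"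
proof (induction p arbitrary: T)
  case (Cons i p)
  then have i: "2 \<le> i" "i + 3 \<le> j" "i < n" "set p \<subseteq> {2..<j - 2}" by auto
  show ?case
    using Cons.IH[OF i(4) Cons.prems(2) closed[OF i(1,3) Cons.prems(3)]] comm[OF i(1,2) Cons.prems(2,3)] by simp
qed simp

lemma finite_conn [simp]: "I \<subseteq> {2..<n} \<Longrightarrow> T \<in> A \<Longrightarrow> finite {U. reachable \<phi> I T U}"
  using reachable_in by (intro finite_subset[OF _ finA]) auto

section \<open>How a single involution acts on the descent bits\<close>

lemma profile:
  assumes "3 \<le> m" "m \<le> 6" "k + m \<le> n" "T \<in> A"
  shows "\<exists>u. yamanouchi u \<and> length u = m \<and>
    image_mset (\<lambda>U. map (\<lambda>j. j + k \<in> Des U) [1..<m]) (mset_set {U. reachable \<phi> {k + 2..<k + m} T U}) = mset (profile_of m u)"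
proof -
  obtain M where M: "is_shape M" "size M = m"
    "\<And>E. card {U. reachable \<phi> {k + 2..<k + m} T U \<and> window_des Des k m U = E} = card {w \<in> yam_words M. descents w = E}"
    using loc[OF assms] by blast
  obtain u where u: "yamanouchi u" "mset u = M" using ex_yam[OF M(1)] by blast
  then have l: "length u = m" using M(2) by auto
  let ?X = "{U. reachable \<phi> {k + 2..<k + m} T U}"
  have fin: "finite ?X" by (rule finite_conn) (use assms in auto)
  have "image_mset (window_des Des k m) (mset_set ?X) = image_mset descents (mset_set (yam_words M))"
  proof (rule multiset_eqI)
    fix E
    have "window_des Des k m -` {E} \<inter> ?X = {U. reachable \<phi> {k + 2..<k + m} T U \<and> window_des Des k m U = E}" by auto
    moreover have "descents -` {E} \<inter> yam_words M = {w \<in> yam_words M. descents w = E}" by auto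
    ultimately show "count (image_mset (window_des Des k m) (mset_set ?X)) E = count (image_mset descents (mset_set (yam_words M))) E"
      using M(3)[of E] fin by (simp add: count_image_mset)
  qed
  then have "image_mset (\<lambda>E. map (\<lambda>j. j \<in> E) [1..<m]) (image_mset (window_des Des k m) (mset_set ?X))
      = image_mset (\<lambda>E. map (\<lambda>j. j \<in> E) [1..<m]) (image_mset descents (mset_set (yam_words M)))" by simp
  moreover have "map (\<lambda>j. j \<in> window_des Des k m U) [1..<m] = map (\<lambda>j. j + k \<in> Des U) [1..<m]" for U
    by (auto simp: window_des_def)
  ultimately have "image_mset (\<lambda>U. map (\<lambda>j. j + k \<in> Des U) [1..<m]) (mset_set ?X) = mset (profile_of m u)"
    unfolding profile_of_eq[OF u(1) l] u(2) by (simp add: multiset.map_comp comp_def del: map_eq_conv)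
  then show ?thesis using u l by blast
qed

lemma profile_distinct:
  assumes "3 \<le> m" "m \<le> 6" "k + m \<le> n" "T \<in> A" "profile_of m ` set (yam_list m) \<subseteq> P" "\<And>L. L \<in> P \<Longrightarrow> distinct L"
  shows "\<exists>L\<in>P. inj_on (\<lambda>U. map (\<lambda>j. j + k \<in> Des U) [1..<m]) {U. reachable \<phi> {k + 2..<k + m} T U}
    \<and> (\<lambda>U. map (\<lambda>j. j + k \<in> Des U) [1..<m]) ` {U. reachable \<phi> {k + 2..<k + m} T U} = set L
    \<and> card {U. reachable \<phi> {k + 2..<k + m} T U} = length L"
proof -
  obtain u where u: "yamanouchi u" "length u = m"
    "image_mset (\<lambda>U. map (\<lambda>j. j + k \<in> Des U) [1..<m]) (mset_set {U. reachable \<phi> {k + 2..<k + m} T U}) = mset (profile_of m u)"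
    using profile[OF assms(1-4)] by blast
  have "profile_of m u \<in> P" using assms(5) u by (auto simp: set_ylist)
  moreover have "finite {U. reachable \<phi> {k + 2..<k + m} T U}" by (rule finite_conn) (use assms in auto)
  ultimately show ?thesis using inj_on_distinct[OF _ u(3)] assms(6) by blast
qed

lemma upt_small: "[1..<3] = [1, 2::nat]" "[1..<4] = [1, 2, 3::nat]" "[1..<5] = [1, 2, 3, 4::nat]"
  by code_simp+

text \<open>A class of one involution is a singleton (shapes 3 and 111) or a pair (shape 21) whose
  two bit patterns are each other's reverse.\<close>

lemma phi_bits:
  assumes "2 \<le> i" "i < n" "T \<in> A"
  shows "(i - 1 \<in> Des T \<longleftrightarrow> i \<in> Des T) \<Longrightarrow> \<phi> i T = T"
    and "(i - 1 \<in> Des T) \<noteq> (i \<in> Des T) \<Longrightarrow>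
      (i - 1 \<in> Des (\<phi> i T) \<longleftrightarrow> i \<in> Des T) \<and> (i \<in> Des (\<phi> i T) \<longleftrightarrow> i - 1 \<in> Des T)"
proof -
  define k where "k = i - 2"
  have i: "i = k + 2" using assms k_def by simp
  let ?X = "{U. reachable \<phi> {k + 2..<k + 3} T U}"
  obtain L where L: "L \<in> {[[False, False]], [[False, True], [True, False]], [[True, True]]}"
    "inj_on (\<lambda>U. map (\<lambda>j. j + k \<in> Des U) [1..<3]) ?X"
    "(\<lambda>U. map (\<lambda>j. j + k \<in> Des U) [1..<3]) ` ?X = set L" "card ?X = length L"
    using profile_distinct[OF _ _ _ assms(3) profiles3, of k] assms i by fastforce
  have X: "T \<in> ?X" "\<phi> i T \<in> ?X" using reachable_step[of i "{k + 2..<k + 3}"] i by auto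
  have e: "map (\<lambda>j. j + k \<in> Des U) [1..<3] = [i - 1 \<in> Des U, i \<in> Des U]" for U
  proof -
    have "1 + k = i - 1" "2 + k = i" using i by auto
    then show ?thesis unfolding upt_small list.map by (simp only:)
  qed
  have m: "[i - 1 \<in> Des U, i \<in> Des U] \<in> set L" if "U \<in> ?X" for U
    using that L(3) unfolding e by blast
  have inj: "T = \<phi> i T" if "[i - 1 \<in> Des T, i \<in> Des T] = [i - 1 \<in> Des (\<phi> i T), i \<in> Des (\<phi> i T)]"
    using inj_onD[OF L(2)[unfolded e] that X] .
  show "(i - 1 \<in> Des T \<longleftrightarrow> i \<in> Des T) \<Longrightarrow> \<phi> i T = T"
    using m[OF X(1)] m[OF X(2)] L(1) inj by auto
  show "(i - 1 \<in> Des T) \<noteq> (i \<in> Des T) \<Longrightarrow>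
      (i - 1 \<in> Des (\<phi> i T) \<longleftrightarrow> i \<in> Des T) \<and> (i \<in> Des (\<phi> i T) \<longleftrightarrow> i - 1 \<in> Des T)"
  proof -
    assume d: "(i - 1 \<in> Des T) \<noteq> (i \<in> Des T)"
    then have L2: "L = [[False, True], [True, False]]" using m[OF X(1)] L(1) by auto
    have "\<phi> i T \<noteq> T"
    proof
      assume f: "\<phi> i T = T"
      have "fold \<phi> p T = T" if "set p \<subseteq> {k + 2..<k + 3}" for p
      proof -
        have "set p \<subseteq> {i}" using that i by auto
        then show ?thesis using f by (induction p) auto
      qed
      then have "?X = {T}" unfolding reachable_def by (auto intro: exI[of _ "[]"])
      then show False using L(4) L2 by simp
    qed
    then have "[i - 1 \<in> Des T, i \<in> Des T] \<noteq> [i - 1 \<in> Des (\<phi> i T), i \<in> Des (\<phi> i T)]" using inj by metis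
    then show ?thesis using m[OF X(1)] m[OF X(2)] L2 d by auto
  qed
qed

text \<open>The change of the third bit produces two patterns that occur together only for shape 22.
  That class has just two elements, and both involutions exchange them.\<close>

lemma phi_pair:
  assumes "2 \<le> i" "i + 1 < n" "T \<in> A"
  shows "(i + 1 \<in> Des (\<phi> i T)) \<noteq> (i + 1 \<in> Des T) \<Longrightarrow> \<phi> i T = \<phi> (i + 1) T"
    and "(i - 1 \<in> Des (\<phi> (i + 1) T)) \<noteq> (i - 1 \<in> Des T) \<Longrightarrow> \<phi> i T = \<phi> (i + 1) T"
proof -
  define k where "k = i - 2"
  have i: "i = k + 2" using assms k_def by simp
  let ?X = "{U. reachable \<phi> {k + 2..<k + 4} T U}"
  obtain L where L: "L \<in> {[[False, False, False]], [[False, False, True], [False, True, False], [True, False, False]],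
      [[False, True, False], [True, False, True]], [[False, True, True], [True, False, True], [True, True, False]],
      [[True, True, True]]}"
    "inj_on (\<lambda>U. map (\<lambda>j. j + k \<in> Des U) [1..<4]) ?X"
    "(\<lambda>U. map (\<lambda>j. j + k \<in> Des U) [1..<4]) ` ?X = set L" "card ?X = length L"
  proof -
    have "\<exists>L\<in>{[[False, False, False]], [[False, False, True], [False, True, False], [True, False, False]],
      [[False, True, False], [True, False, True]], [[False, True, True], [True, False, True], [True, True, False]],
      [[True, True, True]]}. inj_on (\<lambda>U. map (\<lambda>j. j + k \<in> Des U) [1..<4]) ?X
    \<and> (\<lambda>U. map (\<lambda>j. j + k \<in> Des U) [1..<4]) ` ?X = set L \<and> card ?X = length L"
      by (rule profile_distinct[OF _ _ _ assms(3) order_trans[OF profiles4]]) (use assms i in auto)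
    then show thesis using that by blast
  qed
  have X: "T \<in> ?X" "\<phi> i T \<in> ?X" "\<phi> (i + 1) T \<in> ?X"
    using reachable_step[of i "{k + 2..<k + 4}"] reachable_step[of "i + 1" "{k + 2..<k + 4}"] i by auto
  have e: "map (\<lambda>j. j + k \<in> Des U) [1..<4] = [i - 1 \<in> Des U, i \<in> Des U, i + 1 \<in> Des U]" for U
  proof -
    have "1 + k = i - 1" "2 + k = i" "3 + k = i + 1" using i by auto
    then show ?thesis unfolding upt_small list.map by (simp only:)
  qed
  have m: "[i - 1 \<in> Des U, i \<in> Des U, i + 1 \<in> Des U] \<in> set L" if "U \<in> ?X" for U
    using that L(3) unfolding e by blast
  have inj: "\<phi> i T = \<phi> (i + 1) T" if "[i - 1 \<in> Des (\<phi> i T), i \<in> Des (\<phi> i T), i + 1 \<in> Des (\<phi> i T)]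
      = [i - 1 \<in> Des (\<phi> (i + 1) T), i \<in> Des (\<phi> (i + 1) T), i + 1 \<in> Des (\<phi> (i + 1) T)]"
    using inj_onD[OF L(2)[unfolded e] that X(2,3)] .
  have i1: "i < n" "2 \<le> i + 1" using assms(1,2) by auto
  have 1: "i + 1 - 1 = i" by simp
  note f = phi_bits[OF assms(1) i1(1) assms(3)] and g = phi_bits[OF i1(2) assms(2,3), unfolded 1]
  have L2: "L = [[False, True, False], [True, False, True]]"
    if "[x, \<not> x, y] \<in> set L" "[\<not> x, x, \<not> y] \<in> set L" for x y
    using that L(1) by (elim insertE emptyE; cases x; cases y; simp)
  show "\<phi> i T = \<phi> (i + 1) T" if d: "(i + 1 \<in> Des (\<phi> i T)) \<noteq> (i + 1 \<in> Des T)"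
  proof -
    have x: "i \<in> Des T \<longleftrightarrow> i - 1 \<notin> Des T" using f(1) d by metis
    then have fx: "i - 1 \<in> Des (\<phi> i T) \<longleftrightarrow> i - 1 \<notin> Des T" "i \<in> Des (\<phi> i T) \<longleftrightarrow> i - 1 \<in> Des T"
      using f(2) by blast+
    have dd: "i + 1 \<in> Des (\<phi> i T) \<longleftrightarrow> i + 1 \<notin> Des T" using d by blast
    have L3: "L = [[False, True, False], [True, False, True]]"
      using L2 m[OF X(1), unfolded x] m[OF X(2), unfolded fx dd] by blast
    have y: "i + 1 \<in> Des T \<longleftrightarrow> i - 1 \<in> Des T" using m[OF X(1), unfolded x] L3 by auto
    then have gx: "i \<in> Des (\<phi> (i + 1) T) \<longleftrightarrow> i - 1 \<in> Des T" "i + 1 \<in> Des (\<phi> (i + 1) T) \<longleftrightarrow> i - 1 \<notin> Des T"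
      using g(2) x by blast+
    have "i - 1 \<in> Des (\<phi> (i + 1) T) \<longleftrightarrow> i - 1 \<notin> Des T" using m[OF X(3), unfolded gx] L3 by auto
    then show ?thesis using fx gx dd y by (intro inj) simp
  qed
  show "\<phi> i T = \<phi> (i + 1) T" if d: "(i - 1 \<in> Des (\<phi> (i + 1) T)) \<noteq> (i - 1 \<in> Des T)"
  proof -
    have x: "i + 1 \<in> Des T \<longleftrightarrow> i \<notin> Des T" using g(1) d by metis
    then have gx: "i + 1 \<in> Des (\<phi> (i + 1) T) \<longleftrightarrow> i \<in> Des T" "i \<in> Des (\<phi> (i + 1) T) \<longleftrightarrow> i \<notin> Des T"
      using g(2) by blast+
    have dd: "i - 1 \<in> Des (\<phi> (i + 1) T) \<longleftrightarrow> i - 1 \<notin> Des T" using d by blast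
    have L3: "L = [[False, True, False], [True, False, True]]"
      using m[OF X(1), unfolded x] m[OF X(3), unfolded gx dd] L(1)
      by (elim insertE emptyE; cases "i \<in> Des T"; cases "i - 1 \<in> Des T"; simp)
    have y: "i - 1 \<in> Des T \<longleftrightarrow> i \<notin> Des T" using m[OF X(1), unfolded x] L3 by auto
    then have fx: "i - 1 \<in> Des (\<phi> i T) \<longleftrightarrow> i \<in> Des T" "i \<in> Des (\<phi> i T) \<longleftrightarrow> i \<notin> Des T"
      using f(2) by blast+
    have "i + 1 \<in> Des (\<phi> i T) \<longleftrightarrow> i \<in> Des T" using m[OF X(2), unfolded fx] L3 by auto
    then show ?thesis using fx gx dd y by (intro inj) simp
  qed
qed

lemma window5_i:
  assumes "2 \<le> i" "i + 2 < n" "T \<in> A"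
  shows "\<exists>X S. T \<in> X \<and> window5 X (\<phi> i) (\<phi> (i + 1)) (\<phi> (i + 2))
    (\<lambda>U. [i - 1 \<in> Des U, i \<in> Des U, i + 1 \<in> Des U, i + 2 \<in> Des U])
    (\<lambda>U. i - 1 \<in> Des U) (\<lambda>U. i \<in> Des U) (\<lambda>U. i + 1 \<in> Des U) (\<lambda>U. i + 2 \<in> Des U) S"
proof -
  define k where "k = i - 2"
  have i: "i = k + 2" using assms k_def by simp
  have I: "{k + 2..<k + 5} = {i, i + 1, i + 2}" using i by auto
  let ?X = "{U. reachable \<phi> {k + 2..<k + 5} T U}"
  let ?P = "profiles_5"
  have "\<exists>L\<in>?P. inj_on (\<lambda>U. map (\<lambda>j. j + k \<in> Des U) [1..<5]) ?X
    \<and> (\<lambda>U. map (\<lambda>j. j + k \<in> Des U) [1..<5]) ` ?X = set L \<and> card ?X = length L"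
    by (rule profile_distinct[OF _ _ _ assms(3) profiles5 bspec[OF profiles5_distinct]]) (use assms(1,2) i in simp_all)
  then obtain L where L: "L \<in> ?P" "inj_on (\<lambda>U. map (\<lambda>j. j + k \<in> Des U) [1..<5]) ?X"
    "(\<lambda>U. map (\<lambda>j. j + k \<in> Des U) [1..<5]) ` ?X = set L" by (elim bexE conjE)
  have e: "map (\<lambda>j. j + k \<in> Des U) [1..<5] = [i - 1 \<in> Des U, i \<in> Des U, i + 1 \<in> Des U, i + 2 \<in> Des U]" for U
  proof -
    have "1 + k = i - 1" "2 + k = i" "3 + k = i + 1" "4 + k = i + 2" using i by auto
    then show ?thesis unfolding upt_small list.map by (simp only:)
  qed
  have sub: "{k + 2..<k + 5} \<subseteq> {2..<n}" using assms i by auto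
  have XA: "U \<in> A" if "U \<in> ?X" for U using reachable_in[OF _ sub assms(3)] that by blast
  have cl: "\<phi> j U \<in> ?X" if "U \<in> ?X" "j \<in> {i, i + 1, i + 2}" for U j
  proof -
    have "reachable \<phi> {i, i + 1, i + 2} T U" using that(1) unfolding I by simp
    then have "reachable \<phi> {i, i + 1, i + 2} T (\<phi> j U)" using reachable_step[OF that(2)] by (rule reachable_trans)
    then show ?thesis unfolding I by simp
  qed
  have "window5 ?X (\<phi> i) (\<phi> (i + 1)) (\<phi> (i + 2))
    (\<lambda>U. [i - 1 \<in> Des U, i \<in> Des U, i + 1 \<in> Des U, i + 2 \<in> Des U])
    (\<lambda>U. i - 1 \<in> Des U) (\<lambda>U. i \<in> Des U) (\<lambda>U. i + 1 \<in> Des U) (\<lambda>U. i + 2 \<in> Des U) (set L)"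
  proof
    show "Y = ?X" if Y: "Y \<subseteq> ?X" "Y \<noteq> {}" "\<And>U. U \<in> Y \<Longrightarrow> \<phi> i U \<in> Y \<and> \<phi> (i + 1) U \<in> Y \<and> \<phi> (i + 2) U \<in> Y" for Y
    proof
      show "?X \<subseteq> Y"
      proof
        fix U assume U: "U \<in> ?X"
        obtain V where V: "V \<in> Y" using Y(2) by blast
        have "V \<in> ?X" using V Y(1) by (rule rev_subsetD)
        then have "reachable \<phi> {k + 2..<k + 5} V T" using reachable_sym[OF _ sub assms(3)] by simp
        moreover have "reachable \<phi> {k + 2..<k + 5} T U" using U by simp
        ultimately have "reachable \<phi> {k + 2..<k + 5} V U" by (rule reachable_trans)
        then obtain p where p: "set p \<subseteq> {i, i + 1, i + 2}" "fold \<phi> p V = U" unfolding reachable_def I by (elim exE conjE)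
        have "fold \<phi> p W \<in> Y" if "W \<in> Y" for W
          using p(1) that
        proof (induction p arbitrary: W)
          case (Cons j p)
          have "j = i \<or> j = i + 1 \<or> j = i + 2" using Cons.prems(1) by simp
          then have "\<phi> j W \<in> Y" using Y(3)[OF Cons.prems(2)] by (elim disjE) simp_all
          then show ?case using Cons.IH[of "\<phi> j W"] Cons.prems(1) by simp
        qed simp
        then show "U \<in> Y" using p(2) V by metis
      qed
    qed (rule Y(1))
    show "inj_on (\<lambda>U. [i - 1 \<in> Des U, i \<in> Des U, i + 1 \<in> Des U, i + 2 \<in> Des U]) ?X" using L(2) unfolding e .
    show "(\<lambda>U. [i - 1 \<in> Des U, i \<in> Des U, i + 1 \<in> Des U, i + 2 \<in> Des U]) ` ?X = set L" using L(3) unfolding e .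
    show "set L \<in> set ` ?P" using L(1) by (rule imageI)
    show "\<phi> i U \<in> ?X" "\<phi> (i + 1) U \<in> ?X" "\<phi> (i + 2) U \<in> ?X" if "U \<in> ?X" for U by (rule cl[OF that], simp)+
  next
    fix U assume "U \<in> ?X"
    then have U: "U \<in> A" using XA by blast
    have 1: "i + 1 - 1 = i" "i + 2 - 1 = i + 1" and 2: "i + 1 + 1 = i + 2" by simp_all
    have b: "i < n" "i + 1 < n" "2 \<le> i + 1" "2 \<le> i + 2" "i + 1 + 1 < n" using assms by auto
    show "\<phi> i (\<phi> i U) = U" by (rule invol[OF assms(1) b(1) U])
    show "\<phi> (i + 1) (\<phi> (i + 1) U) = U" by (rule invol[OF b(3,2) U])
    show "\<phi> (i + 2) (\<phi> (i + 2) U) = U" by (rule invol[OF b(4) assms(2) U])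
    show "(i - 1 \<in> Des U) = (i \<in> Des U) \<Longrightarrow> \<phi> i U = U" by (rule phi_bits(1)[OF assms(1) b(1) U])
    show "(i - 1 \<in> Des U) \<noteq> (i \<in> Des U) \<Longrightarrow> (i - 1 \<in> Des (\<phi> i U)) = (i \<in> Des U) \<and> (i \<in> Des (\<phi> i U)) = (i - 1 \<in> Des U)"
      by (rule phi_bits(2)[OF assms(1) b(1) U])
    show "(i \<in> Des U) = (i + 1 \<in> Des U) \<Longrightarrow> \<phi> (i + 1) U = U" by (rule phi_bits(1)[OF b(3,2) U, unfolded 1])
    show "(i \<in> Des U) \<noteq> (i + 1 \<in> Des U) \<Longrightarrow> (i \<in> Des (\<phi> (i + 1) U)) = (i + 1 \<in> Des U) \<and> (i + 1 \<in> Des (\<phi> (i + 1) U)) = (i \<in> Des U)"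
      by (rule phi_bits(2)[OF b(3,2) U, unfolded 1])
    show "(i + 1 \<in> Des U) = (i + 2 \<in> Des U) \<Longrightarrow> \<phi> (i + 2) U = U" by (rule phi_bits(1)[OF b(4) assms(2) U, unfolded 1])
    show "(i + 1 \<in> Des U) \<noteq> (i + 2 \<in> Des U) \<Longrightarrow> (i + 1 \<in> Des (\<phi> (i + 2) U)) = (i + 2 \<in> Des U) \<and> (i + 2 \<in> Des (\<phi> (i + 2) U)) = (i + 1 \<in> Des U)"
      by (rule phi_bits(2)[OF b(4) assms(2) U, unfolded 1])
    show "(i + 1 \<in> Des (\<phi> i U)) \<noteq> (i + 1 \<in> Des U) \<Longrightarrow> \<phi> i U = \<phi> (i + 1) U"
      by (rule phi_pair(1)[OF assms(1) b(2) U])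
    show "(i - 1 \<in> Des (\<phi> (i + 1) U)) \<noteq> (i - 1 \<in> Des U) \<Longrightarrow> \<phi> i U = \<phi> (i + 1) U"
      by (rule phi_pair(2)[OF assms(1) b(2) U])
    show "(i + 2 \<in> Des (\<phi> (i + 1) U)) \<noteq> (i + 2 \<in> Des U) \<Longrightarrow> \<phi> (i + 1) U = \<phi> (i + 2) U"
      by (rule phi_pair(1)[OF b(3,5) U, unfolded 2])
    show "(i \<in> Des (\<phi> (i + 2) U)) \<noteq> (i \<in> Des U) \<Longrightarrow> \<phi> (i + 1) U = \<phi> (i + 2) U"
      by (rule phi_pair(2)[OF b(3,5) U, unfolded 1 2])
  qed (rule refl)
  moreover have "T \<in> ?X" by simp
  ultimately show ?thesis by (intro exI conjI)
qed

lemma phi_next: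
  assumes "2 \<le> i" "i + 2 < n" "T \<in> A"
  shows "i + 2 \<in> Des (\<phi> i T) \<longleftrightarrow> i + 2 \<in> Des T"
    and "i - 1 \<in> Des (\<phi> (i + 2) T) \<longleftrightarrow> i - 1 \<in> Des T"
    and "i - 1 \<in> Des T \<Longrightarrow> i \<notin> Des T \<Longrightarrow> i + 1 \<notin> Des T \<Longrightarrow> i + 2 \<in> Des T \<Longrightarrow>
      i + 2 \<in> Des (\<phi> (i + 1) (\<phi> i T)) \<longleftrightarrow> i - 1 \<in> Des (\<phi> (i + 1) (\<phi> (i + 2) T))"
    and "i - 1 \<notin> Des T \<Longrightarrow> i \<in> Des T \<Longrightarrow> i + 1 \<notin> Des T \<Longrightarrow> i + 2 \<in> Des T \<Longrightarrow> i \<in> Des (\<phi> (i + 2) T) \<Longrightarrow>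
      i - 1 \<in> Des (\<phi> (i + 1) T) \<longleftrightarrow> i + 2 \<in> Des (\<phi> (i + 1) (\<phi> i (\<phi> (i + 2) T)))"
proof -
  obtain X S where T: "T \<in> X" and w: "window5 X (\<phi> i) (\<phi> (i + 1)) (\<phi> (i + 2))
    (\<lambda>U. [i - 1 \<in> Des U, i \<in> Des U, i + 1 \<in> Des U, i + 2 \<in> Des U])
    (\<lambda>U. i - 1 \<in> Des U) (\<lambda>U. i \<in> Des U) (\<lambda>U. i + 1 \<in> Des U) (\<lambda>U. i + 2 \<in> Des U) S"
    using window5_i[OF assms] by (elim exE conjE)
  show "i + 2 \<in> Des (\<phi> i T) \<longleftrightarrow> i + 2 \<in> Des T" by (rule window5.f_4[OF w T])
  show "i - 1 \<in> Des (\<phi> (i + 2) T) \<longleftrightarrow> i - 1 \<in> Des T" by (rule window5.h_1[OF w T])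
  show "i - 1 \<in> Des T \<Longrightarrow> i \<notin> Des T \<Longrightarrow> i + 1 \<notin> Des T \<Longrightarrow> i + 2 \<in> Des T \<Longrightarrow>
      i + 2 \<in> Des (\<phi> (i + 1) (\<phi> i T)) \<longleftrightarrow> i - 1 \<in> Des (\<phi> (i + 1) (\<phi> (i + 2) T))"
    by (rule window5.F1[OF w T])
  show "i - 1 \<notin> Des T \<Longrightarrow> i \<in> Des T \<Longrightarrow> i + 1 \<notin> Des T \<Longrightarrow> i + 2 \<in> Des T \<Longrightarrow> i \<in> Des (\<phi> (i + 2) T) \<Longrightarrow>
      i - 1 \<in> Des (\<phi> (i + 1) T) \<longleftrightarrow> i + 2 \<in> Des (\<phi> (i + 1) (\<phi> i (\<phi> (i + 2) T)))"
    by (rule window5.F2[OF w T])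
qed

text \<open>For \<open>j \<ge> i + 3\<close> the involutions \<open>\<phi> i\<close> and
  \<open>\<phi> j\<close> commute, so \<open>\<phi> j\<close> fixes \<open>T\<close> iff it fixes
  \<open>\<phi> i T\<close>. Being fixed by \<open>\<phi> j\<close> means that the bits
  \<open>j - 1\<close> and \<open>j\<close> agree; invariance therefore propagates from bit
  \<open>j - 1\<close> to bit \<open>j\<close>, beginning with \<open>phi_next\<close>.\<close>

lemma phi_far_right:
  assumes "2 \<le> i" "i + 2 + d < n" "T \<in> A"
  shows "i + 2 + d \<in> Des (\<phi> i T) \<longleftrightarrow> i + 2 + d \<in> Des T"
  using assms(2)
proof (induction d)
  case 0
  then show ?case using phi_next(1)[OF assms(1) _ assms(3)] by simp
next
  case (Suc d)
  let ?j = "i + 2 + Suc d"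
  have j: "?j < n" "2 \<le> ?j" "i + 3 \<le> ?j" "?j - 1 = i + 2 + d" using Suc.prems by auto
  have iA: "\<phi> i T \<in> A" using closed assms Suc.prems by simp
  have c: "\<phi> i (\<phi> ?j T) = \<phi> ?j (\<phi> i T)" using comm[OF assms(1) j(3,1) assms(3)] .
  have fx: "\<phi> ?j U = U \<longleftrightarrow> (?j - 1 \<in> Des U \<longleftrightarrow> ?j \<in> Des U)" if "U \<in> A" for U
    using phi_bits[OF j(2,1) that] by metis
  have "\<phi> ?j T = T \<longleftrightarrow> \<phi> ?j (\<phi> i T) = \<phi> i T"
    using c invol[OF assms(1) _ assms(3)] invol[OF assms(1) _ closed[OF j(2,1) assms(3)]] Suc.prems by (metis add.assoc add_lessD1)
  then have "(?j - 1 \<in> Des T \<longleftrightarrow> ?j \<in> Des T) \<longleftrightarrow> (?j - 1 \<in> Des (\<phi> i T) \<longleftrightarrow> ?j \<in> Des (\<phi> i T))"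
    unfolding fx[OF assms(3)] fx[OF iA] .
  moreover have "?j - 1 \<in> Des (\<phi> i T) \<longleftrightarrow> ?j - 1 \<in> Des T" using Suc.IH Suc.prems unfolding j(4) by simp
  ultimately show ?case by blast
qed

lemma phi_far_left:
  assumes "i < n" "d + 4 \<le> i" "T \<in> A"
  shows "i - 3 - d \<in> Des (\<phi> i T) \<longleftrightarrow> i - 3 - d \<in> Des T"
  using assms(2)
proof (induction d)
  case 0
  have "i - 2 + 2 = i" "i - 2 - 1 = i - 3" using 0 by auto
  then show ?case using phi_next(2)[of "i - 2" T] 0 assms(1,3) by simp
next
  case (Suc d)
  let ?j = "i - 3 - d"
  have j: "?j < n" "2 \<le> ?j" "?j + 3 \<le> i" "?j - 1 = i - 3 - Suc d" using Suc.prems assms(1) by auto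
  have i2: "2 \<le> i" using Suc.prems by simp
  have iA: "\<phi> i T \<in> A" using closed[OF i2 assms(1,3)] .
  have c: "\<phi> ?j (\<phi> i T) = \<phi> i (\<phi> ?j T)" using comm[OF j(2,3) assms(1,3)] .
  have fx: "\<phi> ?j U = U \<longleftrightarrow> (?j - 1 \<in> Des U \<longleftrightarrow> ?j \<in> Des U)" if "U \<in> A" for U
    using phi_bits[OF j(2,1) that] by metis
  have "\<phi> ?j T = T \<longleftrightarrow> \<phi> ?j (\<phi> i T) = \<phi> i T"
    using c invol[OF i2 assms(1,3)] invol[OF i2 assms(1) closed[OF j(2,1) assms(3)]] by metis
  then have "(?j - 1 \<in> Des T \<longleftrightarrow> ?j \<in> Des T) \<longleftrightarrow> (?j - 1 \<in> Des (\<phi> i T) \<longleftrightarrow> ?j \<in> Des (\<phi> i T))"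
    unfolding fx[OF assms(3)] fx[OF iA] .
  moreover have "?j \<in> Des (\<phi> i T) \<longleftrightarrow> ?j \<in> Des T" using Suc.IH Suc.prems by simp
  ultimately show ?case unfolding j(4)[symmetric] by blast
qed

lemma phi_far:
  assumes "2 \<le> i" "i < n" "0 < j" "j < n" "j + 3 \<le> i \<or> i + 2 \<le> j" "T \<in> A"
  shows "j \<in> Des (\<phi> i T) \<longleftrightarrow> j \<in> Des T"
proof (cases "i + 2 \<le> j")
  case True
  then obtain d where "j = i + 2 + d" using le_Suc_ex by blast
  then show ?thesis using phi_far_right[of i d T] assms by simp
next
  case False
  then show ?thesis using phi_far_left[of i "i - 3 - j" T] assms by simp
qed

end

section \<open>The last involution acts by Knuth moves\<close>

text \<open>If rows \<open>x < y\<close> are both addable, row \<open>y - 1\<close> is a corner that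
  separates them. This turns comparisons with corners, which descents can detect, into equality of
  letters.\<close>

lemma addable_unique:
  assumes "is_shape M" "is_shape (add_mset a M)" "is_shape (add_mset a' M)"
    and "\<And>s. count M (Suc s) < count M s \<Longrightarrow> s < a \<longleftrightarrow> s < a'"
  shows "a = a'"
proof (rule ccontr)
  have *: False if "x < y" "is_shape (add_mset y M)"
    "\<And>s. count M (Suc s) < count M s \<Longrightarrow> s < x \<longleftrightarrow> s < y" for x y
  proof -
    have "count M (Suc (y - 1)) < count M (y - 1)" using that(1,2) is_shape_add_iff[OF assms(1), of y] by auto
    then show False using that(1) that(3)[of "y - 1"] by auto
  qed
  assume "a \<noteq> a'"
  then show False using *[of a a'] *[of a' a] assms(2-4) by (metis nat_neq_iff)
qed

lemma ex_yam_snoc2: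
  assumes "is_shape M" "count M (Suc s) < count M s" "count (M - {#s#}) (Suc t) < count (M - {#s#}) t"
  shows "\<exists>v. yamanouchi (v @ [t, s]) \<and> mset (v @ [t, s]) = M"
proof -
  obtain w where w: "yamanouchi (w @ [s])" "mset (w @ [s]) = M" using ex_yam_snoc[OF assms(1,2)] by blast
  have m: "M - {#s#} = mset w" using w(2)[symmetric] by simp
  have "is_shape (M - {#s#})" unfolding m using w(1) yamanouchi_dec yamanouchi_appendD by blast
  then obtain v where v: "yamanouchi (v @ [t])" "mset (v @ [t]) = mset w"
    using ex_yam_snoc[OF _ assms(3)] m by auto
  have "yamanouchi ((v @ [t]) @ [s])" using v w yamanouchi_snoc[of "v @ [t]" s] yamanouchi_snoc[of w s] by metis
  moreover have "mset ((v @ [t]) @ [s]) = M"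
  proof -
    have "mset ((v @ [t]) @ [s]) = add_mset s (mset (v @ [t]))" by simp
    also have "\<dots> = M" unfolding v(2) using w(2) by simp
    finally show ?thesis .
  qed
  ultimately show ?thesis by (intro exI[of _ v]) simp
qed

text \<open>\<open>G\<close> is the candidate for the word model in size \<open>q + 1\<close>; what
  remains open is how the last involution \<open>\<phi> q\<close> acts on the words.\<close>

locale lift = dual "Suc q" A Des \<phi> for q A Des \<phi> +
  fixes G :: "'a \<Rightarrow> nat list"
  assumes q2: "2 \<le> q"
    and Gyam: "T \<in> A \<Longrightarrow> yamanouchi (G T)"
    and Glen: "T \<in> A \<Longrightarrow> length (G T) = Suc q"
    and Gds: "T \<in> A \<Longrightarrow> 0 < j \<Longrightarrow> j \<le> q \<Longrightarrow> j \<in> descents (G T) \<longleftrightarrow> j \<in> Des T"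
    and Geq: "2 \<le> i \<Longrightarrow> i < q \<Longrightarrow> T \<in> A \<Longrightarrow> G (\<phi> i T) = knuth i (G T)"
begin

lemma q_in: "T \<in> A \<Longrightarrow> \<phi> q T \<in> A" and q_q: "T \<in> A \<Longrightarrow> \<phi> q (\<phi> q T) = T"
  using closed[of q T] invol[of q T] q2 by auto

lemma low_in: "set p \<subseteq> {2..<q} \<Longrightarrow> T \<in> A \<Longrightarrow> fold \<phi> p T \<in> A"
  by (rule fold_in) auto

lemma G_fold: "set p \<subseteq> {2..<q} \<Longrightarrow> T \<in> A \<Longrightarrow> G (fold \<phi> p T) = fold knuth p (G T)"
proof (induction p arbitrary: T)
  case (Cons i p)
  then show ?case using Geq[of i T] closed[of i T] by simp
qed simp

lemma G_fold_app:
  assumes "T \<in> A" "G T = w @ z" "length w \<le> q" "set p \<subseteq> {2..<length w}"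
  shows "G (fold \<phi> p T) = fold knuth p w @ z"
proof -
  have "set p \<subseteq> {2..<q}" using assms(3,4) by fastforce
  then show ?thesis using G_fold[of p T] assms foldK_append[of p w z] by simp
qed

lemma reach:
  assumes "T \<in> A" "G T = w @ z" "length w \<le> q" "yamanouchi w'" "mset w' = mset w"
  obtains p where "set p \<subseteq> {2..<length w}" "fold knuth p w = w'" "G (fold \<phi> p T) = w' @ z"
    "fold \<phi> p T \<in> A" "fold \<phi> (rev p) (fold \<phi> p T) = T"
proof -
  have "yamanouchi w" using Gyam[OF assms(1)] assms(2) yamanouchi_appendD by metis
  then obtain p where p: "set p \<subseteq> {2..<length w}" "fold knuth p w = w'"
    using yamanouchi_connected[of w w'] assms(4,5) by auto
  then have "set p \<subseteq> {2..<q}" "set p \<subseteq> {2..<Suc q}" using assms(3) by fastforce+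
  then show thesis using that[OF p] G_fold_app[OF assms(1-3) p(1)] p(2) low_in[OF _ assms(1)]
      fold_rev[OF _ assms(1)] by blast
qed

lemma bit: "T \<in> A \<Longrightarrow> G T = u @ x # y # v \<Longrightarrow> j = Suc (length u) \<Longrightarrow> j \<in> Des T \<longleftrightarrow> x < y"
  using Gds[of T j] descents_nth[of j u x y v] Glen[of T] by simp

text \<open>\<open>\<phi> q\<close> commutes with the involutions that act on the first
  \<open>q - 2\<close> entries and preserves the descents below \<open>q - 2\<close>. Both prefixes
  thus have the same descents along every path, and \<open>descents_paths_unique\<close>
  applies.\<close>

lemma q_prefix:
  assumes "T \<in> A"
  shows "take (q - 2) (G (\<phi> q T)) = take (q - 2) (G T)"
proof -
  let ?m = "q - 2"
  have key: "j \<in> descents (fold knuth p (take ?m (G U))) \<longleftrightarrow> j \<in> Des (fold \<phi> p U)"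
    if h: "U \<in> A" "set p \<subseteq> {2..<?m}" "0 < j" "j < ?m" for U p j
  proof -
    let ?u = "take ?m (G U)"
    have l: "length ?u = ?m" using Glen[OF h(1)] by simp
    have p: "set p \<subseteq> {2..<length ?u}" "set p \<subseteq> {2..<q}"
      using h(2) l order_trans[OF h(2), of "{2..<q}"] by auto
    have "G (fold \<phi> p U) = fold knuth p ?u @ drop ?m (G U)"
      by (rule G_fold_app[OF h(1)]) (use l p in auto)
    moreover have "length (fold knuth p ?u) = ?m" using foldK_props[OF p(1)] l by simp
    ultimately have "j \<in> descents (fold knuth p ?u) \<longleftrightarrow> j \<in> descents (G (fold \<phi> p U))" using descents_append h(4) by metis
    then show ?thesis using Gds[OF low_in[OF p(2) h(1)], of j] h by simp
  qed
  have far: "j \<in> Des (fold \<phi> p (\<phi> q T)) \<longleftrightarrow> j \<in> Des (fold \<phi> p T)"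
    if h: "set p \<subseteq> {2..<?m}" "0 < j" "j < ?m" for p j
  proof -
    have "set p \<subseteq> {2..<q}" by (rule order_trans[OF h(1)]) auto
    then have "fold \<phi> p T \<in> A" by (rule low_in[OF _ assms])
    moreover have "j + 3 \<le> q" "j < Suc q" using h(3) by auto
    ultimately show ?thesis using fold_comm[OF h(1) _ assms] phi_far[of q j "fold \<phi> p T"] h(2) q2 by simp
  qed
  show ?thesis
  proof (rule descents_paths_unique)
    show "yamanouchi (take ?m (G (\<phi> q T)))" "yamanouchi (take ?m (G T))"
      using yamanouchi_take Gyam assms q_in by blast+
    show l: "length (take ?m (G (\<phi> q T))) = ?m" "length (take ?m (G T)) = ?m"
      using Glen assms q_in by auto
    fix p assume p: "set p \<subseteq> {2..<?m}"
    have lt: "j < ?m" if "j \<in> descents (fold knuth p (take ?m (G U)))" "U \<in> A" for j U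
    proof -
      have "length (fold knuth p (take ?m (G U))) = ?m"
        using foldK_props[of p "take ?m (G U)"] p Glen[OF that(2)] by simp
      then show ?thesis using descents_lt[OF that(1)] by simp
    qed
    show "descents (fold knuth p (take ?m (G (\<phi> q T)))) = descents (fold knuth p (take ?m (G T)))"
    proof (intro set_eqI)
      fix j
      show "j \<in> descents (fold knuth p (take ?m (G (\<phi> q T)))) \<longleftrightarrow> j \<in> descents (fold knuth p (take ?m (G T)))"
      proof (cases "0 < j \<and> j < ?m")
        case True
        then show ?thesis using key[OF q_in[OF assms] p] key[OF assms p] far[OF p] by simp
      next
        case False
        then show ?thesis using lt[OF _ q_in[OF assms]] lt[OF _ assms] descents_lt by metis
      qed
    qed
  qed
qed

lemma split_last3:
  assumes "T \<in> A"
  obtains v a b c where "G T = v @ [a, b, c]" "length v = q - 2"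
proof -
  have l: "q < length (G T)" using Glen[OF assms] by simp
  show thesis
  proof (rule split3[OF q2 l])
    fix u a b c v assume u: "G T = u @ a # b # c # v" "length u = q - 2"
    have "length (G T) = length u + 3 + length v" using u(1) by simp
    then have "length v = 0" using u(2) Glen[OF assms] q2 by presburger
    then have "v = []" by (simp only: length_0_conv)
    then show thesis using that[of u a b c] u by simp
  qed
qed

lemma q_prefix_split:
  assumes "T \<in> A" "G T = v @ [a, b, c]"
  obtains a' b' c' where "G (\<phi> q T) = v @ [a', b', c']"
proof -
  obtain v' a' b' c' where w: "G (\<phi> q T) = v' @ [a', b', c']" "length v' = q - 2"
    using split_last3[OF q_in[OF assms(1)]] by metis
  have "length v = q - 2" using Glen[OF assms(1)] assms(2) by simp
  then have "v' = v" using q_prefix[OF assms(1)] w assms(2) by simp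
  then show thesis using w that by simp
qed

lemma len3: "T \<in> A \<Longrightarrow> G T = v @ [a, b, c] \<Longrightarrow> q = length v + 2"
  using Glen[of T] by simp

lemma bits3:
  assumes "T \<in> A" "G T = v @ [a, b, c]"
  shows "q \<in> Des T \<longleftrightarrow> b < c" "q - 1 \<in> Des T \<longleftrightarrow> a < b"
  using bit[OF assms(1), of "v @ [a]" b c "[]" q] bit[OF assms(1), of v a b "[c]" "q - 1"] assms(2) len3[OF assms] by auto

lemma bits4:
  assumes "T \<in> A" "G T = v @ [s, a, b, c]"
  shows "q - 2 \<in> Des T \<longleftrightarrow> s < a" "q = length v + 3"
  using bit[OF assms(1), of v s a "[b, c]" "q - 2"] assms(2) len3[OF assms(1), of "v @ [s]" a b c] by auto

lemma bits5:
  assumes "T \<in> A" "G T = v @ [t, s, a, b, c]"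
  shows "q - 3 \<in> Des T \<longleftrightarrow> t < s" "q = length v + 4"
  using bit[OF assms(1), of v t s "[a, b, c]" "q - 3"] assms(2) len3[OF assms(1), of "v @ [t, s]" a b c] by auto

text \<open>If the last entry lies between the two entries before it, some rearrangement of the smaller
  entries makes the last two involutions agree.\<close>

lemma case_A:
  assumes "T \<in> A" "G T = v @ [a, b, c]" "a < c \<and> c \<le> b \<or> b < c \<and> c \<le> a"
  shows "G (\<phi> q T) = v @ [b, a, c]" "reachable \<phi> {2..<q} T (\<phi> q T)"
proof -
  have y: "yamanouchi (v @ [a, b, c])" using Gyam[OF assms(1)] assms(2) by simp
  have lv: "q = length v + 2" using len3[OF assms(1,2)] .
  have y': "yamanouchi (v @ [b, a, c])"
    using yamanouchi_K[of q "v @ [a, b, c]"] y lv knuth_app'[of q v a b c "[]"] knuth3_between_last[OF assms(3)] by simp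
  have ab: "is_shape (mset v)" "is_shape (add_mset a (mset v))" "is_shape (add_mset b (mset v))"
    using y y' unfolding yam3 by (simp_all add: yamanouchi_dec)
  \<comment> \<open>Both \<open>a\<close> and \<open>b\<close> are addable to the shape of
    \<open>v\<close>, so the row just above the larger one is a corner. Placed before them it lies
    between them, and \<open>\<phi> (q - 1)\<close> exchanges \<open>a\<close> and
    \<open>b\<close>.\<close>
  define s where "s = max a b - 1"
  have s: "b \<le> s \<and> s < a \<or> a \<le> s \<and> s < b" using assms(3) by (auto simp: s_def)
  have "count (mset v) (Suc s) < count (mset v) s"
    using ab(2,3) unfolding is_shape_add_iff[OF ab(1)] using s by (auto simp: s_def max_def split: if_splits)
  then obtain w where w: "yamanouchi (w @ [s])" "mset (w @ [s]) = mset v" using ex_yam_snoc[OF ab(1)] by blast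
  obtain p where p: "set p \<subseteq> {2..<length v}" "fold knuth p v = w @ [s]" "G (fold \<phi> p T) = (w @ [s]) @ [a, b, c]"
    "fold \<phi> p T \<in> A" "fold \<phi> (rev p) (fold \<phi> p T) = T"
    using reach[OF assms(1,2) _ w] lv by auto
  let ?U = "fold \<phi> p T"
  have U: "G ?U = w @ [s, a, b, c]" using p(3) by simp
  have lw: "q = length w + 3" using bits4(2)[OF p(4) U] .
  have q1: "2 \<le> q - 1" "q - 1 < q" "q - 1 < Suc q" "q - 1 + 1 = q" using lw by auto
  have "G (\<phi> (q - 1) ?U) = w @ [s, b, a, c]"
    using Geq[OF q1(1,2) p(4)] U knuth_app'[of "q - 1" w s a b "[c]"] lw knuth3_between_fst[OF s] by simp
  then have V: "G (\<phi> (q - 1) ?U) = (w @ [s]) @ [b, a, c]" by simp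
  have VA: "\<phi> (q - 1) ?U \<in> A" using closed[OF q1(1,3) p(4)] .
  \<comment> \<open>\<open>c\<close> lies between \<open>a\<close> and \<open>b\<close>, so the
    exchange alters the comparison with \<open>c\<close>; \<open>phi_pair\<close> then identifies
    the two involutions on \<open>?U\<close>.\<close>
  have "(q \<in> Des (\<phi> (q - 1) ?U)) \<noteq> (q \<in> Des ?U)"
    using bits3(1)[OF VA V] bits3(1)[OF p(4) p(3)] assms(3) by auto
  then have e: "\<phi> q ?U = \<phi> (q - 1) ?U"
    using phi_pair(1)[OF q1(1) _ p(4)] unfolding q1(4) by simp
  have pr: "set (rev p) \<subseteq> {2..<q - 2}" using p(1) lv by auto
  then have qT: "\<phi> q T = fold \<phi> (rev p) (\<phi> (q - 1) ?U)"
    using fold_comm[OF pr _ p(4)] p(5) e by simp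
  have lws: "length (w @ [s]) = length v" using w(2) by (metis size_mset)
  have "fold knuth (rev p) (w @ [s]) = v" using foldK_rev[OF p(1)] p(2) by simp
  moreover have "G (fold \<phi> (rev p) (\<phi> (q - 1) ?U)) = fold knuth (rev p) (w @ [s]) @ [b, a, c]"
    by (rule G_fold_app[OF VA V]) (use lws p(1) lv in auto)
  ultimately show "G (\<phi> q T) = v @ [b, a, c]" unfolding qT by simp
  have "reachable \<phi> {2..<q} T ?U" unfolding reachable_def using order_trans[OF p(1), of "{2..<q}"] lv by (intro exI[of _ p]) simp
  moreover have "reachable \<phi> {2..<q} ?U (\<phi> (q - 1) ?U)" using q1 by (intro reachable_step) auto
  moreover have "reachable \<phi> {2..<q} (\<phi> (q - 1) ?U) (\<phi> q T)"
    unfolding reachable_def qT using order_trans[OF pr, of "{2..<q}"] by (intro exI[of _ "rev p"]) simp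
  ultimately show "reachable \<phi> {2..<q} T (\<phi> q T)" using reachable_trans by metis
qed

lemma q_swaps:
  assumes "T \<in> A" "G T = v @ [a, b, c]" "G (\<phi> q T) = v @ [a', b', c']" "(a < b) \<noteq> (b < c)"
  shows "a' < b' \<longleftrightarrow> b < c" "b' < c' \<longleftrightarrow> a < b"
  using phi_bits(2)[OF q2 _ assms(1)] bits3[OF assms(1,2)] bits3[OF q_in[OF assms(1)] assms(3)] assms(4) by auto

text \<open>Otherwise \<open>case_A\<close> applies to \<open>\<phi> q T\<close>. As
  \<open>\<phi> q\<close> is an involution, this presents the word of \<open>T\<close> as
  \<open>v @ [b', a', c']\<close>, with the last letter between the two before it, contrary to the
  assumption.\<close>

lemma case_B_stays:
  assumes T: "T \<in> A" "G T = v @ [a, b, c]" "b \<le> a \<and> a < c \<or> c \<le> a \<and> a < b"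
    and T': "G (\<phi> q T) = v @ [a', b', c']"
  shows "b' \<le> a' \<and> a' < c' \<or> c' \<le> a' \<and> a' < b'"
proof (rule ccontr)
  assume n: "\<not> ?thesis"
  have "(a < b) \<noteq> (b < c)" using T(3) by auto
  note sw = q_swaps[OF T(1,2) T' this]
  have "a' < c' \<and> c' \<le> b' \<or> b' < c' \<and> c' \<le> a'" using n sw \<open>(a < b) \<noteq> (b < c)\<close> by linarith
  from case_A(1)[OF q_in[OF T(1)] T' this] have "G T = v @ [b', a', c']" using q_q[OF T(1)] by simp
  then show False using T(2,3) sw by auto
qed

text \<open>Rearranging the prefix uses involutions that commute with \<open>\<phi> q\<close>, so
  \<open>T\<close> and \<open>\<phi> q T\<close> are treated at the same time.\<close>

lemma reach_s:
  assumes "T \<in> A" "G T = v @ z" "G (\<phi> q T) = v @ z'" "length v \<le> q - 2" "yamanouchi w" "mset w = mset v"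
  obtains U where "U \<in> A" "G U = w @ z" "G (\<phi> q U) = w @ z'"
proof -
  obtain p where p: "set p \<subseteq> {2..<length v}" "fold knuth p v = w" "G (fold \<phi> p T) = w @ z" "fold \<phi> p T \<in> A"
    using reach[OF assms(1,2) _ assms(5,6)] assms(4) by (metis diff_le_self le_trans)
  have "set p \<subseteq> {2..<q - 2}" using p(1) assms(4) by fastforce
  then have "\<phi> q (fold \<phi> p T) = fold \<phi> p (\<phi> q T)" using fold_comm[OF _ _ assms(1)] by simp
  moreover have "G (fold \<phi> p (\<phi> q T)) = fold knuth p v @ z'"
    by (rule G_fold_app[OF q_in[OF assms(1)] assms(3)]) (use assms(4) p(1) in auto)
  ultimately show thesis using that[OF p(4,3)] p(2) by simp
qed

text \<open>By \<open>addable_unique\<close> it suffices to compare \<open>a\<close> and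
  \<open>a'\<close> with each corner \<open>s\<close> of \<open>v\<close>, moved directly before
  them. If the two comparisons differed, \<open>phi_pair\<close> would make \<open>\<phi> q\<close>
  agree with \<open>\<phi> (q - 1)\<close>, whose known Knuth move contradicts the position of
  \<open>a\<close> between \<open>b\<close> and \<open>c\<close>.\<close>

lemma case_B_fst:
  assumes T: "T \<in> A" "G T = v @ [a, b, c]" "b \<le> a \<and> a < c \<or> c \<le> a \<and> a < b"
    and T': "G (\<phi> q T) = v @ [a', b', c']"
  shows "a' = a"
proof -
  have lv: "q = length v + 2" using len3[OF T(1,2)] .
  have nb: "(a < b) \<noteq> (b < c)" using T(3) by auto
  note sw = q_swaps[OF T(1,2) T' nb]
  have y: "yamanouchi (v @ [a, b, c])" "yamanouchi (v @ [a', b', c'])" using Gyam T(1,2) T' q_in by metis+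
  then have d: "is_shape (mset v)" "is_shape (add_mset a (mset v))" "is_shape (add_mset a' (mset v))"
    unfolding yam3 by (simp_all add: yamanouchi_dec)
  have "a = a'"
  proof (rule addable_unique[OF d])
    fix s assume "count (mset v) (Suc s) < count (mset v) s"
    then obtain w where w: "yamanouchi (w @ [s])" "mset (w @ [s]) = mset v" using ex_yam_snoc[OF d(1)] by blast
    obtain U where U: "U \<in> A" "G U = (w @ [s]) @ [a, b, c]" "G (\<phi> q U) = (w @ [s]) @ [a', b', c']"
      using reach_s[OF T(1,2) T' _ w] lv by auto
    have U': "G U = w @ [s, a, b, c]" "G (\<phi> q U) = w @ [s, a', b', c']" using U by simp_all
    have lw: "q = length w + 3" using bits4(2)[OF U(1) U'(1)] .
    have q1: "2 \<le> q - 1" "q - 1 < q" "q - 1 + 1 = q" "q - 1 - 1 = q - 2" using lw by auto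
    show "s < a \<longleftrightarrow> s < a'"
    proof (rule ccontr)
      assume ne: "(s < a) \<noteq> (s < a')"
      then have "(q - 2 \<in> Des (\<phi> q U)) \<noteq> (q - 2 \<in> Des U)"
        using bits4(1)[OF U(1) U'(1)] bits4(1)[OF q_in[OF U(1)] U'(2)] by simp
      then have "\<phi> (q - 1) U = \<phi> q U" using phi_pair(2)[OF q1(1) _ U(1)] q1(3,4) by simp
      then have "w @ [s, a', b', c'] = knuth (q - 1) (w @ [s, a, b, c])"
        using Geq[OF q1(1,2) U(1)] U' by simp
      also have "\<dots> = w @ knuth3 s a b @ [c]" using knuth_app'[of "q - 1" w s a b "[c]"] lw by simp
      finally have k: "[s, a', b', c'] = knuth3 s a b @ [c]" by simp
      show False using knuth3_cases[of s a b] k ne sw nb T(3) by auto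
    qed
  qed
  then show ?thesis by simp
qed

text \<open>Again the letters are identified by comparison with corners \<open>s\<close>. Only
  corners on one side of \<open>a\<close> need work; for these, the relations between 32, 311 and
  221 in \<open>phi_next\<close> equate a comparison of \<open>s\<close> in \<open>T\<close> with
  one in \<open>\<phi> q T\<close>.\<close>

lemma case_B_up:
  assumes T: "T \<in> A" "G T = v @ [a, b, c]" "b \<le> a" "a < c"
    and T': "G (\<phi> q T) = v @ [a', b', c']"
  shows "a' = a \<and> b' = c \<and> c' = b"
proof -
  have B: "b \<le> a \<and> a < c \<or> c \<le> a \<and> a < b" using T(3,4) by simp
  have a': "a' = a" by (rule case_B_fst[OF T(1,2) B T'])
  have lv: "q = length v + 2" using len3[OF T(1,2)] .
  have nb: "(a < b) \<noteq> (b < c)" using T(3,4) by auto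
  note sw = q_swaps[OF T(1,2) T' nb]
  have T'r: "G (\<phi> q T) = v @ [a, b', c']" using T' a' by simp
  have o: "c' \<le> a" "a < b'" using case_B_stays[OF T(1,2) B T'] sw T(3,4) a' by auto
  have y: "yamanouchi (v @ [a, b, c])" "yamanouchi (v @ [a, b', c'])" using Gyam T(1,2) T'r q_in by metis+
  have y2: "yamanouchi (v @ [a, c, b])" "yamanouchi (v @ [a, c', b'])"
  proof -
    show "yamanouchi (v @ [a, c, b])"
      using yamanouchi_K[of q "v @ [a, b, c]"] y lv knuth_app'[of q v a b c "[]"] knuth3_between_fst[of c a b] T(3,4) by simp
    show "yamanouchi (v @ [a, c', b'])"
      using yamanouchi_K[of q "v @ [a, b', c']"] y lv knuth_app'[of q v a b' c' "[]"] knuth3_between_fst[of c' a b'] o by simp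
  qed
  let ?R = "add_mset a (mset v)"
  have dv: "is_shape (mset v)" and dR: "is_shape ?R" "is_shape (add_mset b ?R)" "is_shape (add_mset c ?R)" "is_shape (add_mset b' ?R)" "is_shape (add_mset c' ?R)"
    using y y2 unfolding yam3 by (simp_all add: yamanouchi_dec)
  have "is_shape (add_mset a (mset v))" using dR(1) .
  then have aadd: "a = 0 \<or> count (mset v) a < count (mset v) (a - 1)" unfolding is_shape_add_iff[OF dv] .
  have words: "\<exists>w U. U \<in> A \<and> G U = w @ [t, s, a, b, c] \<and> G (\<phi> q U) = w @ [t, s, a, b', c']"
    if st: "count (mset v) (Suc s) < count (mset v) s" "count (mset v - {#s#}) (Suc t) < count (mset v - {#s#}) t" for s t
  proof -
    obtain w where w: "yamanouchi (w @ [t, s])" "mset (w @ [t, s]) = mset v" using ex_yam_snoc2[OF dv st] by blast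
    obtain U where "U \<in> A" "G U = (w @ [t, s]) @ [a, b, c]" "G (\<phi> q U) = (w @ [t, s]) @ [a, b', c']"
      using reach_s[OF T(1,2) T'r _ w] lv by auto
    then show ?thesis by auto
  qed
  have qs: "2 \<le> q - 2 \<and> q - 2 < q \<and> q - 2 + 2 = q \<and> q - 2 + 1 = q - 1 \<and> q - 2 - 1 = q - 3 \<and> 2 \<le> q - 1 \<and> q - 1 < q"
    if "q = length w + 4" for w :: "nat list" using that by auto
  have "c = b'"
  proof (rule addable_unique[OF dR(1,3,4)])
    fix s assume s: "count ?R (Suc s) < count ?R s"
    show "s < c \<longleftrightarrow> s < b'"
    proof (cases "s \<le> a")
      case True
      then show ?thesis using T(4) o by simp
    next
      case False
      have s1: "count (mset v) (Suc s) < count (mset v) s" using s False by (simp split: if_splits)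
      \<comment> \<open>Since \<open>a \<le> t < s\<close>, the letter \<open>t\<close> makes
        \<open>\<phi> (q - 2)\<close> exchange \<open>s\<close> and \<open>a\<close>.\<close>
      define t where "t = s - 1"
      have t: "Suc t = s" "a \<le> t" using False by (auto simp: t_def)
      have "count (mset v) s \<le> count (mset v) t" using dv t(1) unfolding is_shape_def by metis
      then have "count (mset v - {#s#}) (Suc t) < count (mset v - {#s#}) t" using s1 t(1) by auto
      then obtain w U where U: "U \<in> A" "G U = w @ [t, s, a, b, c]" "G (\<phi> q U) = w @ [t, s, a, b', c']"
        using words[OF s1] by blast
      have lw: "q = length w + 4" using bits5(2)[OF U(1,2)] .
      note qq = qs[OF lw]
      have bs: "q - 3 \<in> Des U" "q - 2 \<notin> Des U" "q - 1 \<notin> Des U" "q \<in> Des U"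
        using bits5(1)[OF U(1,2)] bits4(1)[OF U(1), of "w @ [t]" s a b c] bits3[OF U(1), of "w @ [t, s]" a b c]
          U(2) t False T(3,4) by auto
      \<comment> \<open>Evaluated below, the left side says \<open>s < c\<close> and the right side
        \<open>s < b'\<close>.\<close>
      have F: "q \<in> Des (\<phi> (q - 1) (\<phi> (q - 2) U)) \<longleftrightarrow> q - 3 \<in> Des (\<phi> (q - 1) (\<phi> q U))"
        using phi_next(3)[of "q - 2" U] qq U(1) bs by simp
      have 1: "G (\<phi> (q - 2) U) = w @ [t, a, s, b, c]"
        using Geq[of "q - 2" U] qq U(1,2) knuth_app'[of "q - 2" w t s a "[b, c]"] knuth3_between_fst[of a t s] lw t by simp
      have A1: "\<phi> (q - 2) U \<in> A" using closed[of "q - 2" U] qq U(1) by simp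
      have 2: "G (\<phi> (q - 1) (\<phi> (q - 2) U)) = w @ [t, a, b, s, c]"
        using Geq[of "q - 1", OF _ _ A1] qq 1 knuth_app_Suc[of "q - 1" w t a s b "[c]"] knuth3_between_fst[of b a s] lw t False T(3) by simp
      have A2: "\<phi> (q - 1) (\<phi> (q - 2) U) \<in> A" using closed[of "q - 1", OF _ _ A1] qq by simp
      have L: "q \<in> Des (\<phi> (q - 1) (\<phi> (q - 2) U)) \<longleftrightarrow> s < c"
        using bits3(1)[OF A2, of "w @ [t, a]" b s c] 2 by simp
      have 3: "G (\<phi> (q - 1) (\<phi> q U)) = w @ t # knuth3 s a b' @ [c']"
        using Geq[of "q - 1", OF _ _ q_in[OF U(1)]] qq U(3) knuth_app_Suc[of "q - 1" w t s a b' "[c']"] lw by simp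
      have A3: "\<phi> (q - 1) (\<phi> q U) \<in> A" using closed[of "q - 1", OF _ _ q_in[OF U(1)]] qq by simp
      have "q - 3 \<in> Des (\<phi> (q - 1) (\<phi> q U)) \<longleftrightarrow> s < b'"
      proof (cases "s < b'")
        case True
        then have "knuth3 s a b' = [s, b', a]" using knuth3_between_fst[of a s b'] knuth3_between_fst[of b' s a] t by auto
        then show ?thesis using bits5(1)[OF A3, of w t s b' a c'] 3 t True by simp
      next
        case le: False
        then have "knuth3 s a b' = [a, s, b']" using knuth3_between_last[of s b' a] o(2) by auto
        then show ?thesis using bits5(1)[OF A3, of w t a s b' c'] 3 t le by simp
      qed
      then show ?thesis using L F by simp
    qed
  qed
  moreover have "b = c'"
  proof (rule addable_unique[OF dR(1,2,5)])
    fix s assume s: "count ?R (Suc s) < count ?R s"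
    show "s < b \<longleftrightarrow> s < c'"
    proof (cases "a \<le> s")
      case True
      then show ?thesis using T(3) o by simp
    next
      case False
      have s1: "count (mset v) (Suc s) < count (mset v) s" using s False by (simp split: if_splits)
      \<comment> \<open>Now \<open>s \<le> t < a\<close>, and again \<open>t\<close> makes
        \<open>\<phi> (q - 2)\<close> exchange \<open>s\<close> and \<open>a\<close>.\<close>
      define t where "t = a - 1"
      have t: "Suc t = a" "s \<le> t" using False by (auto simp: t_def)
      have "count (mset v - {#s#}) (Suc t) < count (mset v - {#s#}) t"
        using aadd t s False by (cases "s = t") auto
      then obtain w U where U: "U \<in> A" "G U = w @ [t, s, a, b, c]" "G (\<phi> q U) = w @ [t, s, a, b', c']"
        using words[OF s1] by blast
      have lw: "q = length w + 4" using bits5(2)[OF U(1,2)] .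
      note qq = qs[OF lw]
      have bs: "q - 3 \<notin> Des U" "q - 2 \<in> Des U" "q - 1 \<notin> Des U" "q \<in> Des U"
        using bits5(1)[OF U(1,2)] bits4(1)[OF U(1), of "w @ [t]" s a b c] bits3[OF U(1), of "w @ [t, s]" a b c]
          U(2) t False T(3,4) by auto
      have bq: "q - 2 \<in> Des (\<phi> q U)"
        using bits4(1)[OF q_in[OF U(1)], of "w @ [t]" s a b' c'] U(3) t by simp
      \<comment> \<open>Here the left side says \<open>s < b\<close> and the right side
        \<open>s < c'\<close>.\<close>
      have F: "q - 3 \<in> Des (\<phi> (q - 1) U) \<longleftrightarrow> q \<in> Des (\<phi> (q - 1) (\<phi> (q - 2) (\<phi> q U)))"
        using phi_next(4)[of "q - 2" U] qq U(1) bs bq by simp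
      have 1: "G (\<phi> (q - 2) (\<phi> q U)) = w @ [t, a, s, b', c']"
        using Geq[of "q - 2", OF _ _ q_in[OF U(1)]] qq U(3) knuth_app'[of "q - 2" w t s a "[b', c']"] knuth3_between_fst[of a t s] lw t by simp
      have A1: "\<phi> (q - 2) (\<phi> q U) \<in> A" using closed[of "q - 2", OF _ _ q_in[OF U(1)]] qq by simp
      have 2: "G (\<phi> (q - 1) (\<phi> (q - 2) (\<phi> q U))) = w @ [t, a, b', s, c']"
        using Geq[of "q - 1", OF _ _ A1] qq 1 knuth_app_Suc[of "q - 1" w t a s b' "[c']"] knuth3_between_fst[of b' a s] lw t False o by simp
      have A2: "\<phi> (q - 1) (\<phi> (q - 2) (\<phi> q U)) \<in> A" using closed[of "q - 1", OF _ _ A1] qq by simp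
      have L: "q \<in> Des (\<phi> (q - 1) (\<phi> (q - 2) (\<phi> q U))) \<longleftrightarrow> s < c'"
        using bits3(1)[OF A2, of "w @ [t, a]" b' s c'] 2 by simp
      have 3: "G (\<phi> (q - 1) U) = w @ t # knuth3 s a b @ [c]"
        using Geq[of "q - 1", OF _ _ U(1)] qq U(2) knuth_app_Suc[of "q - 1" w t s a b "[c]"] lw by simp
      have A3: "\<phi> (q - 1) U \<in> A" using closed[of "q - 1", OF _ _ U(1)] qq by simp
      have "q - 3 \<in> Des (\<phi> (q - 1) U) \<longleftrightarrow> s < b"
      proof (cases "s < b")
        case True
        then have "knuth3 s a b = [a, s, b]" using knuth3_between_last[of s b a] T(3) by auto
        then show ?thesis using bits5(1)[OF A3, of w t a s b c] 3 t True by simp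
      next
        case le: False
        then have "knuth3 s a b = [s, b, a]" using knuth3_between_fst[of b s a] False by auto
        then show ?thesis using bits5(1)[OF A3, of w t s b a c] 3 t le by simp
      qed
      then show ?thesis using L F by simp
    qed
  qed
  ultimately show ?thesis using a' by simp
qed

lemma case_B:
  assumes T: "T \<in> A" "G T = v @ [a, b, c]" "b \<le> a \<and> a < c \<or> c \<le> a \<and> a < b"
  shows "G (\<phi> q T) = v @ [a, c, b]"
proof -
  obtain a' b' c' where T': "G (\<phi> q T) = v @ [a', b', c']" using q_prefix_split[OF T(1,2)] by blast
  show ?thesis
  proof (cases "b \<le> a \<and> a < c")
    case True
    then show ?thesis using case_B_up[OF T(1,2) _ _ T'] T' by simp
  next
    case False
    then have o: "c \<le> a" "a < b" using T(3) by auto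
    have nb: "(a < b) \<noteq> (b < c)" using o by auto
    note sw = q_swaps[OF T(1,2) T' nb]
    have "b' \<le> a' \<and> a' < c'" using case_B_stays[OF T T'] sw o by auto
    then show ?thesis using case_B_up[OF q_in[OF T(1)] T', of a b c] q_q[OF T(1)] T(2) T' by simp
  qed
qed

lemma G_q:
  assumes "T \<in> A"
  shows "G (\<phi> q T) = knuth q (G T)"
proof -
  obtain v a b c where v: "G T = v @ [a, b, c]" "length v = q - 2" using split_last3[OF assms] by blast
  have k: "knuth q (G T) = v @ knuth3 a b c" using v knuth_app'[of q v a b c "[]"] len3[OF assms v(1)] by simp
  consider "a < c \<and> c \<le> b \<or> b < c \<and> c \<le> a" | "b \<le> a \<and> a < c \<or> c \<le> a \<and> a < b" | "(a < b) = (b < c)"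
    by linarith
  then show ?thesis
  proof cases
    case 1
    then show ?thesis using case_A(1)[OF assms v(1)] k knuth3_between_last by simp
  next
    case 2
    then show ?thesis using case_B[OF assms v(1)] k knuth3_between_fst by auto
  next
    case 3
    then have "\<phi> q T = T" using phi_bits(1)[OF q2 _ assms] bits3[OF assms v(1)] by simp
    moreover have "knuth3 a b c = [a, b, c]" using knuth3_cases[of a b c] 3 by auto
    ultimately show ?thesis using k v by simp
  qed
qed

end

section \<open>Injectivity\<close>

abbreviation between :: "nat \<Rightarrow> nat \<Rightarrow> nat \<Rightarrow> bool" where
  "between s d c \<equiv> c \<le> s \<and> s < d \<or> d \<le> s \<and> s < c"

lemma is_shape_minus:
  assumes "is_shape M" "count M (Suc c) < count M c"
  shows "is_shape (M - {#c#})"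
  unfolding is_shape_def
proof
  fix r
  show "count (M - {#c#}) (Suc r) \<le> count (M - {#c#}) r"
    using assms(1)[unfolded is_shape_def, rule_format, of r] assms(2) by (cases "r = c") auto
qed

lemma corner_minus:
  "count M (Suc c') < count M c' \<Longrightarrow> c \<noteq> c' \<Longrightarrow> count (M - {#c#}) (Suc c') < count (M - {#c#}) c'"
  by auto

lemma corner_in: "count M (Suc c) < count M c \<Longrightarrow> c \<in># M"
  by (metis count_eq_zero_iff not_less0)

lemma corner_last:
  assumes "yamanouchi (w @ [c])" "mset (w @ [c]) = M"
  shows "count M (Suc c) < count M c"
proof -
  have "is_shape (mset w)" using assms(1) yamanouchi_dec by auto
  then have "count (mset w) (Suc c) \<le> count (mset w) c" unfolding is_shape_def by blast
  then show ?thesis unfolding assms(2)[symmetric] by auto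
qed

lemma corner_below_addable:
  assumes "is_shape M" "is_shape (add_mset c M)" "b < c"
  shows "count M (Suc (c - 1)) < count M (c - 1)"
  using assms(2,3) unfolding is_shape_add_iff[OF assms(1)] by auto

text \<open>\<open>low_inj\<close> will come from the model of size \<open>q\<close>,
  \<open>win_inj\<close> from a model of the last six entries, on which
  \<open>\<phi> (q - 3)\<close> to \<open>\<phi> q\<close> act. Both are to be combined into
  injectivity of \<open>G\<close> on the full classes.\<close>

locale lift_inj = lift q A Des \<phi> G for q A Des \<phi> G +
  assumes low_inj: "T \<in> A \<Longrightarrow> reachable \<phi> {2..<q} T S \<Longrightarrow> G T = G S \<Longrightarrow> T = S"
    and win_inj: "T \<in> A \<Longrightarrow> reachable \<phi> {q - 3..q} T S \<Longrightarrow> G T = G S \<Longrightarrow> T = S"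
    and q6: "6 \<le> q"
begin

abbreviation low :: "'a \<Rightarrow> 'a \<Rightarrow> bool" where "low \<equiv> reachable \<phi> {2..<q}"

lemma low_sub: "{2..<q} \<subseteq> {2..<Suc q}" by auto

lemma low_A: "low T S \<Longrightarrow> T \<in> A \<Longrightarrow> S \<in> A"
  by (rule reachable_in[OF _ low_sub])

lemma low_sym: "low T S \<Longrightarrow> T \<in> A \<Longrightarrow> low S T"
  by (rule reachable_sym[OF _ low_sub])

lemma Gall: "2 \<le> i \<Longrightarrow> i \<le> q \<Longrightarrow> T \<in> A \<Longrightarrow> G (\<phi> i T) = knuth i (G T)"
  using Geq G_q by (cases "i = q") auto

lemma mset_phi: "2 \<le> i \<Longrightarrow> i \<le> q \<Longrightarrow> T \<in> A \<Longrightarrow> mset (G (\<phi> i T)) = mset (G T)"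
  using Gall Glen by simp

lemma low_G:
  assumes "T \<in> A" "low T S"
  shows "mset (G S) = mset (G T)" "last (G S) = last (G T)"
proof -
  obtain p where p: "set p \<subseteq> {2..<q}" "fold \<phi> p T = S" using assms(2) unfolding reachable_def by blast
  have gs: "G S = fold knuth p (G T)" using G_fold[OF p(1) assms(1)] p(2) by simp
  obtain w c where w: "G T = w @ [c]" using Glen[OF assms(1)] by (cases "G T" rule: rev_cases) auto
  then have l: "length w = q" using Glen[OF assms(1)] by simp
  have pw: "set p \<subseteq> {2..<length w}" using p(1) l by simp
  have e: "G S = fold knuth p w @ [c]" using gs w foldK_append[OF pw] by simp
  show "mset (G S) = mset (G T)" using e w foldK_props[OF pw] by simp
  show "last (G S) = last (G T)" using e w by simp
qed

lemma reach_low: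
  assumes "T \<in> A" "G T = u @ z" "z \<noteq> []" "yamanouchi w" "mset w = mset u"
  obtains S where "S \<in> A" "low T S" "G S = w @ z"
proof -
  have l: "length u \<le> q" using Glen[OF assms(1)] assms(2,3) by (cases z) auto
  obtain p where "set p \<subseteq> {2..<length u}" "G (fold \<phi> p T) = w @ z" "fold \<phi> p T \<in> A"
    using reach[OF assms(1,2) l assms(4,5)] by metis
  moreover from this(1) have "low T (fold \<phi> p T)" unfolding reachable_def using l by (intro exI[of _ p]) auto
  ultimately show thesis using that by blast
qed

lemma swap:
  assumes "X \<in> A" "G X = u @ a # b # c # z" "i = length u + 2" "c \<le> a \<and> a < b \<or> b \<le> a \<and> a < c"
  shows "\<phi> i X \<in> A" "G (\<phi> i X) = u @ a # c # b # z"
proof -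
  have i: "2 \<le> i" "i \<le> q" using assms(2,3) Glen[OF assms(1)] by auto
  show "\<phi> i X \<in> A" using closed[of i X] i assms(1) by simp
  show "G (\<phi> i X) = u @ a # c # b # z"
    using Gall[OF i assms(1)] assms(2) knuth_app'[OF assms(3)] knuth3_between_fst[OF assms(4)] by simp
qed

text \<open>The prefixes are joined by involutions that commute with \<open>\<phi> q\<close>;
  \<open>low_inj\<close> ensures that the element reached is \<open>T2\<close> itself and not merely
  one with the same word.\<close>

lemma class_indep_same:
  assumes T: "T1 \<in> A" "low T1 T2" "G T1 = v1 @ [s, d, c]" "G T2 = v2 @ [s, d, c]"
  shows "low (\<phi> q T1) (\<phi> q T2)"
proof -
  have A2: "T2 \<in> A" using low_A T by blast
  have m: "mset v2 = mset v1" using low_G(1)[OF T(1,2)] T(3,4) by simp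
  have "yamanouchi (v2 @ [s, d, c])" using Gyam[OF A2] T(4) by simp
  then have "yamanouchi v2" by (rule yamanouchi_appendD)
  moreover have l: "q = length v1 + 2" using len3[OF T(1,3)] .
  ultimately obtain p where p: "set p \<subseteq> {2..<length v1}" "G (fold \<phi> p T1) = v2 @ [s, d, c]" "fold \<phi> p T1 \<in> A"
    using reach[OF T(1,3) _ _ m] by (metis le_add1)
  have pq: "set p \<subseteq> {2..<q - 2}" using p(1) l by simp
  have "low T1 (fold \<phi> p T1)" unfolding reachable_def using order_trans[OF pq, of "{2..<q}"] by (intro exI[of _ p]) simp
  then have "low (fold \<phi> p T1) T2" using low_sym T reachable_trans by metis
  then have e: "fold \<phi> p T1 = T2" using low_inj[OF p(3)] p(2) T(4) by simp
  have "\<phi> q T2 = fold \<phi> p (\<phi> q T1)" using fold_comm[OF pq _ T(1)] e by simp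
  then show ?thesis unfolding reachable_def using order_trans[OF pq, of "{2..<q}"] by (intro exI[of _ p]) simp
qed

text \<open>The two choices are linked through words that contain both \<open>s1\<close> and
  \<open>s2\<close> directly before \<open>d\<close>, in either order. There \<open>\<phi> q\<close>
  and \<open>\<phi> (q - 2)\<close>, applied in either order, lead to the same word within a window,
  hence to the same element.\<close>

lemma class_indep_less:
  assumes T: "T1 \<in> A" "low T1 T2" "G T1 = v1 @ [s1, d, c]" "G T2 = v2 @ [s2, d, c]"
    and s: "between s1 d c" "between s2 d c" "s1 < s2"
  shows "low (\<phi> q T1) (\<phi> q T2)"
proof -
  have A2: "T2 \<in> A" using low_A T by blast
  have y: "yamanouchi (v1 @ [s1, d, c])" "yamanouchi (v2 @ [s2, d, c])" using Gyam T A2 by metis+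
  have m: "add_mset s2 (mset v2) = add_mset s1 (mset v1)" using low_G(1)[OF T(1,2)] T(3,4) by simp
  define M where "M = mset v1 - {#s2#}"
  have "s2 \<in># mset v1" using m s(3) by (metis insert_noteq_member nat_less_le union_single_eq_member)
  then have m1: "mset v1 = add_mset s2 M" by (simp add: M_def)
  have m2: "mset v2 = add_mset s1 M" using m unfolding m1 by (metis add_mset_add_mset_same_iff add_mset_commute)
  have d1: "is_shape (add_mset s2 M)" "is_shape (add_mset s1 (add_mset s2 M))" "is_shape (add_mset d (add_mset s1 (add_mset s2 M)))"
    "is_shape (add_mset c (add_mset d (add_mset s1 (add_mset s2 M))))" 
    using y(1) unfolding yam3 m1[symmetric] by (simp_all add: yamanouchi_dec)
  have d2: "is_shape (add_mset s1 M)" using y(2) unfolding yam3 m2[symmetric] by (simp add: yamanouchi_dec)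
  have dM: "is_shape M" using is_shape_add_mono[OF d1(1) d2] s(3) by simp
  \<comment> \<open>\<open>s1 \<le> t < s2\<close>, so a letter \<open>t\<close> in front lets
    \<open>\<phi> (q - 2)\<close> exchange \<open>s1\<close> and \<open>s2\<close>.\<close>
  define t where "t = s2 - 1"
  have t: "s1 \<le> t" "t < s2" using s(3) by (auto simp: t_def)
  obtain v0 where v0: "yamanouchi (v0 @ [t])" "mset (v0 @ [t]) = M"
    using ex_yam_snoc[OF dM] corner_below_addable[OF dM d1(1) s(3)] unfolding t_def by blast
  have w: "yamanouchi ((v0 @ [t]) @ [s2, s1, d])" "mset ((v0 @ [t]) @ [s2, s1]) = mset (v1 @ [s1])"
    unfolding yam3 v0(2) using v0 d1 m1 by simp_all
  then have yw: "yamanouchi ((v0 @ [t]) @ [s2, s1])" using yamanouchi_appendD[of "(v0 @ [t]) @ [s2, s1]" "[d]"] by simp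
  obtain U where U: "U \<in> A" "low T1 U" "G U = ((v0 @ [t]) @ [s2, s1]) @ [d, c]"
    using reach_low[OF T(1) _ _ yw w(2), of "[d, c]"] T(3) by auto
  have U': "G U = v0 @ t # s2 # s1 # [d, c]" "G U = (v0 @ [t, s2]) @ [s1, d, c]" using U(3) by simp_all
  have l: "q = length v0 + 4" using bits5(2)[OF U(1), of v0 t s2 s1 d c] U(3) by simp
  have "low (\<phi> q T1) (\<phi> q U)" by (rule class_indep_same[OF T(1) U(2) T(3) U'(2)])
  moreover
  let ?V = "\<phi> (q - 2) U"
  have V: "?V \<in> A" "G ?V = v0 @ t # s1 # s2 # [d, c]"
    using swap[OF U(1) U'(1), of "q - 2"] l t by auto
  have UV: "low U ?V" using q6 by (intro reachable_step) auto
  then have "low ?V T2" using U(1,2) T(1,2) low_sym reachable_trans V(1) by metis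
  then have "low (\<phi> q ?V) (\<phi> q T2)"
    by (rule class_indep_same[OF V(1) _ _ T(4), of "v0 @ [t, s1]"]) (use V(2) in simp)
  moreover have "\<phi> q ?V = \<phi> (q - 2) (\<phi> q U)"
  proof (rule win_inj)
    show VA: "\<phi> q ?V \<in> A" using q_in[OF V(1)] .
    have 1: "G (\<phi> q ?V) = (v0 @ [t, s1]) @ s2 # c # d # []"
      using swap(2)[OF V(1), of "v0 @ [t, s1]" s2 d c "[]" q] V(2) l s(2) by auto
    have 2: "G (\<phi> q U) = v0 @ t # s2 # s1 # [c, d]"
      using swap(2)[OF U(1), of "v0 @ [t, s2]" s1 d c "[]" q] U(3) l s(1) by auto
    have 3: "G (\<phi> (q - 2) (\<phi> q U)) = v0 @ t # s1 # s2 # [c, d]"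
      using swap(2)[OF q_in[OF U(1)] 2, of "q - 2"] l t by auto
    show "G (\<phi> q ?V) = G (\<phi> (q - 2) (\<phi> q U))" using 1 3 by simp
    have sub: "{q - 3..q} \<subseteq> {2..<Suc q}" using q6 by auto
    have "reachable \<phi> {q - 3..q} U (\<phi> q ?V)" unfolding reachable_def by (intro exI[of _ "[q - 2, q]"]) auto
    then have "reachable \<phi> {q - 3..q} (\<phi> q ?V) U" using reachable_sym[OF _ sub U(1)] by blast
    moreover have "reachable \<phi> {q - 3..q} U (\<phi> (q - 2) (\<phi> q U))" unfolding reachable_def by (intro exI[of _ "[q, q - 2]"]) auto
    ultimately show "reachable \<phi> {q - 3..q} (\<phi> q ?V) (\<phi> (q - 2) (\<phi> q U))" by (rule reachable_trans)
  qed
  moreover have "low (\<phi> q U) (\<phi> (q - 2) (\<phi> q U))" using q6 by (intro reachable_step) auto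
  ultimately show ?thesis using reachable_trans by metis
qed

text \<open>So the class entered when \<open>\<phi> q\<close> moves the largest entry from row
  \<open>c\<close> to row \<open>d\<close> depends only on the class that is left.\<close>

lemma class_indep:
  assumes T: "T1 \<in> A" "low T1 T2" "G T1 = v1 @ [s1, d, c]" "G T2 = v2 @ [s2, d, c]"
    and s: "between s1 d c" "between s2 d c"
  shows "low (\<phi> q T1) (\<phi> q T2)"
proof -
  have A2: "T2 \<in> A" using low_A T by blast
  consider "s1 = s2" | "s1 < s2" | "s2 < s1" by linarith
  then show ?thesis
  proof cases
    case 1
    then show ?thesis using class_indep_same[OF T(1-3), of v2] T(4) by simp
  next
    case 2
    then show ?thesis using class_indep_less[OF T s] by simp
  next
    case 3
    have "low (\<phi> q T2) (\<phi> q T1)"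
      using class_indep_less[OF A2 low_sym[OF T(2,1)] T(4,3) s(2,1) 3] .
    then show ?thesis using low_sym q_in A2 by blast
  qed
qed

text \<open>The three classes obtained by letting entry \<open>n + 1\<close> occupy three distinct corners are
  connected inside a window of six entries (of shape 321).\<close>

lemma triangle_less:
  assumes T: "T \<in> A" "G T = v @ [s, l, j]" "between s l j"
    and i: "count (mset (G T)) (Suc i) < count (mset (G T)) i" "i < j" "j < l"
  shows "\<exists>T1 T2 v1 s1 v2 s2. low T T1 \<and> low (\<phi> q T) T2 \<and> G T1 = v1 @ [s1, i, j] \<and> between s1 i j
    \<and> G T2 = v2 @ [s2, i, l] \<and> between s2 i l \<and> low (\<phi> q T1) (\<phi> q T2)"
proof -
  define N where "N = mset (G T)"
  have dN: "is_shape N" using Gyam[OF T(1)] yamanouchi_dec N_def by blast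
  have qT: "G (\<phi> q T) = v @ [s, j, l]"
    using swap(2)[OF T(1), of v s l j "[]" q] T(2,3) len3[OF T(1,2)] by auto
  have cj: "count N (Suc j) < count N j"
    by (rule corner_last[of "v @ [s, l]"]) (use Gyam[OF T(1)] T(2) N_def in simp_all)
  have cl: "count N (Suc l) < count N l"
    by (rule corner_last[of "v @ [s, j]"]) (use Gyam[OF q_in[OF T(1)]] qT T(2) N_def in simp_all)
  have ci: "count N (Suc i) < count N i" using i(1) N_def by simp
  define M where "M = N - {#j#} - {#l#} - {#i#}"
  have inN: "j \<in># N" "l \<in># N - {#j#}" "i \<in># N - {#j#} - {#l#}"
    using corner_in[OF cj] corner_in[OF cl] corner_in[OF ci] i by (auto simp: in_diff_count)
  have N1: "N - {#j#} - {#l#} = add_mset i M" unfolding M_def by (rule insert_DiffM[OF inN(3), symmetric])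
  have N2: "N - {#j#} = add_mset l (add_mset i M)" using N1 inN(2) by (metis insert_DiffM)
  have N3: "N = add_mset j (add_mset l (add_mset i M))" using N2 inN(1) by (metis insert_DiffM)
  have dj: "is_shape (N - {#j#})" by (rule is_shape_minus[OF dN cj])
  have djl: "is_shape (N - {#j#} - {#l#})" by (rule is_shape_minus[OF dj corner_minus[OF cl]]) (use i in simp)
  have dM: "is_shape M" unfolding M_def
    by (rule is_shape_minus[OF djl corner_minus[OF corner_minus[OF ci]]]) (use i in simp_all)
  have dji: "is_shape (add_mset j M)"
  proof -
    have a: "is_shape (N - {#l#})" by (rule is_shape_minus[OF dN cl])
    have "is_shape (N - {#l#} - {#i#})" by (rule is_shape_minus[OF a corner_minus[OF ci]]) (use i in simp)
    moreover have "N - {#l#} - {#i#} = add_mset j M" unfolding N3 by simp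
    ultimately show ?thesis by simp
  qed
  have dli: "is_shape (add_mset l M)"
  proof -
    have "is_shape (N - {#j#} - {#i#})" by (rule is_shape_minus[OF dj corner_minus[OF ci]]) (use i in simp)
    moreover have "N - {#j#} - {#i#} = add_mset l M" unfolding N3 by simp
    ultimately show ?thesis by simp
  qed
  have dii: "is_shape (add_mset i M)" using djl N1 by simp
  \<comment> \<open>Separators: \<open>y1\<close> lies between \<open>i\<close> and
    \<open>j\<close>, \<open>y2\<close> between \<open>j\<close> and \<open>l\<close>, and
    \<open>w\<close> below between \<open>y1\<close> and \<open>y2\<close>. Together with the three
    corners they are the six letters of the window.\<close>
  define y1 y2 where "y1 = j - 1" and "y2 = l - 1"
  have y: "i \<le> y1" "y1 < j" "j \<le> y2" "y2 < l" using i by (auto simp: y1_def y2_def)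
  have cy1: "count M (Suc y1) < count M y1" unfolding y1_def by (rule corner_below_addable[OF dM dji i(2)])
  have cy2: "count M (Suc y2) < count M y2" unfolding y2_def by (rule corner_below_addable[OF dM dli i(3)])
  define P where "P = M - {#y2#} - {#y1#}"
  have inM: "y2 \<in># M" "y1 \<in># M - {#y2#}" using corner_in[OF cy1] corner_in[OF cy2] y by (auto simp: in_diff_count)
  have M1: "M - {#y2#} = add_mset y1 P" unfolding P_def by (rule insert_DiffM[OF inM(2), symmetric])
  have M2: "M = add_mset y2 (add_mset y1 P)" using M1 inM(1) by (metis insert_DiffM)
  have dM2: "is_shape (M - {#y2#})" by (rule is_shape_minus[OF dM cy2])
  have dP: "is_shape P" unfolding P_def by (rule is_shape_minus[OF dM2 corner_minus[OF cy1]]) (use y in simp)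
  have dP2: "is_shape (add_mset y2 P)"
  proof -
    have "is_shape (M - {#y1#})" by (rule is_shape_minus[OF dM cy1])
    moreover have "M - {#y1#} = add_mset y2 P" unfolding M2 by simp
    ultimately show ?thesis by simp
  qed
  define w where "w = y2 - 1"
  have yy: "y1 < y2" using y by simp
  have w: "y1 \<le> w" "w < y2" using yy by (auto simp: w_def)
  obtain x where x: "yamanouchi (x @ [w])" "mset (x @ [w]) = P"
    using ex_yam_snoc[OF dP] corner_below_addable[OF dP dP2 yy] unfolding w_def by blast
  have iM: "is_shape (add_mset i (add_mset y1 P))"
  proof -
    have "i = 0 \<or> count M i < count M (i - 1)" using dii unfolding is_shape_add_iff[OF dM] .
    then have "i = 0 \<or> count (M - {#y2#}) i < count (M - {#y2#}) (i - 1)" using y i by auto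
    then show ?thesis using is_shape_add_iff[OF dM2] M1 by simp
  qed
  have z1: "yamanouchi ((x @ [w]) @ [y1, i, y2])" unfolding yam3 x(2)
  proof (intro conjI)
    show "is_shape (add_mset y1 P)" using dM2 M1 by simp
    have e: "add_mset y2 (add_mset i (add_mset y1 P)) = add_mset i M" unfolding M2 by simp
    show "is_shape (add_mset y2 (add_mset i (add_mset y1 P)))" unfolding e by (rule dii)
  qed (use x iM in simp_all)
  have z2: "mset ((x @ [w]) @ [y1, i, y2]) = add_mset i M" using x(2) unfolding M2 by simp
  have z: "yamanouchi (((x @ [w]) @ [y1, i, y2]) @ [l])"
    unfolding yamanouchi_snoc z2 using z1 dj N2 by simp
  have zm: "mset (((x @ [w]) @ [y1, i, y2]) @ [l]) = mset (v @ [s, l])"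
  proof -
    have "add_mset j (mset (v @ [s, l])) = N" unfolding N_def T(2) by simp
    moreover have "add_mset j (mset (((x @ [w]) @ [y1, i, y2]) @ [l])) = N" using z2 N3 by simp
    ultimately show ?thesis by (metis add_mset_add_mset_same_iff)
  qed
  obtain U where U: "U \<in> A" "low T U" "G U = (((x @ [w]) @ [y1, i, y2]) @ [l]) @ [j]"
    using reach_low[OF T(1) _ _ z zm, of "[j]"] T(2) by auto
  have l: "q = length x + 5" using Glen[OF U(1)] U(3) by simp
  have q': "q - 2 = length (x @ [w]) + 2" "q - 3 = length x + 2" "q - 1 = length (x @ [w, a]) + 2"
    "q = length (x @ [w, a, b]) + 2" for a b using l by auto
  let ?U1 = "\<phi> (q - 2) U" let ?U2 = "\<phi> (q - 3) ?U1" let ?U3 = "\<phi> (q - 1) ?U2" let ?U4 = "\<phi> (q - 2) ?U3"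
  have 1: "?U1 \<in> A" "G ?U1 = x @ w # y1 # y2 # [i, l, j]"
    using swap[OF U(1), of "x @ [w]" y1 i y2 "[l, j]", OF _ q'(1)] U(3) y yy by auto
  have 2: "?U2 \<in> A" "G ?U2 = x @ w # y2 # y1 # [i, l, j]"
    using swap[OF 1 q'(2)] w by auto
  have 3: "?U3 \<in> A" "G ?U3 = (x @ [w, y2]) @ y1 # l # i # [j]"
    using swap[OF 2(1), of "x @ [w, y2]" y1 i l "[j]", OF _ q'(3)] 2(2) y i by auto
  have 4: "?U4 \<in> A" "G ?U4 = (x @ [w]) @ y2 # l # y1 # [i, j]"
    using swap[OF 3(1), of "x @ [w]" y2 y1 l "[i, j]", OF _ q'(1)] 3(2) y yy by auto
  let ?V = "\<phi> q U" let ?V1 = "\<phi> (q - 2) ?V" let ?V2 = "\<phi> (q - 3) ?V1" let ?V3 = "\<phi> (q - 1) ?V2"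
  have 50: "?V \<in> A" "G ?V = (x @ [w, y1, i]) @ y2 # j # l # []"
    using swap[OF U(1), of "x @ [w, y1, i]" y2 l j "[]" q] U(3) y l by auto
  have 51: "?V1 \<in> A" "G ?V1 = x @ w # y1 # y2 # [i, j, l]"
    using swap[OF 50(1), of "x @ [w]" y1 i y2 "[j, l]", OF _ q'(1)] 50(2) y yy by auto
  have 52: "?V2 \<in> A" "G ?V2 = x @ w # y2 # y1 # [i, j, l]"
    using swap[OF 51 q'(2)] w by auto
  have 53: "?V3 \<in> A" "G ?V3 = (x @ [w, y2]) @ y1 # j # i # [l]"
    using swap[OF 52(1), of "x @ [w, y2]" y1 i j "[l]", OF _ q'(3)] 52(2) y i by auto
  let ?Q = "\<phi> q ?U4" let ?R = "\<phi> q ?V3"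
  let ?Q1 = "\<phi> (q - 2) ?Q" let ?Q2 = "\<phi> (q - 3) ?Q1" let ?Q3 = "\<phi> (q - 1) ?Q2" let ?Q4 = "\<phi> (q - 3) ?Q3"
  have 60: "?Q \<in> A" "G ?Q = (x @ [w, y2, l]) @ y1 # j # i # []"
    using swap[OF 4(1), of "x @ [w, y2, l]" y1 i j "[]" q] 4(2) y l by auto
  have 61: "?Q1 \<in> A" "G ?Q1 = (x @ [w]) @ y2 # y1 # l # [j, i]"
    using swap[OF 60(1), of "x @ [w]" y2 l y1 "[j, i]", OF _ q'(1)] 60(2) y yy by auto
  have 62: "?Q2 \<in> A" "G ?Q2 = x @ w # y1 # y2 # [l, j, i]"
    using swap[OF 61(1), of x w y2 y1 "[l, j, i]", OF _ q'(2)] 61(2) w by auto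
  have 63: "?Q3 \<in> A" "G ?Q3 = (x @ [w, y1]) @ y2 # j # l # [i]"
    using swap[OF 62(1), of "x @ [w, y1]" y2 l j "[i]", OF _ q'(3)] 62(2) y by auto
  have 64: "?Q4 \<in> A" "G ?Q4 = x @ w # y2 # y1 # [j, l, i]"
    using swap[OF 63(1), of x w y1 y2 "[j, l, i]", OF _ q'(2)] 63(2) w by auto
  have 70: "?R \<in> A" "G ?R = (x @ [w, y2, y1]) @ j # l # i # []"
    using swap[OF 53(1), of "x @ [w, y2, y1]" j i l "[]" q] 53(2) y i l by auto
  have sub: "{q - 3..q} \<subseteq> {2..<Suc q}" using q6 by auto
  \<comment> \<open>Both routes around the triangle start at \<open>U\<close>, stay in the window
    and end with the same word, so \<open>win_inj\<close> closes the loop.\<close>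
  have "?Q4 = ?R"
  proof (rule win_inj[OF 64(1)])
    have "reachable \<phi> {q - 3..q} U ?Q4" unfolding reachable_def
      by (intro exI[of _ "[q - 2, q - 3, q - 1, q - 2, q, q - 2, q - 3, q - 1, q - 3]"]) auto
    then have "reachable \<phi> {q - 3..q} ?Q4 U" by (rule reachable_sym[OF _ sub U(1)])
    moreover have "reachable \<phi> {q - 3..q} U ?R" unfolding reachable_def
      by (intro exI[of _ "[q, q - 2, q - 3, q - 1, q]"]) auto
    ultimately show "reachable \<phi> {q - 3..q} ?Q4 ?R" by (rule reachable_trans)
    show "G ?Q4 = G ?R" using 64(2) 70(2) by simp
  qed
  moreover have "low ?Q ?Q4" unfolding reachable_def using q6 by (intro exI[of _ "[q - 2, q - 3, q - 1, q - 3]"]) auto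
  ultimately have QR: "low ?Q ?R" by simp
  have "low U ?U4" unfolding reachable_def using q6 by (intro exI[of _ "[q - 2, q - 3, q - 1, q - 2]"]) auto
  then have TU4: "low T ?U4" using U(2) reachable_trans by metis
  have "low (\<phi> q T) ?V" by (rule class_indep[OF T(1) U(2) T(2), of "x @ [w, y1, i]" y2]) (use U(3) T(3) y in auto)
  moreover have "low ?V ?V3" unfolding reachable_def using q6 by (intro exI[of _ "[q - 2, q - 3, q - 1]"]) auto
  ultimately have TV: "low (\<phi> q T) ?V3" by (rule reachable_trans)
  have e1: "G ?U4 = (x @ [w, y2, l]) @ [y1, i, j]" using 4(2) by simp
  have e2: "G ?V3 = (x @ [w, y2, y1]) @ [j, i, l]" using 53(2) by simp
  have b: "between y1 i j" "between j i l" using y i by auto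
  show ?thesis using TU4 TV e1 e2 b QR by blast
qed

text \<open>Passing from \<open>T\<close> to \<open>\<phi> q T\<close> exchanges \<open>j\<close>
  and \<open>l\<close>, which reduces the claim to \<open>j < l\<close>.\<close>

lemma triangle:
  assumes T: "T \<in> A" "G T = v @ [s, l, j]" "between s l j"
    and i: "count (mset (G T)) (Suc i) < count (mset (G T)) i" "i < j" "i < l"
  shows "\<exists>T1 T2 v1 s1 v2 s2. low T T1 \<and> low (\<phi> q T) T2 \<and> G T1 = v1 @ [s1, i, j] \<and> between s1 i j
    \<and> G T2 = v2 @ [s2, i, l] \<and> between s2 i l \<and> low (\<phi> q T1) (\<phi> q T2)"
proof (cases "j < l")
  case True
  then show ?thesis using triangle_less[OF T i(1,2)] by blast
next
  case False
  then have lj: "l < j" using T(3) by auto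
  have qT: "G (\<phi> q T) = v @ [s, j, l]"
    using swap(2)[OF T(1), of v s l j "[]" q] T(2,3) len3[OF T(1,2)] by auto
  have m: "mset (G (\<phi> q T)) = mset (G T)" using qT T(2) by simp
  have b: "between s j l" using T(3) by auto
  obtain T1 T2 v1 s1 v2 s2 where h: "low (\<phi> q T) T1" "low (\<phi> q (\<phi> q T)) T2" "G T1 = v1 @ [s1, i, l]"
    "between s1 i l" "G T2 = v2 @ [s2, i, j]" "between s2 i j" "low (\<phi> q T1) (\<phi> q T2)"
    using triangle_less[OF q_in[OF T(1)] qT b _ i(3) lj] i(1) unfolding m by blast
  have "T1 \<in> A" using h(1) low_A q_in T(1) by blast
  then have "low (\<phi> q T2) (\<phi> q T1)" using low_sym[OF h(7)] q_in by blast
  moreover have "low T T2" using h(2) q_q[OF T(1)] by simp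
  ultimately show ?thesis using h by blast
qed

text \<open>\<open>S\<close> belongs to the class reached from that of \<open>T\<close> by moving the largest entry to row \<open>i\<close>.\<close>

definition base :: "nat \<Rightarrow> 'a \<Rightarrow> 'a \<Rightarrow> bool" where
  "base i T S \<longleftrightarrow> last (G T) = i \<and> low T S \<or>
     last (G T) \<noteq> i \<and> (\<exists>U v s. low T U \<and> G U = v @ [s, i, last (G T)] \<and> between s i (last (G T)) \<and> low (\<phi> q U) S)"

lemma base_low: "low T T' \<Longrightarrow> T \<in> A \<Longrightarrow> base i T S \<longleftrightarrow> base i T' S"
  unfolding base_def using low_G(2)[of T T'] reachable_trans low_sym[of T T'] low_A by metis

lemma base_unique:
  assumes "T \<in> A" "base i T S" "base i T S'"
  shows "low S S'"
proof (cases "last (G T) = i")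
  case True
  then have "low T S" "low T S'" using assms(2,3) unfolding base_def by auto
  then show ?thesis using low_sym[OF _ assms(1)] reachable_trans by metis
next
  case False
  then obtain U v s where U: "low T U" "G U = v @ [s, i, last (G T)]" "between s i (last (G T))" "low (\<phi> q U) S"
    using assms(2) unfolding base_def by auto
  obtain U' v' s' where U': "low T U'" "G U' = v' @ [s', i, last (G T)]" "between s' i (last (G T))" "low (\<phi> q U') S'"
    using assms(3) False unfolding base_def by auto
  have UA: "U \<in> A" using low_A U(1) assms(1) by blast
  have "low U U'" using low_sym[OF U(1) assms(1)] U'(1) by (rule reachable_trans)
  then have "low (\<phi> q U) (\<phi> q U')" using class_indep[OF UA _ U(2) U'(2) U(3) U'(3)] by blast
  then have "low (\<phi> q U) S'" using U'(4) by (rule reachable_trans)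
  moreover have "low S (\<phi> q U)" using low_sym[OF U(4)] q_in[OF UA] by blast
  ultimately show ?thesis by (metis reachable_trans)
qed

text \<open>With the corners \<open>i\<close> and \<open>c\<close> removed, both rows are addable,
  so a corner \<open>s\<close> of the rest separates them. The class of \<open>T\<close> then
  contains an element whose word ends in \<open>s\<close>, \<open>i\<close>,
  \<open>c\<close>.\<close>

lemma base_ex:
  assumes T: "T \<in> A" "count (mset (G T)) (Suc i) < count (mset (G T)) i"
  shows "\<exists>S. base i T S"
proof (cases "last (G T) = i")
  case True
  then show ?thesis unfolding base_def by (intro exI[of _ T]) simp
next
  case False
  obtain u c where u: "G T = u @ [c]" using Glen[OF T(1)] by (cases "G T" rule: rev_cases) auto
  define N where "N = mset (G T)"
  have dN: "is_shape N" using Gyam[OF T(1)] yamanouchi_dec N_def by blast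
  have ic: "i \<noteq> c" using False u by simp
  have cc: "count N (Suc c) < count N c"
    by (rule corner_last[of u]) (use Gyam[OF T(1)] u N_def in simp_all)
  have ci: "count N (Suc i) < count N i" using T(2) N_def by simp
  define M where "M = N - {#c#} - {#i#}"
  have inN: "c \<in># N" "i \<in># N - {#c#}" using corner_in[OF cc] corner_in[OF ci] ic by (auto simp: in_diff_count)
  have N1: "N - {#c#} = add_mset i M" unfolding M_def by (rule insert_DiffM[OF inN(2), symmetric])
  have N2: "N = add_mset c (add_mset i M)" using N1 inN(1) by (metis insert_DiffM)
  have dc: "is_shape (add_mset i M)" using is_shape_minus[OF dN cc] N1 by simp
  have di: "is_shape (add_mset c M)"
  proof -
    have "is_shape (N - {#i#})" by (rule is_shape_minus[OF dN ci])
    moreover have "N - {#i#} = add_mset c M" unfolding N2 using ic by simp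
    ultimately show ?thesis by simp
  qed
  have dM: "is_shape M" using is_shape_add_mono[OF dc di] ic by simp
  obtain s where s: "between s i c" "count M (Suc s) < count M s"
  proof (cases "i < c")
    case True
    then have "between (c - 1) i c" by auto
    then show thesis using that corner_below_addable[OF dM di True] by blast
  next
    case False
    then have "c < i" using ic by simp
    moreover from this have "between (i - 1) i c" by auto
    ultimately show thesis using that corner_below_addable[OF dM dc] by blast
  qed
  obtain x where x: "yamanouchi (x @ [s])" "mset (x @ [s]) = M" using ex_yam_snoc[OF dM s(2)] by blast
  have y: "yamanouchi ((x @ [s]) @ [i])" unfolding yamanouchi_snoc[of "x @ [s]"] x(2) using x(1) dc by blast
  have m: "mset ((x @ [s]) @ [i]) = mset u"
  proof -
    have "add_mset c (mset u) = N" using u N_def by simp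
    moreover have "add_mset c (mset ((x @ [s]) @ [i])) = N" using x(2) N2 by simp
    ultimately show ?thesis by (metis add_mset_add_mset_same_iff)
  qed
  obtain U where U: "U \<in> A" "low T U" "G U = ((x @ [s]) @ [i]) @ [c]"
    using reach_low[OF T(1) u _ y m] by auto
  have lc: "last (G T) = c" using u by simp
  have gU: "G U = x @ [s, i, c]" using U(3) by simp
  have "base i T (\<phi> q U)" unfolding base_def lc
    by (rule disjI2, intro conjI exI) (rule ic[symmetric], rule U(2), rule gU, rule s(1), rule reachable_refl)
  then show ?thesis by blast
qed

text \<open>Only a step of \<open>\<phi> q\<close> into another class matters. If one of the two
  corners involved is \<open>i\<close>, \<open>class_indep\<close> suffices; otherwise
  \<open>triangle\<close> compares their routes to \<open>i\<close>. Minimality of \<open>i\<close>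
  puts it below both other corners, as \<open>triangle\<close> requires.\<close>

lemma base_step:
  assumes T: "T \<in> A" "base i T S" "base i (\<phi> k T) S'" "2 \<le> k" "k \<le> q"
    and i: "count (mset (G T)) (Suc i) < count (mset (G T)) i"
    and min: "\<And>c. count (mset (G T)) (Suc c) < count (mset (G T)) c \<Longrightarrow> i \<le> c"
  shows "low S S'"
proof (cases "low T (\<phi> k T)")
  case True
  then show ?thesis using base_unique[OF T(1,2)] T(3) base_low[OF True T(1)] by blast
next
  case False
  then have k: "k = q" using T(4,5) reachable_step[of k "{2..<q}" \<phi> T] by (cases "k < q") auto
  obtain v a b c where v: "G T = v @ [a, b, c]" using split_last3[OF T(1)] by metis
  have l: "q = length v + 2" using len3[OF T(1) v] .
  have ab: "between a b c"
  proof (rule ccontr)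
    assume n: "\<not> ?thesis"
    show False
    proof (cases "a < c \<and> c \<le> b \<or> b < c \<and> c \<le> a")
      case True
      then show False using case_A(2)[OF T(1) v] False k by blast
    next
      case f: False
      then have "(a < b) = (b < c)" using n by linarith
      then have "\<phi> q T = T" using phi_bits(1)[OF q2 _ T(1)] bits3[OF T(1) v] by simp
      then show False using False k reachable_refl by metis
    qed
  qed
  have qT: "G (\<phi> q T) = v @ [a, c, b]" using swap(2)[OF T(1), of v a b c "[]" q] v ab l by auto
  have bc: "b \<noteq> c" using ab by auto
  have ab': "between a c b" using ab by auto
  have cc: "i \<le> c" by (rule min, rule corner_last[of "v @ [a, b]"]) (use Gyam[OF T(1)] v in simp_all)
  have cb: "i \<le> b" by (rule min, rule corner_last[of "v @ [a, c]"]) (use Gyam[OF q_in[OF T(1)]] qT v in simp_all)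
  have lasts: "last (G T) = c" "last (G (\<phi> q T)) = b" using v qT by simp_all
  note b1 = T(2)[unfolded base_def lasts] and b2 = T(3)[unfolded k base_def lasts]
  consider "c = i" | "b = i" | "i < c" "i < b" using cc cb by linarith
  then show ?thesis
  proof cases
    case 1
    then obtain U w s where U: "low (\<phi> q T) U" "G U = w @ [s, i, b]" "between s i b" "low (\<phi> q U) S'"
      using b2 bc 1 by (elim disjE conjE exE) simp_all
    have "low (\<phi> q (\<phi> q T)) (\<phi> q U)"
      by (rule class_indep[OF q_in[OF T(1)] U(1) _ U(2) _ U(3)]) (use qT ab 1 in auto)
    then have "low T S'" using q_q[OF T(1)] U(4) reachable_trans by metis
    then show ?thesis using b1 1 low_sym[OF _ T(1)] reachable_trans by metis
  next
    case 2
    then obtain U w s where U: "low T U" "G U = w @ [s, i, c]" "between s i c" "low (\<phi> q U) S"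
      using b1 bc 2 by (elim disjE conjE exE) simp_all
    have UA: "U \<in> A" using low_A[OF U(1) T(1)] .
    have "low (\<phi> q T) (\<phi> q U)"
      by (rule class_indep[OF T(1) U(1) _ U(2) _ U(3)]) (use v ab 2 in auto)
    then have "low (\<phi> q T) S" using U(4) reachable_trans by metis
    then have "low S (\<phi> q T)" using low_sym q_in[OF T(1)] by blast
    moreover have "low (\<phi> q T) S'" using b2 2 by auto
    ultimately show ?thesis by (rule reachable_trans)
  next
    case 3
    obtain T1 T2 v1 s1 v2 s2 where h: "low T T1" "low (\<phi> q T) T2" "G T1 = v1 @ [s1, i, c]" "between s1 i c"
      "G T2 = v2 @ [s2, i, b]" "between s2 i b" "low (\<phi> q T1) (\<phi> q T2)"
      using triangle[OF T(1) v ab i 3] by blast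
    have ne: "c \<noteq> i" "b \<noteq> i" using 3 by auto
    have "base i T (\<phi> q T1)" unfolding base_def lasts
      by (rule disjI2, intro conjI exI) (rule ne(1), rule h(1), rule h(3), rule h(4), rule reachable_refl)
    then have s1: "low S (\<phi> q T1)" by (rule base_unique[OF T(1,2)])
    have "base i (\<phi> q T) (\<phi> q T2)" unfolding base_def lasts
      by (rule disjI2, intro conjI exI) (rule ne(2), rule h(2), rule h(5), rule h(6), rule reachable_refl)
    then have s2: "low (\<phi> q T2) S'" by (rule base_unique[OF q_in[OF T(1)] _ T(3)[unfolded k]])
    show ?thesis by (rule reachable_trans[OF reachable_trans[OF s1 h(7)] s2])
  qed
qed

lemma base_path:
  assumes "set p \<subseteq> {2..<Suc q}" "T \<in> A" "base i T S" "base i (fold \<phi> p T) S'"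
    and "count (mset (G T)) (Suc i) < count (mset (G T)) i"
    and "\<And>c. count (mset (G T)) (Suc c) < count (mset (G T)) c \<Longrightarrow> i \<le> c"
  shows "low S S'"
  using assms
proof (induction p arbitrary: T S)
  case Nil
  then show ?case using base_unique by simp
next
  case (Cons k p)
  have k: "2 \<le> k" "k \<le> q" "set p \<subseteq> {2..<Suc q}" using Cons.prems(1) by auto
  have kA: "\<phi> k T \<in> A" using closed[of k T] k Cons.prems(2) by simp
  have m: "mset (G (\<phi> k T)) = mset (G T)" using mset_phi[OF k(1,2) Cons.prems(2)] .
  obtain S1 where S1: "base i (\<phi> k T) S1" using base_ex[OF kA] Cons.prems(5) unfolding m by blast
  have "low S S1" by (rule base_step[OF Cons.prems(2,3) S1 k(1,2) Cons.prems(5,6)])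
  moreover have "low S1 S'"
    by (rule Cons.IH[OF k(3) kA S1]) (use Cons.prems m in auto)
  ultimately show ?case by (rule reachable_trans)
qed

text \<open>Along the path from \<open>T\<close> to \<open>U\<close> the class at the smallest
  corner stays the same. Both words have the same last letter, so moving the largest entry back from
  that corner brings \<open>T\<close> and \<open>U\<close> into one small class, where
  \<open>low_inj\<close> applies.\<close>

lemma G_inj:
  assumes "T \<in> A" "reachable \<phi> {2..<Suc q} T U" "G T = G U"
  shows "T = U"
proof -
  let ?N = "mset (G T)"
  define i where "i = (LEAST c. count ?N (Suc c) < count ?N c)"
  obtain u c where u: "G T = u @ [c]" using Glen[OF assms(1)] by (cases "G T" rule: rev_cases) auto
  have cc: "count ?N (Suc c) < count ?N c"
    by (rule corner_last[of u]) (use Gyam[OF assms(1)] u in simp_all)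
  have i: "count ?N (Suc i) < count ?N i" unfolding i_def using cc by (rule LeastI)
  have min: "i \<le> d" if "count ?N (Suc d) < count ?N d" for d unfolding i_def using that by (rule Least_le)
  have UA: "U \<in> A" using reachable_in[OF assms(2) _ assms(1)] by simp
  obtain S where S: "base i T S" using base_ex[OF assms(1) i] by blast
  obtain S' where S': "base i U S'" using base_ex[OF UA, of i] i assms(3) by auto
  obtain p where p: "set p \<subseteq> {2..<Suc q}" "fold \<phi> p T = U" using assms(2) unfolding reachable_def by blast
  have SS: "low S S'" using base_path[OF p(1) assms(1) S _ i min] S' p(2) by simp
  have "low T U"
  proof (cases "last (G T) = i")
    case True
    then have "low T S" "low U S'" using S S' assms(3) unfolding base_def by auto
    then show ?thesis using SS low_sym[OF _ UA] reachable_trans by metis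
  next
    case False
    then obtain V v s where V: "low T V" "G V = v @ [s, i, last (G T)]" "between s i (last (G T))" "low (\<phi> q V) S"
      using S unfolding base_def by auto
    obtain W w t where W: "low U W" "G W = w @ [t, i, last (G T)]" "between t i (last (G T))" "low (\<phi> q W) S'"
      using S' False assms(3) unfolding base_def by auto
    have A: "V \<in> A" "W \<in> A" using low_A V(1) W(1) assms(1) UA by blast+
    have "low (\<phi> q V) S'" using V(4) SS by (rule reachable_trans)
    moreover have "low S' (\<phi> q W)" using low_sym[OF W(4) q_in[OF A(2)]] .
    ultimately have VW: "low (\<phi> q V) (\<phi> q W)" by (rule reachable_trans)
    have gV: "G (\<phi> q V) = v @ s # last (G T) # i # []"
      using swap(2)[OF A(1), of v s i "last (G T)" "[]" q] V(2,3) len3[OF A(1) V(2)] by auto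
    have gW: "G (\<phi> q W) = w @ t # last (G T) # i # []"
      using swap(2)[OF A(2), of w t i "last (G T)" "[]" q] W(2,3) len3[OF A(2) W(2)] by auto
    have "low (\<phi> q (\<phi> q V)) (\<phi> q (\<phi> q W))"
      by (rule class_indep[OF q_in[OF A(1)] VW gV gW]) (use V(3) W(3) in auto)
    then have "low V W" using q_q A by simp
    then show ?thesis using V(1) low_sym[OF W(1) UA] reachable_trans by metis
  qed
  then show ?thesis using low_inj[OF assms(1)] assms(3) by blast
qed

end

section \<open>The model by Yamanouchi words\<close>

text \<open>Injectivity is demanded only within a class, because different classes of one shape
  carry the same words.\<close>

definition model :: "nat \<Rightarrow> 'a set \<Rightarrow> ('a \<Rightarrow> nat set) \<Rightarrow> (nat \<Rightarrow> 'a \<Rightarrow> 'a) \<Rightarrow> ('a \<Rightarrow> nat list) \<Rightarrow> bool" where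
  "model n A Des \<phi> F \<longleftrightarrow> (\<forall>T\<in>A. yamanouchi (F T) \<and> length (F T) = n
     \<and> (\<forall>j. 0 < j \<and> j < n \<longrightarrow> (j \<in> descents (F T) \<longleftrightarrow> j \<in> Des T))
     \<and> (\<forall>i. 2 \<le> i \<and> i < n \<longrightarrow> F (\<phi> i T) = knuth i (F T))
     \<and> (\<forall>S. reachable \<phi> {2..<n} T S \<and> F T = F S \<longrightarrow> T = S))"

lemma modelD:
  assumes "model n A Des \<phi> F" "T \<in> A"
  shows "yamanouchi (F T)" "length (F T) = n" "0 < j \<Longrightarrow> j < n \<Longrightarrow> j \<in> descents (F T) \<longleftrightarrow> j \<in> Des T"
    "2 \<le> i \<Longrightarrow> i < n \<Longrightarrow> F (\<phi> i T) = knuth i (F T)" "reachable \<phi> {2..<n} T S \<Longrightarrow> F T = F S \<Longrightarrow> T = S"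
  using assms unfolding model_def by blast+

lemma dual_less: "dual (Suc n) A Des \<phi> \<Longrightarrow> dual n A Des \<phi>"
  using dual_shift[of "Suc n" A Des \<phi> 0 n] by simp

lemma model_fold:
  assumes "dual n A Des \<phi>" "model n A Des \<phi> F" "set p \<subseteq> {2..<n}" "T \<in> A"
  shows "F (fold \<phi> p T) = fold knuth p (F T)"
  using assms(3,4)
proof (induction p arbitrary: T)
  case (Cons i p)
  then have i: "2 \<le> i" "i < n" "set p \<subseteq> {2..<n}" by auto
  show ?case using Cons.IH[OF i(3) dual.closed[OF assms(1) i(1,2) Cons.prems(2)]]
      modelD(4)[OF assms(2) Cons.prems(2) i(1,2)] by simp
qed simp

lemma model_reach:
  assumes "dual n A Des \<phi>" "model n A Des \<phi> F" "T \<in> A" "yamanouchi w" "mset w = mset (F T)"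
  obtains S where "S \<in> A" "reachable \<phi> {2..<n} T S" "F S = w"
proof -
  obtain p where p: "set p \<subseteq> {2..<n}" "fold knuth p (F T) = w"
    using yamanouchi_connected[OF modelD(1)[OF assms(2,3)] assms(4)] assms(5) modelD(2)[OF assms(2,3)] by auto
  show thesis
  proof (rule that)
    show "F (fold \<phi> p T) = w" using model_fold[OF assms(1,2) p(1) assms(3)] p(2) by simp
    show "fold \<phi> p T \<in> A" using dual.fold_in[OF assms(1) p(1) assms(3)] .
    show "reachable \<phi> {2..<n} T (fold \<phi> p T)" unfolding reachable_def using p(1) by blast
  qed
qed

lemma model_mset:
  assumes "dual n A Des \<phi>" "model n A Des \<phi> F" "T \<in> A" "reachable \<phi> {2..<n} T S"
  shows "mset (F S) = mset (F T)"
proof -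
  obtain p where p: "set p \<subseteq> {2..<n}" "fold \<phi> p T = S" using assms(4) unfolding reachable_def by blast
  then show ?thesis using model_fold[OF assms(1,2) p(1) assms(3)] foldK_props[of p "F T"]
      modelD(2)[OF assms(2,3)] by simp
qed

text \<open>On a class of the first \<open>n - 2\<close> involutions, the letter in position \<open>n + 1\<close> of the extended
  words is forced: it separates the corners after which \<open>n\<close> is a descent from the others.\<close>

lemma extension_exists:
  assumes "dual (Suc n) A Des \<phi>" "model n A Des \<phi> F" "T \<in> A"
  shows "\<exists>r. \<forall>S. reachable \<phi> {2..<n} T S \<longrightarrow>
    is_shape (add_mset r (mset (F S))) \<and> (0 < n \<longrightarrow> (n \<in> Des S \<longleftrightarrow> last (F S) < r))"
proof (cases "n = 0")
  case True
  have "is_shape (add_mset 0 (mset (F S)))" if "reachable \<phi> {2..<n} T S" for S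
    using yamanouchi_dec[OF modelD(1)[OF assms(2,3)]] model_mset[OF dual_less[OF assms(1)] assms(2,3) that]
      is_shape_add_iff[of "mset (F T)" 0] by simp
  then show ?thesis using True by blast
next
  case n0: False
  interpret dual "Suc n" A Des \<phi> by fact
  note dn = dual_less[OF assms(1)] and M = assms(2)
  have sub: "{2..<n} \<subseteq> {2..<Suc n}" by auto
  let ?C = "reachable \<phi> {2..<n} T"
  have CA: "S \<in> A" if "?C S" for S using reachable_in[OF that sub assms(3)] .
  have CC: "reachable \<phi> {2..<n} S S'" if "?C S" "?C S'" for S S'
    using reachable_trans[OF reachable_sym[OF that(1) sub assms(3)] that(2)] .
  let ?N = "mset (F T)"
  have mN: "mset (F S) = ?N" if "?C S" for S using model_mset[OF dn M assms(3) that] .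
  have dN: "is_shape ?N" using yamanouchi_dec[OF modelD(1)[OF M assms(3)]] .
  have ends: "\<exists>u. F S = u @ [last (F S)]" if "?C S" for S
    using modelD(2)[OF M CA[OF that]] n0 by (intro exI[of _ "butlast (F S)"]) (cases "F S" rule: rev_cases; auto)
  \<comment> \<open>Elements of the class with equal last letters are joined by involutions of index
    at most \<open>n - 2\<close>, and these leave bit \<open>n\<close> alone.\<close>
  have W: "n \<in> Des S \<longleftrightarrow> n \<in> Des S'" if h: "?C S" "?C S'" "last (F S) = last (F S')" for S S'
  proof -
    obtain u where u: "F S = u @ [last (F S)]" using ends[OF h(1)] by blast
    obtain u' where u': "F S' = u' @ [last (F S)]" using ends[OF h(2)] h(3) by metis
    have m: "mset u = mset u'" using mN[OF h(1)] mN[OF h(2)] u u'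
      by (metis add_mset_add_single add_mset_add_mset_same_iff mset.simps(1) mset.simps(2) mset_append)
    have y: "yamanouchi u" "yamanouchi u'" using modelD(1)[OF M CA[OF h(1)]] modelD(1)[OF M CA[OF h(2)]] u u' yamanouchi_appendD by metis+
    obtain p where p: "set p \<subseteq> {2..<length u}" "fold knuth p u = u'" using yamanouchi_connected[OF y m] by blast
    have l: "n = Suc (length u)" using modelD(2)[OF M CA[OF h(1)]] u by (metis length_append_singleton)
    have pn: "set p \<subseteq> {2..<n}" using order_trans[OF p(1), of "{2..<n}"] l by simp
    have "F (fold \<phi> p S) = fold knuth p (u @ [last (F S)])" using model_fold[OF dn M pn CA[OF h(1)]] u by simp
    also have "\<dots> = F S'" using foldK_append[OF p(1)] p(2) u' by simp
    finally have e: "F (fold \<phi> p S) = F S'" .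
    have c: "reachable \<phi> {2..<n} S (fold \<phi> p S)" unfolding reachable_def using pn by blast
    then have "?C (fold \<phi> p S)" using h(1) reachable_trans by metis
    then have eq: "fold \<phi> p S = S'" using modelD(5)[OF M CA CC[OF _ h(2)] e] by blast
    have "n \<in> Des (fold \<phi> p R) \<longleftrightarrow> n \<in> Des R" if "R \<in> A" for R
      using p(1) that
    proof (induction p arbitrary: R)
      case (Cons i p)
      then have i: "2 \<le> i" "i < length u" "set p \<subseteq> {2..<length u}" by auto
      then have i2: "i < Suc n" "i + 2 \<le> n" using l by auto
      have "n \<in> Des (\<phi> i R) \<longleftrightarrow> n \<in> Des R"
        using phi_far[OF i(1) i2(1) _ _ _ Cons.prems(2), of n] i2 n0 by simp
      then show ?case using Cons.IH[OF i(3) closed[OF i(1) i2(1) Cons.prems(2)]] by simp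
    qed simp
    then show ?thesis using eq CA[OF h(1)] by metis
  qed
  \<comment> \<open>If this failed, exchanging the last letters \<open>c < c'\<close> by
    \<open>\<phi> (n - 1)\<close> would change bit \<open>n\<close>, so
    \<open>\<phi> (n - 1)\<close> would agree with \<open>\<phi> n\<close> on \<open>R\<close>. But
    \<open>\<phi> n\<close> fixes \<open>R\<close>, whose bits \<open>n - 1\<close> and
    \<open>n\<close> are both set.\<close>
  have mono: False if h: "?C S" "?C S'" "last (F S) < last (F S')" "n \<notin> Des S" "n \<in> Des S'" for S S'
  proof -
    obtain u c where u: "F S = u @ [c]" using ends[OF h(1)] by blast
    obtain u' c' where u': "F S' = u' @ [c']" using ends[OF h(2)] by blast
    have cc: "c < c'" using h(3) u u' by simp
    have m: "?N = add_mset c (mset u)" "?N = add_mset c' (mset u')" using mN[OF h(1)] mN[OF h(2)] u u' by simp_all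
    have y: "yamanouchi (u @ [c])" "yamanouchi (u' @ [c'])" using modelD(1)[OF M CA[OF h(1)]] modelD(1)[OF M CA[OF h(2)]] u u' by simp_all
    define L where "L = mset u - {#c'#}"
    have "c' \<in># mset u" using m cc by (metis insert_noteq_member nat_less_le union_single_eq_member)
    then have mu: "mset u = add_mset c' L" unfolding L_def by simp
    have mu': "mset u' = add_mset c L" using m unfolding mu by (metis add_mset_add_mset_same_iff add_mset_commute)
    have d: "is_shape (add_mset c' L)" "is_shape (add_mset c L)"
      using yamanouchi_dec[OF yamanouchi_appendD[OF y(1)]] yamanouchi_dec[OF yamanouchi_appendD[OF y(2)]] mu mu' by simp_all
    have dL: "is_shape L" using is_shape_add_mono[OF d] cc by simp
    define s where "s = c' - 1"
    have s: "c \<le> s" "s < c'" using cc by (auto simp: s_def)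
    obtain z where z: "yamanouchi (z @ [s])" "mset (z @ [s]) = L"
      using ex_yam_snoc[OF dL] corner_below_addable[OF dL d(1) cc] unfolding s_def by blast
    have NN: "?N = add_mset c' (add_mset c L)" using m(1) unfolding mu by simp
    have yz: "yamanouchi (((z @ [s]) @ [c]) @ [c'])"
    proof -
      have e: "mset ((z @ [s]) @ [c]) = add_mset c L" using z(2) by simp
      have "yamanouchi ((z @ [s]) @ [c])" unfolding yamanouchi_snoc[of "z @ [s]"] z(2) using z(1) d(2) by blast
      then show ?thesis unfolding yamanouchi_snoc[of "(z @ [s]) @ [c]"] e using dN NN by simp
    qed
    have mz: "mset (((z @ [s]) @ [c]) @ [c']) = mset (F T)" using z(2) NN by simp
    obtain R where R: "R \<in> A" "?C R" "F R = ((z @ [s]) @ [c]) @ [c']"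
      using model_reach[OF dn M assms(3) yz mz] by blast
    have l: "n = length z + 3" using modelD(2)[OF M R(1)] R(3) by simp
    have i: "2 \<le> n - 1" "n - 1 < n" "n - 1 < Suc n" "n - 1 + 1 = n" using l by auto
    have nR: "n \<in> Des R" using W[OF R(2) h(2)] h(5) R(3) u' by simp
    have FR: "F (\<phi> (n - 1) R) = z @ [s, c', c]"
      using modelD(4)[OF M R(1) i(1,2)] R(3) knuth_app'[of "n - 1" z s c c' "[]"] l knuth3_between_fst[of c' s c] s by simp
    have "?C (\<phi> (n - 1) R)" using R(2) reachable_step[of "n - 1" "{2..<n}" \<phi> R] i reachable_trans by (metis atLeastLessThan_iff)
    then have nQ: "n \<notin> Des (\<phi> (n - 1) R)" using W[OF _ h(1)] FR h(4) u by simp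
    have "\<phi> (n - 1) R = \<phi> n R" using phi_pair(1)[OF i(1) _ R(1)] nR nQ i(4) by simp
    moreover have "n - 1 \<in> Des R"
      using modelD(3)[OF M R(1), of "n - 1"] R(3) descents_nth1[of "n - 1" z s c c' "[]"] l cc i by simp
    then have "\<phi> n R = R" using phi_bits(1)[of n R] R(1) nR l by simp
    ultimately have "F (\<phi> (n - 1) R) = F R" by simp
    then show False using FR R(3) cc by simp
  qed
  show ?thesis
  proof (cases "\<exists>S. ?C S \<and> n \<in> Des S")
    case False
    have "is_shape (add_mset 0 ?N)" using is_shape_add_iff[OF dN, of 0] by simp
    then have "is_shape (add_mset 0 (mset (F S))) \<and> (0 < n \<longrightarrow> (n \<in> Des S \<longleftrightarrow> last (F S) < 0))" if "?C S" for S
      unfolding mN[OF that] using False that by blast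
    then show ?thesis by blast
  next
    case True
    let ?D = "{S. ?C S \<and> n \<in> Des S}"
    have fin: "finite ?D" using CA by (intro finite_subset[OF _ finA]) auto
    \<comment> \<open>The largest last letter followed by a descent. It is a corner, so the next row
      is addable, and that row is the letter sought.\<close>
    define c where "c = Max ((\<lambda>S. last (F S)) ` ?D)"
    have "c \<in> (\<lambda>S. last (F S)) ` ?D" unfolding c_def using fin True by (intro Max_in) auto
    then obtain S0 where S0: "?C S0" "n \<in> Des S0" "last (F S0) = c" by auto
    have mx: "last (F S) \<le> c" if "?C S" "n \<in> Des S" for S unfolding c_def using fin that by (intro Max_ge) auto
    obtain u where u: "F S0 = u @ [c]" using ends[OF S0(1)] S0(3) by metis
    have "count ?N (Suc c) < count ?N c"
      by (rule corner_last[of u]) (use modelD(1)[OF M CA[OF S0(1)]] u mN[OF S0(1)] in simp_all)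
    then have d: "is_shape (add_mset (Suc c) ?N)" unfolding is_shape_add_iff[OF dN] by simp
    have "n \<in> Des S \<longleftrightarrow> last (F S) < Suc c" if S: "?C S" for S
    proof
      assume "last (F S) < Suc c"
      then consider "last (F S) = c" | "last (F S) < c" by linarith
      then show "n \<in> Des S"
      proof cases
        case 1
        then show ?thesis using W[OF S S0(1)] S0 by simp
      next
        case 2
        then show ?thesis using mono[OF S S0(1)] S0 by auto
      qed
    qed (use mx[OF S] in simp)
    then have "is_shape (add_mset (Suc c) (mset (F S))) \<and> (0 < n \<longrightarrow> (n \<in> Des S \<longleftrightarrow> last (F S) < Suc c))" if "?C S" for S
      unfolding mN[OF that] using d that by blast
    then show ?thesis by blast
  qed
qed

lemma extend:
  assumes "dual (Suc n) A Des \<phi>" "model n A Des \<phi> F"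
  obtains G where "\<And>T. T \<in> A \<Longrightarrow> yamanouchi (G T)" "\<And>T. T \<in> A \<Longrightarrow> length (G T) = Suc n"
    "\<And>T j. T \<in> A \<Longrightarrow> 0 < j \<Longrightarrow> j \<le> n \<Longrightarrow> j \<in> descents (G T) \<longleftrightarrow> j \<in> Des T"
    "\<And>T i. T \<in> A \<Longrightarrow> 2 \<le> i \<Longrightarrow> i < n \<Longrightarrow> G (\<phi> i T) = knuth i (G T)"
    "\<And>T S. T \<in> A \<Longrightarrow> reachable \<phi> {2..<n} T S \<Longrightarrow> G T = G S \<Longrightarrow> T = S"
proof -
  interpret dual "Suc n" A Des \<phi> by fact
  note M = assms(2)
  have sub: "{2..<n} \<subseteq> {2..<Suc n}" by auto
  \<comment> \<open>The property depends only on the class of \<open>T\<close>, so the chosen letter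
    is constant on classes; \<open>rc\<close> relies on this.\<close>
  define r where "r T = (SOME r. \<forall>S. reachable \<phi> {2..<n} T S \<longrightarrow>
    is_shape (add_mset r (mset (F S))) \<and> (0 < n \<longrightarrow> (n \<in> Des S \<longleftrightarrow> last (F S) < r)))" for T
  have r: "is_shape (add_mset (r T) (mset (F S))) \<and> (0 < n \<longrightarrow> (n \<in> Des S \<longleftrightarrow> last (F S) < r T))"
    if "T \<in> A" "reachable \<phi> {2..<n} T S" for T S
    using someI_ex[OF extension_exists[OF assms that(1)]] that(2) unfolding r_def by blast
  have rc: "r T = r S" if "T \<in> A" "reachable \<phi> {2..<n} T S" for T S
  proof -
    have "reachable \<phi> {2..<n} T = reachable \<phi> {2..<n} S"
      using reachable_trans[OF that(2)] reachable_trans[OF reachable_sym[OF that(2) sub that(1)]] by (intro ext) blast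
    then show ?thesis unfolding r_def by simp
  qed
  let ?G = "\<lambda>T. F T @ [r T]"
  show thesis
  proof (rule that[of ?G])
    fix T assume T: "T \<in> A"
    have c0: "reachable \<phi> {2..<n} T T" by (rule reachable_refl)
    show "yamanouchi (F T @ [r T])" using modelD(1)[OF M T] r[OF T c0] by simp
    show "length (F T @ [r T]) = Suc n" using modelD(2)[OF M T] by simp
    show "j \<in> descents (F T @ [r T]) \<longleftrightarrow> j \<in> Des T" if j: "0 < j" "j \<le> n" for j
    proof (cases "j < n")
      case True
      then show ?thesis using descents_append[of j "F T" "[r T]"] modelD(2,3)[OF M T] j by simp
    next
      case False
      then have j: "j = n" "0 < n" using j by auto
      obtain u x where u: "F T = u @ [x]" using modelD(2)[OF M T] j by (cases "F T" rule: rev_cases) auto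
      have "n \<in> descents (u @ x # r T # []) \<longleftrightarrow> x < r T"
        using descents_nth[of n u x "r T" "[]"] modelD(2)[OF M T] u by simp
      then show ?thesis using r[OF T c0] u j by simp
    qed
    show "F (\<phi> i T) @ [r (\<phi> i T)] = knuth i (F T @ [r T])" if i: "2 \<le> i" "i < n" for i
    proof -
      have "reachable \<phi> {2..<n} T (\<phi> i T)" using i by (intro reachable_step) simp
      then have "r (\<phi> i T) = r T" using rc[OF T] by simp
      then show ?thesis using modelD(4)[OF M T i] knuth_append[OF i(1), of "F T" "[r T]"] modelD(2)[OF M T] i by simp
    qed
    show "T = S" if "reachable \<phi> {2..<n} T S" "F T @ [r T] = F S @ [r S]" for S
      using modelD(5)[OF M T that(1)] that(2) by simp
  qed
qed

text \<open>Equal words under \<open>G\<close> give equal descents along all paths of the window. By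
  \<open>descents_paths_unique\<close> the words in the window model are then equal, and that model
  is injective on its classes.\<close>

lemma window_inj:
  assumes "dual n A Des \<phi>" "k + m \<le> n" "model m A (\<lambda>T. {j. j + k \<in> Des T}) (\<lambda>i. \<phi> (i + k)) H"
    and Gds: "\<And>T j. T \<in> A \<Longrightarrow> 0 < j \<Longrightarrow> j < n \<Longrightarrow> j \<in> descents (G T) \<longleftrightarrow> j \<in> Des T"
    and Geq: "\<And>T i. T \<in> A \<Longrightarrow> 2 \<le> i \<Longrightarrow> i < n \<Longrightarrow> G (\<phi> i T) = knuth i (G T)"
    and T: "T \<in> A" "reachable \<phi> {k + 2..<k + m} T S" "G T = G S"
  shows "T = S"
proof -
  note dm = dual_shift[OF assms(1,2)] and M = assms(3)
  have sub: "{k + 2..<k + m} \<subseteq> {2..<n}" using assms(2) by auto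
  have SA: "S \<in> A" using dual.reachable_in[OF assms(1) T(2) sub T(1)] .
  have Gf: "G (fold \<phi> p U) = fold knuth p (G U)" if "set p \<subseteq> {2..<n}" "U \<in> A" for p U
    using that
  proof (induction p arbitrary: U)
    case (Cons i p)
    then have i: "2 \<le> i" "i < n" "set p \<subseteq> {2..<n}" by auto
    show ?case using Cons.IH[OF i(3) dual.closed[OF assms(1) i(1,2) Cons.prems(2)]] Geq[OF Cons.prems(2) i(1,2)] by simp
  qed simp
  have key: "j \<in> descents (fold knuth p (H U)) \<longleftrightarrow> j + k \<in> descents (fold knuth (map (\<lambda>i. i + k) p) (G U))"
    if h: "set p \<subseteq> {2..<m}" "U \<in> A" "0 < j" "j < m" for p U j
  proof -
    have s: "set (map (\<lambda>i. i + k) p) \<subseteq> {2..<n}" using h(1) assms(2) by auto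
    have A: "fold \<phi> (map (\<lambda>i. i + k) p) U \<in> A" by (rule dual.fold_in[OF assms(1) s h(2)])
    have "fold knuth p (H U) = H (fold \<phi> (map (\<lambda>i. i + k) p) U)"
      using model_fold[OF dm M h(1,2)] unfolding fold_shift by simp
    then have "j \<in> descents (fold knuth p (H U)) \<longleftrightarrow> j + k \<in> Des (fold \<phi> (map (\<lambda>i. i + k) p) U)"
      using modelD(3)[OF M A h(3,4)] by simp
    then show ?thesis using Gds[OF A, of "j + k"] Gf[OF s h(2)] h assms(2) by simp
  qed
  have "H T = H S"
  proof (rule descents_paths_unique)
    show "yamanouchi (H T)" "yamanouchi (H S)" "length (H T) = m" "length (H S) = m" using modelD(1,2)[OF M] T(1) SA by blast+
    fix p assume p: "set p \<subseteq> {2..<m}"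
    have lt: "0 < j \<and> j < m" if "j \<in> descents (fold knuth p (H U))" "U \<in> A" for j U
      using descents_lt[OF that(1)] foldK_props[of p "H U"] p modelD(2)[OF M that(2)] by simp
    show "descents (fold knuth p (H T)) = descents (fold knuth p (H S))"
    proof (intro set_eqI)
      fix j
      show "j \<in> descents (fold knuth p (H T)) \<longleftrightarrow> j \<in> descents (fold knuth p (H S))"
      proof (cases "0 < j \<and> j < m")
        case True
        then show ?thesis using key[OF p T(1)] key[OF p SA] T(3) by simp
      next
        case False
        then show ?thesis using lt[OF _ T(1)] lt[OF _ SA] by metis
      qed
    qed
  qed
  moreover have "reachable (\<lambda>i. \<phi> (i + k)) {2..<m} T S"
    unfolding reachable_shift using T(2) by (simp add: add.commute)
  ultimately show ?thesis using modelD(5)[OF M T(1)] by blast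
qed

text \<open>By the hypothesis on classes of at most six entries, the descent set of the sorted word
  of shape \<open>N\<close> occurs exactly once in the class. A path from \<open>T\<close> to that
  element also takes \<open>S\<close> to it, because the words under \<open>G\<close>, and so the
  descents, remain equal.\<close>

lemma small_inj:
  assumes "dual n A Des \<phi>" "3 \<le> n" "n \<le> 6"
    and G: "\<And>T. T \<in> A \<Longrightarrow> yamanouchi (G T)" "\<And>T. T \<in> A \<Longrightarrow> length (G T) = n"
    and Gds: "\<And>T j. T \<in> A \<Longrightarrow> 0 < j \<Longrightarrow> j < n \<Longrightarrow> j \<in> descents (G T) \<longleftrightarrow> j \<in> Des T"
    and Geq: "\<And>T i. T \<in> A \<Longrightarrow> 2 \<le> i \<Longrightarrow> i < n \<Longrightarrow> G (\<phi> i T) = knuth i (G T)"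
    and T: "T \<in> A" "reachable \<phi> {2..<n} T S" "G T = G S"
  shows "T = S"
proof -
  interpret dual n A Des \<phi> by fact
  have Gf: "G (fold \<phi> p U) = fold knuth p (G U)" if "set p \<subseteq> {2..<n}" "U \<in> A" for p U
    using that
  proof (induction p arbitrary: U)
    case (Cons i p)
    then have i: "2 \<le> i" "i < n" "set p \<subseteq> {2..<n}" by auto
    show ?case using Cons.IH[OF i(3) closed[OF i(1,2) Cons.prems(2)]] Geq[OF Cons.prems(2) i(1,2)] by simp
  qed simp
  have w: "window_des Des 0 n U = descents (G U)" if "U \<in> A" for U
  proof (intro set_eqI)
    fix j
    show "j \<in> window_des Des 0 n U \<longleftrightarrow> j \<in> descents (G U)"
    proof (cases "0 < j \<and> j < n")
      case True
      then show ?thesis using Gds[OF that, of j] by (simp add: window_des_def)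
    next
      case False
      then show ?thesis using descents_lt[of j "G U"] G(2)[OF that] unfolding window_des_def by auto
    qed
  qed
  obtain N where N': "is_shape N \<and> size N = n \<and>
      (\<forall>E. card {U. reachable \<phi> {2..<n} T U \<and> window_des Des 0 n U = E} = card {w \<in> yam_words N. descents w = E})"
    using loc[OF assms(2,3), of 0 T, unfolded add_0, OF le_refl T(1)] by (elim exE)
  have N: "is_shape N" using N' by (rule conjunct1)
  have NE: "card {U. reachable \<phi> {2..<n} T U \<and> window_des Des 0 n U = E} = card {w \<in> yam_words N. descents w = E}" for E
    using N' by (elim conjE allE)
  obtain u where u: "yamanouchi u" "mset u = N" using ex_yam[OF N] by blast
  have yN: "{w \<in> yam_words N. descents w = descents (sort u)} = {sort u}"
  proof (intro equalityI subsetI)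
    fix w assume w: "w \<in> {w \<in> yam_words N. descents w = descents (sort u)}"
    have "w = sort u"
      by (rule descents_sort_unique[OF u(1)]) (use w u(2) in \<open>simp_all add: yam_words_def\<close>)
    then show "w \<in> {sort u}" by simp
  qed (use yamanouchi_sort_mset[OF u(1)] u(2) in \<open>simp add: yam_words_def\<close>)
  have "card {U. reachable \<phi> {2..<n} T U \<and> window_des Des 0 n U = descents (sort u)} = 1" unfolding NE yN by simp
  then obtain U0 where U0: "{U. reachable \<phi> {2..<n} T U \<and> window_des Des 0 n U = descents (sort u)} = {U0}"
    by (rule card_1_singletonE)
  then have "U0 \<in> {U. reachable \<phi> {2..<n} T U \<and> window_des Des 0 n U = descents (sort u)}" by simp
  then have c0: "reachable \<phi> {2..<n} T U0" "window_des Des 0 n U0 = descents (sort u)" by simp_all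
  obtain p where p: "set p \<subseteq> {2..<n}" "fold \<phi> p T = U0" using c0(1) unfolding reachable_def by blast
  have SA: "S \<in> A" using reachable_in[OF T(2) _ T(1)] by simp
  let ?U1 = "fold \<phi> p S"
  have A: "?U1 \<in> A" "U0 \<in> A" using fold_in[OF p(1) SA] fold_in[OF p(1) T(1)] p(2) by simp_all
  have "reachable \<phi> {2..<n} S ?U1" unfolding reachable_def using p(1) by blast
  then have "reachable \<phi> {2..<n} T ?U1" using T(2) reachable_trans by metis
  moreover have "window_des Des 0 n ?U1 = descents (sort u)"
  proof -
    have "G ?U1 = G U0" using Gf[OF p(1) SA] Gf[OF p(1) T(1)] unfolding p(2) T(3) by simp
    then show ?thesis using w[OF A(1)] w[OF A(2)] c0(2) by simp
  qed
  ultimately have "?U1 \<in> {U0}" unfolding U0[symmetric] by simp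
  then have "fold \<phi> p S = fold \<phi> p T" using p(2) by simp
  then show ?thesis using fold_rev[OF p(1) SA] fold_rev[OF p(1) T(1)] by metis
qed

text \<open>Strong induction with \<open>Des\<close> and \<open>\<phi>\<close> arbitrary: besides
  the model of size \<open>q\<close>, sizes above six use a model of a shifted window of six
  entries.\<close>

theorem model_exists: "dual n A Des \<phi> \<Longrightarrow> \<exists>F. model n A Des \<phi> F"
proof (induction n arbitrary: Des \<phi> rule: less_induct)
  case (less n)
  show ?case
  proof (cases n)
    case 0
    then show ?thesis unfolding model_def reachable_def by (intro exI[of _ "\<lambda>_. []"]) auto
  next
    case (Suc q)
    have d: "dual (Suc q) A Des \<phi>" using less.prems Suc by simp
    obtain F where F: "model q A Des \<phi> F" using less.IH[of q] dual_less[OF d] Suc by blast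
    show ?thesis
    proof (rule extend[OF d F])
      fix G assume G: "\<And>T. T \<in> A \<Longrightarrow> yamanouchi (G T)" "\<And>T. T \<in> A \<Longrightarrow> length (G T) = Suc q"
        "\<And>T j. T \<in> A \<Longrightarrow> 0 < j \<Longrightarrow> j \<le> q \<Longrightarrow> j \<in> descents (G T) \<longleftrightarrow> j \<in> Des T"
        "\<And>T i. T \<in> A \<Longrightarrow> 2 \<le> i \<Longrightarrow> i < q \<Longrightarrow> G (\<phi> i T) = knuth i (G T)"
        "\<And>T S. T \<in> A \<Longrightarrow> reachable \<phi> {2..<q} T S \<Longrightarrow> G T = G S \<Longrightarrow> T = S"
      show ?thesis
      proof (cases "2 \<le> q")
        case False
        then have e: "{2..<Suc q} = {}" by simp
        have "model (Suc q) A Des \<phi> G" unfolding model_def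
        proof (intro ballI conjI allI impI)
          fix T assume T: "T \<in> A"
          show "yamanouchi (G T)" "length (G T) = Suc q" using G(1,2) T by blast+
          show "j \<in> descents (G T) \<longleftrightarrow> j \<in> Des T" if "0 < j \<and> j < Suc q" for j using G(3)[OF T, of j] that by simp
          show "G (\<phi> i T) = knuth i (G T)" if "2 \<le> i \<and> i < Suc q" for i using False that by simp
          show "T = S" if "reachable \<phi> {2..<Suc q} T S \<and> G T = G S" for S using that unfolding reachable_def e by auto
        qed
        then show ?thesis using Suc by blast
      next
        case True
        have ax: "lift_axioms q A Des \<phi> G"
          by (rule lift_axioms.intro[OF True G(1,2) G(3) G(4)])
        interpret L: lift q A Des \<phi> G
          by (rule lift.intro[OF d ax])
        have Gds: "j \<in> descents (G T) \<longleftrightarrow> j \<in> Des T" if "T \<in> A" "0 < j" "j < Suc q" for T j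
          using G(3)[OF that(1,2)] that(3) by simp
        have Geq: "G (\<phi> i T) = knuth i (G T)" if "T \<in> A" "2 \<le> i" "i < Suc q" for T i
          using G(4)[OF that(1,2)] L.G_q[OF that(1)] that(3) by (cases "i = q") auto
        have inj: "T = S" if T: "T \<in> A" "reachable \<phi> {2..<Suc q} T S" "G T = G S" for T S
        proof (cases "Suc q \<le> 6")
          case le: True
          show ?thesis
            by (rule small_inj[OF d _ le G(1,2) Gds Geq T]) (use True in simp_all)
        next
          case False
          \<comment> \<open>The last six of the \<open>q + 1\<close> entries are those after entry
            \<open>k\<close>; their involutions are \<open>\<phi> (q - 3)\<close> to
            \<open>\<phi> q\<close>.\<close>
          define k where "k = q - 5"
          have k: "k + 6 = Suc q" using False k_def by simp
          obtain H where H: "model 6 A (\<lambda>T. {j. j + k \<in> Des T}) (\<lambda>i. \<phi> (i + k)) H"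
          proof -
            have "6 < n" "k + 6 \<le> Suc q" using k Suc False by auto
            then show thesis using less.IH[OF _ dual_shift[OF d]] that by blast
          qed
          have "{k + 2..<k + 6} = {q - 3..q}" using k by auto
          then have window_des: "T = S" if "T \<in> A" "reachable \<phi> {q - 3..q} T S" "G T = G S" for T S
          proof -
            have "k + 6 \<le> Suc q" "reachable \<phi> {k + 2..<k + 6} T S"
              using k that(2) \<open>{k + 2..<k + 6} = {q - 3..q}\<close> by simp_all
            then show ?thesis using window_inj[OF d _ H Gds Geq that(1) _ that(3)] by blast
          qed
          have q6: "6 \<le> q" using False by linarith
          have ax': "lift_inj_axioms q A \<phi> G"
            by (rule lift_inj_axioms.intro[OF G(5) window_des q6])
          interpret LI: lift_inj q A Des \<phi> G
            by (rule lift_inj.intro[OF lift.intro[OF d ax] ax'])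
          show ?thesis by (rule LI.G_inj[OF T])
        qed
        have "model (Suc q) A Des \<phi> G" unfolding model_def
        proof (intro ballI conjI allI impI)
          fix T assume T: "T \<in> A"
          show "yamanouchi (G T)" "length (G T) = Suc q" using G(1,2) T by blast+
          show "j \<in> descents (G T) \<longleftrightarrow> j \<in> Des T" if "0 < j \<and> j < Suc q" for j using Gds[OF T] that by blast
          show "G (\<phi> i T) = knuth i (G T)" if "2 \<le> i \<and> i < Suc q" for i using Geq[OF T] that by blast
          show "T = S" if "reachable \<phi> {2..<Suc q} T S \<and> G T = G S" for S using inj[OF T] that by blast
        qed
        then show ?thesis using Suc by blast
      qed
    qed
  qed
qed

section \<open>Dominance\<close>

lemma eq_class_conn:
  assumes "\<And>i T. i \<in> I \<Longrightarrow> T \<in> A \<Longrightarrow> \<phi> i T \<in> A" "T \<in> A"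
  shows "eq_class A \<phi> I T = {U. reachable \<phi> I T U}"
proof (intro equalityI subsetI)
  fix U assume "U \<in> eq_class A \<phi> I T"
  then have "(T, U) \<in> (gen_rel A \<phi> I)\<^sup>*" by (simp add: eq_class_def)
  then show "U \<in> {U. reachable \<phi> I T U}"
  proof (induction rule: rtrancl_induct)
    case (step V W)
    from step.hyps(2) obtain j where j: "j \<in> I" "W = \<phi> j V" unfolding gen_rel_def by blast
    have "reachable \<phi> I T V" using step.IH by simp
    then have "reachable \<phi> I T (\<phi> j V)" using reachable_step[OF j(1)] by (rule reachable_trans)
    then show ?case using j(2) by simp
  qed simp
next
  fix U assume "U \<in> {U. reachable \<phi> I T U}"
  then obtain p where p: "set p \<subseteq> I" "fold \<phi> p T = U" unfolding reachable_def by blast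
  have "(T, fold \<phi> p T) \<in> (gen_rel A \<phi> I)\<^sup>*" using p(1) assms(2)
  proof (induction p arbitrary: T)
    case (Cons i p)
    then have i: "i \<in> I" "T \<in> A" "set p \<subseteq> I" by auto
    have "(T, \<phi> i T) \<in> gen_rel A \<phi> I" unfolding gen_rel_def using i(1,2) by blast
    moreover have "(\<phi> i T, fold \<phi> p (\<phi> i T)) \<in> (gen_rel A \<phi> I)\<^sup>*"
      using Cons.IH[OF i(3) assms(1)[OF i(1,2)]] .
    ultimately have "(T, fold \<phi> p (\<phi> i T)) \<in> (gen_rel A \<phi> I)\<^sup>*" by (rule converse_rtrancl_into_rtrancl)
    then show ?case by simp
  qed simp
  then show "U \<in> eq_class A \<phi> I T" using p(2) by (simp add: eq_class_def)
qed

lemma Des_hi_win: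
  assumes "3 \<le> m"
  shows "Des_hi Des (k + 2) (k + m - 1) U = window_des Des k m U"
proof (intro equalityI subsetI)
  fix j assume "j \<in> Des_hi Des (k + 2) (k + m - 1) U"
  then show "j \<in> window_des Des k m U" using assms by (auto simp: Des_hi_def window_des_def)
next
  fix j assume "j \<in> window_des Des k m U"
  then have "j + k \<in> Des U \<inter> {k + 2 - 1..k + m - 1}" "j = j + k - (k + 2 - 2)"
    using assms by (auto simp: window_des_def)
  then show "j \<in> Des_hi Des (k + 2) (k + m - 1) U" unfolding Des_hi_def by blast
qed

lemma yam_words_length: "w \<in> yam_words M \<Longrightarrow> length w = size M"
  by (auto simp: yam_words_def)

lemma descents_sub: "length w = n \<Longrightarrow> descents w \<subseteq> {0<..<n}"
  by (auto simp: descents_def)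

lemma dual_equivalence_dual:
  assumes "finite A" "involutions_on n A \<phi>" "dual_equivalence n A Des \<phi>"
  shows "dual n A Des \<phi>"
proof
  show cl: "\<phi> i T \<in> A" if "2 \<le> i" "i < n" "T \<in> A" for i T
    using assms(2) that unfolding involutions_on_def by simp
  show "\<phi> i (\<phi> i T) = T" if "2 \<le> i" "i < n" "T \<in> A" for i T
    using assms(2) that unfolding involutions_on_def by simp
  show "\<phi> i (\<phi> j T) = \<phi> j (\<phi> i T)" if "2 \<le> i" "i + 3 \<le> j" "j < n" "T \<in> A" for i j T
  proof -
    have "1 < i" "i < n" "1 < j" using that by auto
    then show ?thesis using assms(3) that unfolding dual_equivalence_def by blast
  qed
  fix m k T assume h: "3 \<le> m" "m \<le> (6::nat)" "k + m \<le> n" "T \<in> A"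
  \<comment> \<open>The involutions of the window after entry \<open>k\<close> have the indices
    \<open>k + 2\<close> to \<open>k + m - 1\<close>, so \<open>i - h' \<le> 3\<close> corresponds
    to \<open>m \<le> 6\<close>.\<close>
  define h' i where "h' = k + 2" and "i = k + m - 1"
  have hi: "1 < h'" "h' \<le> i" "i < n" "i - h' \<le> 3" "i - h' + 3 = m" using h by (auto simp: h'_def i_def)
  have I: "{h'..i} = {k + 2..<k + m}" using h by (auto simp: h'_def i_def)
  have "\<exists>la. la \<in> partitions (i - h' + 3) \<and>
      (\<forall>a. (\<Sum>U\<in>eq_class A \<phi> {h'..i} T. Qcoef (i - h' + 3) (Des_hi Des h' i U) a) = schur_coef la a)"
    using assms(3) hi(1-4) h(4) unfolding dual_equivalence_def by blast
  then obtain la where la: "la \<in> partitions m"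
    "\<And>a. (\<Sum>U\<in>eq_class A \<phi> {h'..i} T. Qcoef m (Des_hi Des h' i U) a) = schur_coef la a"
    unfolding hi(5) by blast
  have D: "Des_hi Des h' i = window_des Des k m" by (rule ext) (simp add: h'_def i_def Des_hi_win[OF h(1), simplified])
  have E: "eq_class A \<phi> {k + 2..<k + m} T = {U. reachable \<phi> {k + 2..<k + m} T U}"
    by (rule eq_class_conn) (use cl h in auto)
  let ?X = "{U. reachable \<phi> {k + 2..<k + m} T U}"
  have XA: "?X \<subseteq> A"
  proof
    fix U assume "U \<in> ?X"
    then obtain p where p: "set p \<subseteq> {k + 2..<k + m}" "fold \<phi> p T = U" unfolding reachable_def by blast
    have "fold \<phi> p T \<in> A" using p(1) h(4)
    proof (induction p arbitrary: T)
      case (Cons i p)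
      then show ?case using cl[of i T] h(3) by simp
    qed simp
    then show "U \<in> A" using p(2) by simp
  qed
  have ip: "is_partition la" and sl: "sum_list la = m" using la(1) by (auto simp: partitions_def)
  have "card {U \<in> ?X. window_des Des k m U = F} = card {w \<in> yam_words (shape_of la). descents w = F}" for F
  proof (rule Qcoef_independent)
    show "finite ?X" using XA assms(1) by (rule finite_subset)
    show "window_des Des k m U \<subseteq> {0<..<m}" for U by (auto simp: window_des_def)
    show "descents w \<subseteq> {0<..<m}" if "w \<in> yam_words (shape_of la)" for w
      by (rule descents_sub) (simp add: yam_words_length[OF that] sl size_shp)
    show "(\<Sum>U\<in>?X. Qcoef m (window_des Des k m U) a) = (\<Sum>w\<in>yam_words (shape_of la). Qcoef m (descents w) a)" for a
      using la(2)[of a] schur_coef_eq[OF ip, of a] unfolding I D E sl by simp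
  qed simp
  then have "\<forall>F. card {U. reachable \<phi> {k + 2..<k + m} T U \<and> window_des Des k m U = F} = card {w \<in> yam_words (shape_of la). descents w = F}"
    by simp
  moreover have "is_shape (shape_of la)" "size (shape_of la) = m" using is_shape_shp[OF ip] size_shp sl by simp_all
  ultimately show "\<exists>M. is_shape M \<and> size M = m \<and>
      (\<forall>E. card {U. reachable \<phi> {k + 2..<k + m} T U \<and> window_des Des k m U = E} = card {w \<in> yam_words M. descents w = E})" by blast
qed (use assms in auto)

section \<open>Partial sums of descent compositions, and dominance\<close>

definition alpha_sum :: "nat \<Rightarrow> nat set \<Rightarrow> nat \<Rightarrow> nat" where
  "alpha_sum n D j = (0 # sorted_list_of_set D @ [n]) ! min j (Suc (card D))"

text \<open>The differences telescope; \<open>min\<close> accounts for \<open>take\<close> beyond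
  the end of the list.\<close>

lemma sum_diffs:
  "sorted (x # xs) \<Longrightarrow> (x :: nat) + sum_list (take j (map2 (-) xs (x # xs))) = (x # xs) ! min j (length xs)"
proof (induction xs arbitrary: x j)
  case (Cons y ys)
  show ?case
  proof (cases j)
    case (Suc i)
    have "y + sum_list (take i (map2 (-) ys (y # ys))) = (y # ys) ! min i (length ys)"
      using Cons by simp
    moreover have "x + (y - x + S) = y + S" for S :: nat using Cons.prems by simp
    ultimately show ?thesis using Suc by simp
  qed simp
qed simp

lemma alpha_diffs: "alpha n D = map2 (-) (sorted_list_of_set D @ [n]) (0 # sorted_list_of_set D @ [n])"
proof -
  have "zip (xs @ [n]) (0 # xs) = zip (xs @ [n]) (0 # xs @ [n])" for xs :: "nat list"
    by (rule nth_equalityI) (auto simp: nth_append nth_Cons split: nat.splits)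
  then show ?thesis by (simp add: alpha_def Let_def)
qed

lemma sum_alpha:
  assumes "D \<subseteq> {0<..<n}"
  shows "sum_list (take j (alpha n D)) = alpha_sum n D j"
proof -
  have "finite D" using assms by (rule finite_subset) simp
  then have "sorted (0 # sorted_list_of_set D @ [n])" using assms by (auto simp: sorted_append)
  then show ?thesis using sum_diffs[of 0 "sorted_list_of_set D @ [n]" j] \<open>finite D\<close>
    by (simp add: alpha_diffs alpha_sum_def)
qed

lemma alpha_sum_simps:
  assumes "D \<subseteq> {0<..<n}"
  shows "alpha_sum n D 0 = 0" "1 \<le> j \<Longrightarrow> j \<le> card D \<Longrightarrow> alpha_sum n D j = sorted_list_of_set D ! (j - 1)"
    "card D < j \<Longrightarrow> alpha_sum n D j = n" "1 \<le> j \<Longrightarrow> j \<le> card D \<Longrightarrow> alpha_sum n D j \<in> D" "alpha_sum n D j \<le> n"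
proof -
  have f: "finite D" using assms by (rule finite_subset) simp
  show 0: "alpha_sum n D 0 = 0" by (simp add: alpha_sum_def)
  show 1: "alpha_sum n D j = sorted_list_of_set D ! (j - 1)" if "1 \<le> j" "j \<le> card D" for j
    using that f by (cases j) (auto simp: alpha_sum_def nth_append)
  show 2: "alpha_sum n D j = n" if "card D < j" for j
    using that f by (auto simp: alpha_sum_def nth_append min_def)
  show 3: "alpha_sum n D j \<in> D" if "1 \<le> j" "j \<le> card D" for j
  proof -
    have "sorted_list_of_set D ! (j - 1) \<in> set (sorted_list_of_set D)" using that f by (intro nth_mem) auto
    then show ?thesis using 1[OF that] f by simp
  qed
  consider "j = 0" | "1 \<le> j \<and> j \<le> card D" | "card D < j" by linarith
  then show "alpha_sum n D j \<le> n"
  proof cases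
    case 2
    then show ?thesis using 3[of j] assms by fastforce
  qed (use 0 2[of j] in simp_all)
qed

text \<open>The partial sum is the \<open>j\<close>-th smallest descent, or \<open>n\<close> once
  the descents are exhausted. This turns dominance into counting descents in initial
  segments.\<close>

lemma alpha_sum_le_iff:
  assumes "D \<subseteq> {0<..<n}" "1 \<le> j" "p < n"
  shows "alpha_sum n D j \<le> p \<longleftrightarrow> j \<le> card (D \<inter> {1..p})"
proof -
  let ?xs = "sorted_list_of_set D"
  have f: "finite D" using assms(1) by (rule finite_subset) simp
  have l: "length ?xs = card D" "set ?xs = D" using f by simp_all
  have mono: "?xs ! a \<le> ?xs ! b" if "a \<le> b" "b < card D" for a b using that l by (simp add: sorted_nth_mono)
  have le: "card (D \<inter> {1..p}) \<le> card D" using f by (intro card_mono) auto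
  show ?thesis
  proof (cases "j \<le> card D")
    case False
    then show ?thesis using alpha_sum_simps(3)[OF assms(1), of j] assms(3) le by simp
  next
    case True
    have e: "alpha_sum n D j = ?xs ! (j - 1)" using alpha_sum_simps(2)[OF assms(1,2) True] .
    show ?thesis
    proof
      assume h: "alpha_sum n D j \<le> p"
      have "(!) ?xs ` {..<j} \<subseteq> D \<inter> {1..p}"
      proof
        fix y assume "y \<in> (!) ?xs ` {..<j}"
        then obtain a where a: "a < j" "y = ?xs ! a" by auto
        have "?xs ! a \<in> set ?xs" using a True l by (intro nth_mem) simp
        then have "y \<in> D" using a l by simp
        moreover have "a \<le> j - 1" "j - 1 < card D" using a(1) True assms(2) by linarith+
        then have "y \<le> p" using mono[of a "j - 1"] a(2) h e by simp
        ultimately show "y \<in> D \<inter> {1..p}" using assms(1) by auto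
      qed
      then have "card ((!) ?xs ` {..<j}) \<le> card (D \<inter> {1..p})" using f by (intro card_mono) auto
      moreover have "inj_on ((!) ?xs) {..<j}" using True l by (auto simp: inj_on_def nth_eq_iff_index_eq)
      ultimately show "j \<le> card (D \<inter> {1..p})" by (simp add: card_image)
    next
      assume h: "j \<le> card (D \<inter> {1..p})"
      show "alpha_sum n D j \<le> p"
      proof (rule ccontr)
        assume c: "\<not> alpha_sum n D j \<le> p"
        have "D \<inter> {1..p} \<subseteq> (!) ?xs ` {..<j - 1}"
        proof
          fix y assume y: "y \<in> D \<inter> {1..p}"
          then obtain a where a: "a < card D" "y = ?xs ! a" using l by (metis IntD1 in_set_conv_nth)
          have "a < j - 1"
          proof (rule ccontr)
            assume "\<not> a < j - 1"
            then show False using mono[of "j - 1" a] a y c e by simp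
          qed
          then show "y \<in> (!) ?xs ` {..<j - 1}" using a by blast
        qed
        then have "card (D \<inter> {1..p}) \<le> card ((!) ?xs ` {..<j - 1})" by (intro card_mono) auto
        also have "\<dots> \<le> j - 1" using card_image_le[of "{..<j - 1}" "(!) ?xs"] by simp
        finally show False using h assms(2) by simp
      qed
    qed
  qed
qed

lemma dominates_iff:
  assumes "D \<subseteq> {0<..<n}" "E \<subseteq> {0<..<n}"
  shows "dominates (alpha n D) (alpha n E) \<longleftrightarrow> (\<forall>j. alpha_sum n E j \<le> alpha_sum n D j)"
  using sum_alpha assms by (simp add: dominates_def)

text \<open>With fewer elements in every initial segment, the \<open>j\<close>-th element comes
  later.\<close>

lemma dominatesI:
  assumes "D \<subseteq> {0<..<n}" "E \<subseteq> {0<..<n}" "\<And>p. p < n \<Longrightarrow> card (D \<inter> {1..p}) \<le> card (E \<inter> {1..p})"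
  shows "dominates (alpha n D) (alpha n E)"
  unfolding dominates_iff[OF assms(1,2)]
proof
  fix j
  show "alpha_sum n E j \<le> alpha_sum n D j"
  proof (cases "j = 0 \<or> alpha_sum n D j = n")
    case True
    then show ?thesis using alpha_sum_simps(1,5)[OF assms(1)] alpha_sum_simps(1,5)[OF assms(2)] by auto
  next
    case False
    then have j: "1 \<le> j" "alpha_sum n D j < n" using alpha_sum_simps(5)[OF assms(1), of j] by auto
    then have "j \<le> card (D \<inter> {1..alpha_sum n D j})" using alpha_sum_le_iff[OF assms(1) j] by simp
    then have "j \<le> card (E \<inter> {1..alpha_sum n D j})" using assms(3)[OF j(2)] by simp
    then show ?thesis using alpha_sum_le_iff[OF assms(2) j] by simp
  qed
qed

lemma dominates_antisym:
  assumes "D \<subseteq> {0<..<n}" "E \<subseteq> {0<..<n}"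
    "dominates (alpha n D) (alpha n E)" "dominates (alpha n E) (alpha n D)"
  shows "D = E"
proof -
  have e: "alpha_sum n D j = alpha_sum n E j" for j
    using assms(3,4) unfolding dominates_iff[OF assms(1,2)] dominates_iff[OF assms(2,1)] by (simp add: le_antisym)
  have *: "X \<subseteq> Y" if X: "X \<subseteq> {0<..<n}" "Y \<subseteq> {0<..<n}" "\<And>j. alpha_sum n X j = alpha_sum n Y j" for X Y
  proof
    fix x assume x: "x \<in> X"
    have f: "finite X" using X(1) by (rule finite_subset) simp
    then obtain a where a: "a < card X" "x = sorted_list_of_set X ! a"
      using x by (metis in_set_conv_nth length_sorted_list_of_set set_sorted_list_of_set)
    then have xa: "alpha_sum n X (Suc a) = x" using alpha_sum_simps(2)[OF X(1), of "Suc a"] by simp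
    then have ya: "alpha_sum n Y (Suc a) = x" using X(3) by simp
    have "x < n" using x X(1) by auto
    then have "\<not> card Y < Suc a" using alpha_sum_simps(3)[OF X(2), of "Suc a"] ya by auto
    then show "x \<in> Y" using alpha_sum_simps(4)[OF X(2), of "Suc a"] ya by simp
  qed
  show ?thesis by (rule equalityI[OF *[OF assms(1,2) e] *[OF assms(2,1) e[symmetric]]])
qed

text \<open>At most \<open>p\<close> letters are smaller than \<open>sort v ! p\<close>, so one of
  the first \<open>p + 1\<close> letters of \<open>v\<close> is at least that large;
  \<open>yamanouchi_nth_le\<close> bounds it.\<close>

lemma sort_nth_le_card:
  assumes "yamanouchi v" "p < length v"
  shows "sort v ! p \<le> card (descents v \<inter> {1..p})"
proof -
  let ?c = "sort v ! p"
  have "\<exists>q\<le>p. ?c \<le> v ! q"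
  proof (rule ccontr)
    assume "\<not> ?thesis"
    then have lt: "v ! q < ?c" if "q \<le> p" for q using that not_le by blast
    then have all: "\<forall>x\<in>set (take (Suc p) v). x < ?c" by (auto simp: in_set_conv_nth less_Suc_eq_le)
    have "filter (\<lambda>x. x < ?c) (take (Suc p) v) = take (Suc p) v" using all by simp
    then have "Suc p \<le> length (filter (\<lambda>x. x < ?c) (take (Suc p) v))" using assms(2) by simp
    also have "\<dots> \<le> length (filter (\<lambda>x. x < ?c) v)"
      by (metis append_take_drop_id filter_append le_add1 length_append)
    also have "\<dots> = size (filter_mset (\<lambda>x. x < ?c) (mset v))" by (metis mset_filter size_mset)
    also have "\<dots> = length (filter (\<lambda>x. x < ?c) (sort v))" by (metis mset_filter mset_sort size_mset)
    also have "\<dots> = length (filter (\<lambda>x. x < ?c) (take p (sort v))) + length (filter (\<lambda>x. x < ?c) (drop p (sort v)))"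
      by (metis append_take_drop_id filter_append length_append)
    also have "filter (\<lambda>x. x < ?c) (drop p (sort v)) = []"
    proof -
      have "?c \<le> x" if h: "x \<in> set (drop p (sort v))" for x
      proof -
        obtain i where "i < length v - p" "x = sort v ! (p + i)"
          using h assms(2) by (auto simp: in_set_conv_nth)
        then show ?thesis by (simp add: sorted_nth_mono)
      qed
      then show ?thesis by (auto simp: filter_empty_conv not_less)
    qed
    also have "length (filter (\<lambda>x. x < ?c) (take p (sort v))) + length ([] :: nat list) \<le> p"
      using length_filter_le[of "\<lambda>x. x < ?c" "take p (sort v)"] by simp
    finally show False by simp
  qed
  then obtain q where q: "q \<le> p" "?c \<le> v ! q" by blast
  have "v ! q \<le> card (descents v \<inter> {1..q})" using yamanouchi_nth_le[OF assms(1)] q(1) assms(2) by simp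
  also have "\<dots> \<le> card (descents v \<inter> {1..p})" using q(1) by (intro card_mono) auto
  finally show ?thesis using q(2) by simp
qed

lemma sort_dominates:
  assumes "yamanouchi v" "length v = n"
  shows "dominates (alpha n (descents (sort v))) (alpha n (descents v))"
proof (rule dominatesI)
  show "descents (sort v) \<subseteq> {0<..<n}" "descents v \<subseteq> {0<..<n}" using assms(2) by (intro descents_sub; simp)+
  show "card (descents (sort v) \<inter> {1..p}) \<le> card (descents v \<inter> {1..p})" if "p < n" for p
    using sort_nth_le_card[OF assms(1), of p] sorted_yam_nth[OF yamanouchi_sort_mset[OF assms(1)], of p] that assms(2) by simp
qed

section \<open>Partitions and sorted Yamanouchi words\<close>

lemma is_shape_shp_ex:
  assumes "is_shape M"
  shows "\<exists>la. is_partition la \<and> shape_of la = M"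
proof -
  have am: "count M b \<le> count M a" if "a \<le> b" for a b
    using lift_Suc_antimono_le[of "count M" a b] assms that unfolding is_shape_def by blast
  define k where "k = (LEAST r. count M r = 0)"
  have "\<exists>r. r \<notin># M" using ex_new_if_finite[OF infinite_UNIV_nat finite_set_mset[of M]] by blast
  then have "\<exists>r. count M r = 0" by (simp add: not_in_iff)
  then have k0: "count M k = 0" unfolding k_def by (rule LeastI_ex)
  have kl: "0 < count M r" if "r < k" for r using not_less_Least[of r "\<lambda>r. count M r = 0"] that k_def by auto
  let ?la = "map (count M) [0..<k]"
  have "is_partition ?la" unfolding is_partition_def using am kl by (auto simp: sorted_wrt_iff_nth_less)
  moreover have "shape_of ?la = M"
  proof (rule multiset_eqI)
    fix r
    show "count (shape_of ?la) r = count M r" using am[of k r] k0 by (auto simp: count_shp)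
  qed
  ultimately show ?thesis by blast
qed

definition row_word :: "nat list \<Rightarrow> nat list" where
  "row_word la = concat (map (\<lambda>r. replicate (la ! r) r) [0..<length la])"

lemma row_word_snoc: "row_word (la @ [x]) = row_word la @ replicate x (length la)"
proof -
  have "map (\<lambda>r. replicate ((la @ [x]) ! r) r) [0..<length la] = map (\<lambda>r. replicate (la ! r) r) [0..<length la]"
    by (auto simp: nth_append)
  then have "concat (map (\<lambda>r. replicate ((la @ [x]) ! r) r) [0..<length (la @ [x])])
      = concat (map (\<lambda>r. replicate (la ! r) r) [0..<length la]) @ replicate x (length la)"
    by (simp del: map_eq_conv)
  then show ?thesis by (simp add: row_word_def)
qed

lemma row_word_props: "length (row_word la) = sum_list la \<and> sorted (row_word la) \<and> (\<forall>x\<in>set (row_word la). x < length la)"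
proof (induction la rule: rev_induct)
  case Nil
  then show ?case by (simp add: row_word_def)
next
  case (snoc x la)
  then show ?case by (auto simp: row_word_snoc sorted_append less_Suc_eq)
qed

lemma descents_replicate:
  assumes "\<forall>y\<in>set u. y < c" "0 < x"
  shows "descents (u @ replicate x c) = descents u \<union> (if u = [] then {} else {length u})"
proof (intro set_eqI)
  fix j
  consider "j < length u" | "j = length u" | "length u < j" by linarith
  then show "j \<in> descents (u @ replicate x c) \<longleftrightarrow> j \<in> descents u \<union> (if u = [] then {} else {length u})"
  proof cases
    case 1
    then show ?thesis using descents_append[OF 1, of "replicate x c"] by (auto split: if_splits)
  next
    case 2
    then show ?thesis using assms by (auto simp: descents_def nth_append)
  next
    case 3
    then show ?thesis by (auto simp: descents_def nth_append)
  qed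
qed

lemma descents_rw:
  "\<forall>x\<in>set la. 0 < x \<Longrightarrow> descents (row_word la) = (\<lambda>i. sum_list (take i la)) ` {1..<length la}"
proof (induction la rule: rev_induct)
  case Nil
  then show ?case by (simp add: row_word_def descents_def)
next
  case (snoc x la)
  have e: "row_word la = [] \<longleftrightarrow> la = []"
  proof -
    have "length (row_word la) = sum_list la" using row_word_props by blast
    then show ?thesis using snoc.prems by (cases la) auto
  qed
  have "descents (row_word (la @ [x])) = descents (row_word la) \<union> (if row_word la = [] then {} else {length (row_word la)})"
    unfolding row_word_snoc by (rule descents_replicate) (use row_word_props snoc.prems in auto)
  also have "\<dots> = (\<lambda>i. sum_list (take i la)) ` {1..<length la} \<union> (if la = [] then {} else {sum_list la})"
    using snoc e row_word_props[of la] by simp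
  also have "\<dots> = (\<lambda>i. sum_list (take i (la @ [x]))) ` {1..<length (la @ [x])}"
  proof (cases "la = []")
    case False
    then have "{1..<length (la @ [x])} = insert (length la) {1..<length la}" by (auto simp: less_Suc_eq Suc_le_eq)
    moreover have "(\<lambda>i. sum_list (take i (la @ [x]))) ` {1..<length la} = (\<lambda>i. sum_list (take i la)) ` {1..<length la}"
      by (intro image_cong) auto
    ultimately show ?thesis using False by simp
  qed simp
  finally show ?case .
qed

lemma alpha_rw:
  assumes "is_partition la" "0 < sum_list la"
  shows "alpha (sum_list la) (descents (row_word la)) = la"
proof -
  have pos: "\<forall>x\<in>set la. 0 < x" using assms(1) by (simp add: is_partition_def)
  have ne: "la \<noteq> []" using assms(2) by auto
  define ps where "ps = map (\<lambda>i. sum_list (take i la)) [1..<length la]"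
  have st: "sum_list (take (Suc i) la) = sum_list (take i la) + la ! i" if "i < length la" for i
    using that by (simp add: take_Suc_conv_app_nth)
  have lt: "sum_list (take i la) < sum_list (take j la)" if "i < j" "j \<le> length la" for i j
    using that
  proof (induction j)
    case (Suc j)
    have "0 < la ! j" using pos Suc.prems by simp
    then show ?case using Suc st[of j] by (cases "i = j") auto
  qed simp
  have "sorted_wrt (<) ps" unfolding ps_def using lt by (auto simp: sorted_wrt_iff_nth_less)
  moreover have "set ps = descents (row_word la)" unfolding ps_def descents_rw[OF pos] by simp
  ultimately have ssyt_of: "sorted_list_of_set (descents (row_word la)) = ps"
    by (metis sorted_list_of_set_unique finite_set strict_sorted_iff length_remdups_card_conv remdups_id_iff_distinct)
  have lp: "length ps = length la - 1" by (simp add: ps_def)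
  show ?thesis unfolding alpha_def Let_def ssyt_of
  proof (rule nth_equalityI)
    show "length (map2 (-) (ps @ [sum_list la]) (0 # ps)) = length la" using lp ne by (cases la) simp_all
    fix i assume "i < length (map2 (-) (ps @ [sum_list la]) (0 # ps))"
    then have i: "i < length la" using lp ne by (cases la) simp_all
    have "(ps @ [sum_list la]) ! i = sum_list (take (Suc i) la)"
    proof (cases "i < length ps")
      case True
      then show ?thesis by (simp add: nth_append ps_def)
    next
      case False
      then have "i = length ps" "Suc i = length la" using i lp by auto
      then show ?thesis by simp
    qed
    moreover have "(0 # ps) ! i = sum_list (take i la)"
      using i by (cases i) (auto simp: ps_def)
    ultimately show "map2 (-) (ps @ [sum_list la]) (0 # ps) ! i = la ! i"
      using i lp st[OF i] by simp
  qed
qed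

text \<open>A sorted word lists the rows of its shape one after the other, so its descents are the
  partial sums of the row lengths. Positivity of \<open>n\<close> matters: \<open>alpha 0 {}\<close>
  is \<open>[0]\<close>, which has a zero part.\<close>

lemma alpha_sorted_yam:
  assumes "yamanouchi w" "sorted w" "length w = n" "0 < n"
  shows "is_partition (alpha n (descents w))" "shape_of (alpha n (descents w)) = mset w"
proof -
  obtain la where la: "is_partition la" "shape_of la = mset w" using is_shape_shp_ex[OF yamanouchi_dec[OF assms(1)]] by blast
  have "mset (row_word la) = mset w" using la(2) by (simp add: shape_of_def row_word_def)
  then have row_word: "row_word la = w" using row_word_props[of la] assms(2) by (metis properties_for_sort sorted_sort_id)
  have "sum_list la = n" using row_word_props[of la] row_word assms(3) by simp
  then have "alpha n (descents w) = la" using alpha_rw[OF la(1)] row_word assms(4) by simp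
  then show "is_partition (alpha n (descents w))" "shape_of (alpha n (descents w)) = mset w" using la by simp_all
qed

lemma finite_partitions: "finite (partitions n)"
proof (rule finite_subset)
  show "partitions n \<subseteq> {xs. set xs \<subseteq> {0..n} \<and> length xs \<le> n}"
  proof
    fix la assume "la \<in> partitions n"
    then have p: "\<forall>x\<in>set la. 0 < x" "sum_list la = n" by (auto simp: partitions_def is_partition_def)
    have "length la \<le> sum_list la" using p(1) by (induction la) (auto simp: Suc_le_eq)
    moreover have "x \<le> n" if "x \<in> set la" for x using member_le_sum_list[OF that] p(2) by simp
    ultimately show "la \<in> {xs. set xs \<subseteq> {0..n} \<and> length xs \<le> n}" using p(2) by auto
  qed
qed (simp add: finite_lists_length_le)

section \<open>Dominant elements and generating functions read off from the words\<close>

locale word_model = dual n A Des \<phi> for n A Des \<phi> +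
  fixes F :: "'a \<Rightarrow> nat list"
  assumes mod: "model n A Des \<phi> F" and n0: "0 < n"
    and Dsub: "T \<in> A \<Longrightarrow> Des T \<subseteq> {0<..<n}"
begin

lemma Des_ds:
  assumes "T \<in> A"
  shows "Des T = descents (F T)"
proof (intro set_eqI)
  fix j
  show "j \<in> Des T \<longleftrightarrow> j \<in> descents (F T)"
  proof (cases "0 < j \<and> j < n")
    case True
    then show ?thesis using modelD(3)[OF mod assms, of j] by simp
  next
    case False
    then show ?thesis using Dsub[OF assms] descents_sub[OF modelD(2)[OF mod assms]] by auto
  qed
qed

lemma class_eq: "T \<in> A \<Longrightarrow> eq_class A \<phi> {1<..<n} T = {U. reachable \<phi> {2..<n} T U}"
proof -
  assume T: "T \<in> A"
  have I: "{1<..<n} = {2..<n}" by auto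
  show ?thesis unfolding I by (rule eq_class_conn[OF _ T]) (simp add: closed)
qed

lemma dominant_alt:
  "dominant n A Des \<phi> T \<longleftrightarrow> T \<in> A \<and>
     (\<forall>S. reachable \<phi> {2..<n} T S \<longrightarrow> dominates (alpha n (descents (F T))) (alpha n (descents (F S))))"
proof (cases "T \<in> A")
  case True
  have "Des S = descents (F S)" if "reachable \<phi> {2..<n} T S" for S using Des_ds reachable_in[OF that _ True] by simp
  then have "(\<forall>S\<in>eq_class A \<phi> {1<..<n} T. dominates (alpha n (Des T)) (alpha n (Des S)))
      \<longleftrightarrow> (\<forall>S. reachable \<phi> {2..<n} T S \<longrightarrow> dominates (alpha n (descents (F T))) (alpha n (descents (F S))))"
    unfolding class_eq[OF True] Des_ds[OF True] by (metis mem_Collect_eq)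
  then show ?thesis unfolding dominant_def using True by blast
qed (simp add: dominant_def)

lemma top_exists:
  assumes "T \<in> A"
  obtains U where "U \<in> A" "reachable \<phi> {2..<n} T U" "F U = sort (F T)"
  by (rule model_reach[OF dual_axioms mod assms yamanouchi_sort_mset[OF modelD(1)[OF mod assms]]]) (simp_all add: that)

text \<open>Sorted words dominate by \<open>sort_dominates\<close>. Conversely, every class contains
  an element with the sorted word; antisymmetry gives a dominant element the descents of that word,
  and \<open>descents_sort_unique\<close> gives it the word itself.\<close>

lemma dominant_iff: "dominant n A Des \<phi> T \<longleftrightarrow> T \<in> A \<and> sorted (F T)"
proof
  assume d: "dominant n A Des \<phi> T"
  then have T: "T \<in> A" using dominant_alt by blast
  note y = modelD(1,2)[OF mod T]
  obtain U where U: "U \<in> A" "reachable \<phi> {2..<n} T U" "F U = sort (F T)" using top_exists[OF T] by blast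
  have "dominates (alpha n (descents (F T))) (alpha n (descents (sort (F T))))"
    using d U(2) unfolding dominant_alt U(3)[symmetric] by blast
  moreover have "descents (F T) \<subseteq> {0<..<n}" "descents (sort (F T)) \<subseteq> {0<..<n}" using y(2) by (intro descents_sub; simp)+
  ultimately have "descents (F T) = descents (sort (F T))" using dominates_antisym sort_dominates[OF y] by blast
  then have "F T = sort (F T)" by (intro descents_sort_unique[OF y(1,1)]) simp_all
  then show "T \<in> A \<and> sorted (F T)" using T by (metis sorted_sort)
next
  assume h: "T \<in> A \<and> sorted (F T)"
  show "dominant n A Des \<phi> T" unfolding dominant_alt
  proof (intro conjI allI impI)
    fix S assume S: "reachable \<phi> {2..<n} T S"
    have SA: "S \<in> A" using reachable_in[OF S] h by simp
    have "mset (F S) = mset (F T)" using model_mset[OF dual_axioms mod _ S] h by simp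
    then have "sort (F S) = F T" using h by (metis properties_for_sort)
    then show "dominates (alpha n (descents (F T))) (alpha n (descents (F S)))"
      using sort_dominates[OF modelD(1,2)[OF mod SA]] by simp
  qed (use h in simp)
qed

lemma dominant_unique:
  assumes "T \<in> A"
  shows "\<exists>!U. U \<in> eq_class A \<phi> {1<..<n} T \<and> dominant n A Des \<phi> U"
proof -
  obtain U where U: "U \<in> A" "reachable \<phi> {2..<n} T U" "F U = sort (F T)" using top_exists[OF assms] by blast
  show ?thesis unfolding class_eq[OF assms] dominant_iff
  proof (rule ex1I)
    show "U \<in> {U. reachable \<phi> {2..<n} T U} \<and> U \<in> A \<and> sorted (F U)" using U by simp
    fix V assume V: "V \<in> {U. reachable \<phi> {2..<n} T U} \<and> V \<in> A \<and> sorted (F V)"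
    then have c: "reachable \<phi> {2..<n} T V" by simp
    have "mset (F V) = mset (F T)" using model_mset[OF dual_axioms mod assms c] .
    then have "F V = F U" using V U(3) by (metis properties_for_sort)
    moreover have "reachable \<phi> {2..<n} V U" using reachable_trans[OF reachable_sym[OF c _ assms] U(2)] by simp
    ultimately show "V = U" using modelD(5)[OF mod, of V U] V by blast
  qed
qed

lemma alpha_dominant:
  assumes "dominant n A Des \<phi> T"
  shows "is_partition (alpha n (Des T))" "shape_of (alpha n (Des T)) = mset (F T)"
    "sum_list (alpha n (Des T)) = n"
proof -
  have T: "T \<in> A" "sorted (F T)" using assms dominant_iff by auto
  note y = modelD(1,2)[OF mod T(1)]
  show "is_partition (alpha n (Des T))" and s: "shape_of (alpha n (Des T)) = mset (F T)"
    unfolding Des_ds[OF T(1)] using alpha_sorted_yam[OF y(1) T(2) y(2) n0] by simp_all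
  show "sum_list (alpha n (Des T)) = n" using arg_cong[OF s, of size] y(2) by (simp add: size_shp)
qed

text \<open>\<open>F\<close> maps the class bijectively onto the Yamanouchi words of its shape,
  which is the shape given by \<open>alpha\<close> at the dominant element;
  \<open>schur_coef_eq\<close> sums them up.\<close>

lemma class_sum:
  assumes "dominant n A Des \<phi> T"
  shows "(\<Sum>U\<in>{U. reachable \<phi> {2..<n} T U}. Qcoef n (Des U) a) = schur_coef (alpha n (Des T)) a"
proof -
  have T: "T \<in> A" using assms dominant_iff by auto
  have CA: "U \<in> A" if "reachable \<phi> {2..<n} T U" for U using reachable_in[OF that _ T] by simp
  have "bij_betw F {U. reachable \<phi> {2..<n} T U} (yam_words (mset (F T)))"
    unfolding bij_betw_def
  proof
    show "inj_on F {U. reachable \<phi> {2..<n} T U}"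
    proof (rule inj_onI)
      fix U V assume h: "U \<in> {U. reachable \<phi> {2..<n} T U}" "V \<in> {U. reachable \<phi> {2..<n} T U}" "F U = F V"
      then have c: "reachable \<phi> {2..<n} T U" "reachable \<phi> {2..<n} T V" by simp_all
      have "reachable \<phi> {2..<n} U V" using reachable_trans[OF reachable_sym[OF c(1) _ T] c(2)] by simp
      then show "U = V" using modelD(5)[OF mod CA[OF c(1)]] h(3) by blast
    qed
    show "F ` {U. reachable \<phi> {2..<n} T U} = yam_words (mset (F T))"
    proof (intro equalityI subsetI)
      fix w assume "w \<in> F ` {U. reachable \<phi> {2..<n} T U}"
      then obtain U where U: "reachable \<phi> {2..<n} T U" "w = F U" by blast
      then show "w \<in> yam_words (mset (F T))"
        using modelD(1)[OF mod CA[OF U(1)]] model_mset[OF dual_axioms mod T U(1)] by (simp add: yam_words_def)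
    next
      fix w assume "w \<in> yam_words (mset (F T))"
      then have w: "yamanouchi w" "mset w = mset (F T)" by (simp_all add: yam_words_def)
      obtain U where "reachable \<phi> {2..<n} T U" "F U = w" using model_reach[OF dual_axioms mod T w] by blast
      then show "w \<in> F ` {U. reachable \<phi> {2..<n} T U}" by blast
    qed
  qed
  then have "(\<Sum>U\<in>{U. reachable \<phi> {2..<n} T U}. Qcoef n (descents (F U)) a) = (\<Sum>w\<in>yam_words (mset (F T)). Qcoef n (descents w) a)"
    by (rule sum.reindex_bij_betw)
  moreover have "(\<Sum>U\<in>{U. reachable \<phi> {2..<n} T U}. Qcoef n (Des U) a)
      = (\<Sum>U\<in>{U. reachable \<phi> {2..<n} T U}. Qcoef n (descents (F U)) a)"
    using Des_ds CA by (intro sum.cong) auto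
  ultimately show ?thesis
    using schur_coef_eq[OF alpha_dominant(1)[OF assms], of a] alpha_dominant(2,3)[OF assms] by simp
qed

lemma stat_conn:
  assumes "\<And>i T. 1 < i \<Longrightarrow> i < n \<Longrightarrow> T \<in> A \<Longrightarrow> stat (\<phi> i T) = stat T" "T \<in> A" "reachable \<phi> {2..<n} T U"
  shows "stat U = stat T"
proof -
  obtain p where p: "set p \<subseteq> {2..<n}" "fold \<phi> p T = U" using assms(3) unfolding reachable_def by blast
  have "stat (fold \<phi> p T) = stat T" using p(1) assms(2)
  proof (induction p arbitrary: T)
    case (Cons i p)
    then have i: "2 \<le> i" "i < n" "set p \<subseteq> {2..<n}" by auto
    show ?case using Cons.IH[OF i(3) closed[OF i(1,2) Cons.prems(2)]] assms(1)[of i T] i Cons.prems(2) by simp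
  qed simp
  then show ?thesis using p(2) by simp
qed

text \<open>A level set of \<open>stat\<close> is a disjoint union of classes, one for each dominant
  element in it.\<close>

lemma stat_sum:
  assumes "\<And>i T. 1 < i \<Longrightarrow> i < n \<Longrightarrow> T \<in> A \<Longrightarrow> stat (\<phi> i T) = stat T"
  shows "(\<Sum>T\<in>{T\<in>A. stat T = m}. Qcoef n (Des T) a)
    = (\<Sum>T\<in>{T. dominant n A Des \<phi> T \<and> stat T = m}. schur_coef (alpha n (Des T)) a)"
proof -
  let ?D = "{T. dominant n A Des \<phi> T \<and> stat T = m}"
  let ?C = "\<lambda>T. {U. reachable \<phi> {2..<n} T U}"
  have DA: "T \<in> A" if "T \<in> ?D" for T using that dominant_iff by simp
  have un: "{T\<in>A. stat T = m} = (\<Union>T\<in>?D. ?C T)"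
  proof (intro equalityI subsetI)
    fix T assume "T \<in> {T\<in>A. stat T = m}"
    then have T: "T \<in> A" "stat T = m" by simp_all
    obtain U where U: "U \<in> A" "reachable \<phi> {2..<n} T U" "F U = sort (F T)" using top_exists[OF T(1)] by blast
    have "dominant n A Des \<phi> U" using U dominant_iff by simp
    moreover have "stat U = m" using stat_conn[where stat=stat, OF assms T(1) U(2)] T(2) by simp
    moreover have "T \<in> ?C U" using reachable_sym[OF U(2) _ T(1)] by simp
    ultimately show "T \<in> (\<Union>T\<in>?D. ?C T)" by blast
  next
    fix T assume "T \<in> (\<Union>T\<in>?D. ?C T)"
    then obtain U where U: "U \<in> ?D" "reachable \<phi> {2..<n} U T" by blast
    then show "T \<in> {T\<in>A. stat T = m}"
      using stat_conn[where stat=stat, OF assms DA[OF U(1)] U(2)] reachable_in[OF U(2) _ DA[OF U(1)]] by simp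
  qed
  have disj: "?C T \<inter> ?C U = {}" if h: "T \<in> ?D" "U \<in> ?D" "T \<noteq> U" for T U
  proof (rule ccontr)
    assume "?C T \<inter> ?C U \<noteq> {}"
    then obtain V where V: "reachable \<phi> {2..<n} T V" "reachable \<phi> {2..<n} U V" by blast
    have "reachable \<phi> {2..<n} V U" using reachable_sym[OF V(2) _ DA[OF h(2)]] by simp
    then have "reachable \<phi> {2..<n} T U" by (rule reachable_trans[OF V(1)])
    then have "U \<in> eq_class A \<phi> {1<..<n} T" "T \<in> eq_class A \<phi> {1<..<n} T"
      using class_eq[OF DA[OF h(1)]] by simp_all
    then show False using dominant_unique[OF DA[OF h(1)]] h by blast
  qed
  have fin: "finite ?D" using DA by (intro finite_subset[OF _ finA]) blast
  have finC: "finite (?C T)" if "T \<in> ?D" for T using DA[OF that] by simp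
  have "(\<Sum>T\<in>{T\<in>A. stat T = m}. Qcoef n (Des T) a) = (\<Sum>T\<in>?D. \<Sum>U\<in>?C T. Qcoef n (Des U) a)"
    unfolding un using fin finC disj by (intro sum.UNION_disjoint) blast+
  also have "\<dots> = (\<Sum>T\<in>?D. schur_coef (alpha n (Des T)) a)"
    by (intro sum.cong) (simp_all add: class_sum)
  finally show ?thesis .
qed

lemma group_by_shape:
  "(\<Sum>T\<in>{T. dominant n A Des \<phi> T \<and> stat T = m}. schur_coef (alpha n (Des T)) a)
    = (\<Sum>la\<in>partitions n. int (card {T. dominant n A Des \<phi> T \<and> alpha n (Des T) = la \<and> stat T = m}) * schur_coef la a)"
proof -
  let ?D = "{T. dominant n A Des \<phi> T \<and> stat T = m}"
  have fin: "finite ?D" using dominant_iff by (intro finite_subset[OF _ finA]) auto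
  have "(\<lambda>T. alpha n (Des T)) ` ?D \<subseteq> partitions n"
    using alpha_dominant(1,3) by (auto simp: partitions_def)
  then have "(\<Sum>T\<in>?D. schur_coef (alpha n (Des T)) a)
      = (\<Sum>la\<in>partitions n. \<Sum>T\<in>{T \<in> ?D. alpha n (Des T) = la}. schur_coef (alpha n (Des T)) a)"
    by (rule sum.group[OF fin finite_partitions, symmetric])
  also have "\<dots> = (\<Sum>la\<in>partitions n. int (card {T. dominant n A Des \<phi> T \<and> alpha n (Des T) = la \<and> stat T = m}) * schur_coef la a)"
  proof (rule sum.cong)
    fix la
    have "{T \<in> ?D. alpha n (Des T) = la} = {T. dominant n A Des \<phi> T \<and> alpha n (Des T) = la \<and> stat T = m}" by auto
    moreover have "(\<Sum>T\<in>{T \<in> ?D. alpha n (Des T) = la}. schur_coef (alpha n (Des T)) a)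
        = (\<Sum>T\<in>{T \<in> ?D. alpha n (Des T) = la}. schur_coef la a)" by (intro sum.cong) auto
    ultimately show "(\<Sum>T\<in>{T \<in> ?D. alpha n (Des T) = la}. schur_coef (alpha n (Des T)) a)
        = int (card {T. dominant n A Des \<phi> T \<and> alpha n (Des T) = la \<and> stat T = m}) * schur_coef la a"
      by simp
  qed simp
  finally show ?thesis .
qed

end

text \<open>The identities are read coefficientwise: \<open>m\<close> selects the power of q and
  \<open>a\<close> the monomial in the variables. Since \<open>stat\<close> may take values in any
  type, vector-valued statistics are included.\<close>

theorem theorem4p6:
  fixes A :: "'a set" and Des :: "'a \<Rightarrow> nat set" and \<phi> :: "nat \<Rightarrow> 'a \<Rightarrow> 'a"
    and stat :: "'a \<Rightarrow> 's" and n :: nat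
  assumes "finite A" and "0 < n"
    and "\<forall>T\<in>A. Des T \<subseteq> {1..n - 1}"
    and "involutions_on n A \<phi>"
    and "dual_equivalence n A Des \<phi>"
    and "\<forall>i. 1 < i \<and> i < n \<longrightarrow> (\<forall>T\<in>A. stat (\<phi> i T) = stat T)"
  shows "(\<forall>T\<in>A. \<exists>!U. U \<in> eq_class A \<phi> {1<..<n} T \<and> dominant n A Des \<phi> U)
    \<and> (\<forall>T. dominant n A Des \<phi> T \<longrightarrow> is_partition (alpha n (Des T)))
    \<and> (\<forall>m a. (\<Sum>T\<in>{T\<in>A. stat T = m}. Qcoef n (Des T) a)
             = (\<Sum>T\<in>{T. dominant n A Des \<phi> T \<and> stat T = m}. schur_coef (alpha n (Des T)) a))
    \<and> (\<forall>m a. (\<Sum>T\<in>{T\<in>A. stat T = m}. Qcoef n (Des T) a)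
             = (\<Sum>la\<in>partitions n.
                  int (card {T. dominant n A Des \<phi> T \<and> alpha n (Des T) = la \<and> stat T = m})
                  * schur_coef la a))"
proof -
  have d: "dual n A Des \<phi>" by (rule dual_equivalence_dual[OF assms(1,4,5)])
  then obtain F where F: "model n A Des \<phi> F" using model_exists by blast
  have sub: "Des T \<subseteq> {0<..<n}" if "T \<in> A" for T
  proof -
    have "{1..n - 1} = {0<..<n}" using assms(2) by auto
    then show ?thesis using assms(3) that by simp
  qed
  interpret word_model n A Des \<phi> F
    by (intro word_model.intro word_model_axioms.intro d F assms(2) sub)
  have st: "stat (\<phi> i T) = stat T" if "1 < i" "i < n" "T \<in> A" for i T using assms(6) that by blast
  show ?thesis
  proof (intro conjI ballI allI impI)
    show "\<exists>!U. U \<in> eq_class A \<phi> {1<..<n} T \<and> dominant n A Des \<phi> U" if "T \<in> A" for T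
      by (rule dominant_unique[OF that])
    show "is_partition (alpha n (Des T))" if "dominant n A Des \<phi> T" for T by (rule alpha_dominant(1)[OF that])
    fix m a
    show "(\<Sum>T\<in>{T\<in>A. stat T = m}. Qcoef n (Des T) a)
             = (\<Sum>T\<in>{T. dominant n A Des \<phi> T \<and> stat T = m}. schur_coef (alpha n (Des T)) a)"
      by (rule stat_sum[OF st])
    then show "(\<Sum>T\<in>{T\<in>A. stat T = m}. Qcoef n (Des T) a)
             = (\<Sum>la\<in>partitions n.
                  int (card {T. dominant n A Des \<phi> T \<and> alpha n (Des T) = la \<and> stat T = m})
                  * schur_coef la a)"
      using group_by_shape by simp
  qed
qed

end
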